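(* Let $M$ be a finite-dimensional smooth manifold, $f$ a complete smooth vector field on $M$, and consider the dynamical system $\frac{d}{dt}x(t)=f(x(t))$ on $M$. Then the Koopman operator $U_t$ associated with the system satisfies the linear differential equation system on $\mathrm{Aut}(C^\infty(M))$ given by $$\frac{d}{dt}U_t=U_t\mathcal{L}_f=\mathcal{L}_fU_t .$$
   Context: Let $\Phi:\mathbb{R}\times M\to M$ be the global flow of $f$ and $\Phi_t=\Phi(t,\cdot)$. The Koopman operator is $U_t:C^\infty(M)\to C^\infty(M)$, $U_th=h\circ\Phi_t$. The $C^\infty$-topology on $C^\infty(M)$ is generated by the seminorms $\|h\|_{i,j}=\sup_{x\in\overline{V}_i}|D^jh(x)|$, $i,j\in\mathbb{N}$, where $\{V_i\}$ is an increasing open cover of $M$ by precompact open sets with $\overline{V}_i\subset V_{i+1}$, and $D^j:C^\infty(M)\to C^\infty(\otimes^jT^*M)$ is the $j$-th iterated covariant derivative; the topology does not depend on these choices. $\mathrm{Aut}(C^\infty(M))$ is the group of invertible bounded (continuous) linear operators from $C^\infty(M)$ to itself. $\mathcal{L}_f$ is the Lie derivative, $\mathcal{L}_fh=dh(f)$. The operator differential equation is understood in the strong operator topology: for every $h\in C^\infty(M)$, $\frac{d}{dt}(U_th)=U_t\mathcal{L}_fh=\mathcal{L}_fU_th$, with the derivative taken in the $C^\infty$-topology. *)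

theory Defs
  imports "HOL-Analysis.Analysis"
begin

section \<open>Calculus on the model space\<close>

text \<open>
  Manifolds are modelled on a vector space \<open>E\<close> inside a type of class \<^class>\<open>euclidean_space\<close>.
  Such types have positive dimension, so \<open>E\<close> is allowed to be either the whole type or
  the zero space; the latter is the case of dimension 0.  Derivatives are taken within \<open>E\<close> and
  only in directions belonging to \<open>E\<close>, so for \<open>E = {0}\<close> they vanish; for \<open>E = UNIV\<close> they
  are the usual Frechet derivatives.
\<close>

definition model_space :: "'e::euclidean_space set \<Rightarrow> bool" where
  "model_space E \<longleftrightarrow> E = UNIV \<or> E = {0}"

definition dir_deriv ::
    "'e::euclidean_space set \<Rightarrow> ('e \<Rightarrow> 'b::real_normed_vector) \<Rightarrow> 'e \<Rightarrow> 'e \<Rightarrow> 'b" where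
  "dir_deriv E F x v = frechet_derivative F (at x within E) v"

primrec Ck_on ::
    "nat \<Rightarrow> 'e::euclidean_space set \<Rightarrow> 'e set \<Rightarrow> ('e \<Rightarrow> 'b::real_normed_vector) \<Rightarrow> bool" where
  "Ck_on 0 E S F \<longleftrightarrow> continuous_on S F"
| "Ck_on (Suc k) E S F \<longleftrightarrow>
     (\<forall>x\<in>S. F differentiable (at x within E)) \<and> (\<forall>v\<in>E. Ck_on k E S (\<lambda>x. dir_deriv E F x v))"

definition smooth_on ::
    "'e::euclidean_space set \<Rightarrow> 'e set \<Rightarrow> ('e \<Rightarrow> 'b::real_normed_vector) \<Rightarrow> bool" where
  "smooth_on E S F \<longleftrightarrow> (\<forall>k. Ck_on k E S F)"


section \<open>Smooth manifolds and smooth functions\<close>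

text \<open>
  A chart is a pair of its domain and its coordinate map, the values of the map outside the
  domain being irrelevant.  The underlying set of the manifold is the whole type \<open>'a\<close>; the
  Hausdorff property and second countability are the type classes \<^class>\<open>t2_space\<close> and
  \<^class>\<open>second_countable_topology\<close>.  The smooth structure is the one determined by the
  (not necessarily maximal) atlas \<open>A\<close>.
\<close>

type_synonym ('a, 'e) chart = "'a set \<times> ('a \<Rightarrow> 'e)"

definition chart_inv :: "('a, 'e) chart \<Rightarrow> 'e \<Rightarrow> 'a" where
  "chart_inv c = inv_into (fst c) (snd c)"

definition transition :: "('a, 'e) chart \<Rightarrow> ('a, 'e) chart \<Rightarrow> 'e \<Rightarrow> 'e" where
  "transition c d = snd d \<circ> chart_inv c"

definition is_chart :: "'e::euclidean_space set \<Rightarrow> ('a::topological_space, 'e) chart \<Rightarrow> bool" where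
  "is_chart E c \<longleftrightarrow>
     open (fst c) \<and> openin (top_of_set E) (snd c ` fst c) \<and>
     homeomorphism (fst c) (snd c ` fst c) (snd c) (chart_inv c)"

definition smooth_manifold ::
    "'e::euclidean_space set \<Rightarrow> ('a::{t2_space,second_countable_topology}, 'e) chart set \<Rightarrow> bool" where
  "smooth_manifold E A \<longleftrightarrow>
     model_space E \<and> (\<forall>c\<in>A. is_chart E c) \<and> (\<Union>c\<in>A. fst c) = UNIV \<and>
     (\<forall>c\<in>A. \<forall>d\<in>A. smooth_on E (snd c ` (fst c \<inter> fst d)) (transition c d))"

text \<open>An arbitrary chart of the atlas around a point; it is only used to evaluate expressions
  that do not depend on the chart.\<close>

definition chart_at :: "('a, 'e) chart set \<Rightarrow> 'a \<Rightarrow> ('a, 'e) chart" where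
  "chart_at A p = (SOME c. c \<in> A \<and> p \<in> fst c)"

definition smooth_functions ::
    "'e::euclidean_space set \<Rightarrow> ('a, 'e) chart set \<Rightarrow> ('a \<Rightarrow> real) set" where
  "smooth_functions E A = {h. \<forall>c\<in>A. smooth_on E (snd c ` fst c) (h \<circ> chart_inv c)}"


section \<open>Vector fields, Lie derivative and flow\<close>

text \<open>
  A tangent vector at \<open>p\<close> is a family of coordinate vectors, one for each chart around \<open>p\<close>,
  transforming by the derivatives of the transition maps.  So \<open>f c p\<close> is the coordinate vector
  of the vector field \<open>f\<close> at the point \<open>p\<close> with respect to the chart \<open>c\<close>.
\<close>

definition smooth_vector_field ::
    "'e::euclidean_space set \<Rightarrow> ('a, 'e) chart set \<Rightarrow> (('a, 'e) chart \<Rightarrow> 'a \<Rightarrow> 'e) \<Rightarrow> bool" where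
  "smooth_vector_field E A f \<longleftrightarrow>
     (\<forall>c\<in>A. (\<forall>p\<in>fst c. f c p \<in> E) \<and> smooth_on E (snd c ` fst c) (f c \<circ> chart_inv c)) \<and>
     (\<forall>c\<in>A. \<forall>d\<in>A. \<forall>p \<in> fst c \<inter> fst d. f d p = dir_deriv E (transition c d) (snd c p) (f c p))"

definition lie_derivative ::
    "'e::euclidean_space set \<Rightarrow> ('a, 'e) chart set \<Rightarrow> (('a, 'e) chart \<Rightarrow> 'a \<Rightarrow> 'e) \<Rightarrow>
     ('a \<Rightarrow> real) \<Rightarrow> 'a \<Rightarrow> real" where
  "lie_derivative E A f h p =
     (let c = chart_at A p in dir_deriv E (h \<circ> chart_inv c) (snd c p) (f c p))"

text \<open>Integral curves defined on all of \<open>\<real>\<close>, that is, solutions of \<open>\<gamma>' = f(\<gamma>)\<close>.\<close>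

definition integral_curve ::
    "('a::topological_space, 'e::euclidean_space) chart set \<Rightarrow> (('a, 'e) chart \<Rightarrow> 'a \<Rightarrow> 'e) \<Rightarrow>
     (real \<Rightarrow> 'a) \<Rightarrow> bool" where
  "integral_curve A f \<gamma> \<longleftrightarrow>
     continuous_on UNIV \<gamma> \<and>
     (\<forall>t. \<forall>c\<in>A. \<gamma> t \<in> fst c \<longrightarrow> ((snd c \<circ> \<gamma>) has_vector_derivative f c (\<gamma> t)) (at t))"

definition complete_vector_field ::
    "('a::topological_space, 'e::euclidean_space) chart set \<Rightarrow> (('a, 'e) chart \<Rightarrow> 'a \<Rightarrow> 'e) \<Rightarrow> bool" where
  "complete_vector_field A f \<longleftrightarrow> (\<forall>x. \<exists>\<gamma>. integral_curve A f \<gamma> \<and> \<gamma> 0 = x)"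

text \<open>For a complete smooth vector field on a Hausdorff manifold the integral curve is unique.\<close>

definition flow ::
    "('a::topological_space, 'e::euclidean_space) chart set \<Rightarrow> (('a, 'e) chart \<Rightarrow> 'a \<Rightarrow> 'e) \<Rightarrow>
     real \<Rightarrow> 'a \<Rightarrow> 'a" where
  "flow A f t x = (THE \<gamma>. integral_curve A f \<gamma> \<and> \<gamma> 0 = x) t"

definition koopman ::
    "('a::topological_space, 'e::euclidean_space) chart set \<Rightarrow> (('a, 'e) chart \<Rightarrow> 'a \<Rightarrow> 'e) \<Rightarrow>
     real \<Rightarrow> ('a \<Rightarrow> real) \<Rightarrow> 'a \<Rightarrow> real" where
  "koopman A f t h = h \<circ> flow A f t"


section \<open>Iterated covariant derivatives\<close>

text \<open>
  \<open>\<Gamma> c p v w\<close> is the Christoffel form of the connection in the chart \<open>c\<close>, that is,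
  \<open>\<nabla>\<^sub>v Y = DY(v) + \<Gamma>(v, Y)\<close> in coordinates.  The last condition is the usual transformation
  law \<open>D\<tau>(\<Gamma>\<^sub>c(v, w)) = D\<^sup>2\<tau>(v, w) + \<Gamma>\<^sub>d(D\<tau> v, D\<tau> w)\<close> for a change \<open>\<tau>\<close> from \<open>c\<close> to \<open>d\<close>.
  No relation between the connection and the metric below is required.
\<close>

definition affine_connection ::
    "'e::euclidean_space set \<Rightarrow> ('a, 'e) chart set \<Rightarrow>
     (('a, 'e) chart \<Rightarrow> 'a \<Rightarrow> 'e \<Rightarrow> 'e \<Rightarrow> 'e) \<Rightarrow> bool" where
  "affine_connection E A \<Gamma> \<longleftrightarrow>
     (\<forall>c\<in>A. (\<forall>p\<in>fst c. bilinear (\<Gamma> c p)) \<and>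
        (\<forall>v\<in>E. \<forall>w\<in>E. smooth_on E (snd c ` fst c) (\<lambda>y. \<Gamma> c (chart_inv c y) v w))) \<and>
     (\<forall>c\<in>A. \<forall>d\<in>A. \<forall>p \<in> fst c \<inter> fst d. \<forall>v\<in>E. \<forall>w\<in>E.
        let D\<tau> = dir_deriv E (transition c d) in
          D\<tau> (snd c p) (\<Gamma> c p v w) =
            dir_deriv E (\<lambda>y. D\<tau> y w) (snd c p) v + \<Gamma> d p (D\<tau> (snd c p) v) (D\<tau> (snd c p) w))"

definition riemannian_metric ::
    "'e::euclidean_space set \<Rightarrow> ('a, 'e) chart set \<Rightarrow>
     (('a, 'e) chart \<Rightarrow> 'a \<Rightarrow> 'e \<Rightarrow> 'e \<Rightarrow> real) \<Rightarrow> bool" where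
  "riemannian_metric E A g \<longleftrightarrow>
     (\<forall>c\<in>A. (\<forall>p\<in>fst c. bilinear (g c p) \<and> (\<forall>v\<in>E. \<forall>w\<in>E. g c p v w = g c p w v) \<and>
               (\<forall>v\<in>E. v \<noteq> 0 \<longrightarrow> g c p v v > 0)) \<and>
        (\<forall>v\<in>E. \<forall>w\<in>E. smooth_on E (snd c ` fst c) (\<lambda>y. g c (chart_inv c y) v w))) \<and>
     (\<forall>c\<in>A. \<forall>d\<in>A. \<forall>p \<in> fst c \<inter> fst d. \<forall>v\<in>E. \<forall>w\<in>E.
        let D\<tau> = dir_deriv E (transition c d) (snd c p) in g d p (D\<tau> v) (D\<tau> w) = g c p v w)"

text \<open>
  A covariant tensor field \<open>T\<close> of rank \<open>j\<close> is represented by its values \<open>T c p [v\<^sub>1, \<dots>, v\<^sub>j]\<close>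
  on lists of \<open>j\<close> coordinate vectors in the chart \<open>c\<close>.  In coordinates,
  \<open>(\<nabla>T)(v, v\<^sub>1, \<dots>, v\<^sub>j) = \<partial>\<^sub>v (T(v\<^sub>1, \<dots>, v\<^sub>j)) - (\<Sum>k. T(v\<^sub>1, \<dots>, \<Gamma>(v, v\<^sub>k), \<dots>, v\<^sub>j))\<close>
  with constant coordinate vectors \<open>v\<^sub>1, \<dots>, v\<^sub>j\<close>.
\<close>

definition covariant_derivative ::
    "'e::euclidean_space set \<Rightarrow> (('a, 'e) chart \<Rightarrow> 'a \<Rightarrow> 'e \<Rightarrow> 'e \<Rightarrow> 'e) \<Rightarrow>
     (('a, 'e) chart \<Rightarrow> 'a \<Rightarrow> 'e list \<Rightarrow> real) \<Rightarrow> ('a, 'e) chart \<Rightarrow> 'a \<Rightarrow> 'e list \<Rightarrow> real" where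
  "covariant_derivative E \<Gamma> T c p vs =
     (case vs of [] \<Rightarrow> 0
      | v # ws \<Rightarrow> dir_deriv E (\<lambda>y. T c (chart_inv c y) ws) (snd c p) v
                  - (\<Sum>k<length ws. T c p (ws[k := \<Gamma> c p v (ws ! k)])))"

primrec iterated_covariant_derivative ::
    "'e::euclidean_space set \<Rightarrow> (('a, 'e) chart \<Rightarrow> 'a \<Rightarrow> 'e \<Rightarrow> 'e \<Rightarrow> 'e) \<Rightarrow> nat \<Rightarrow> ('a \<Rightarrow> real) \<Rightarrow>
     ('a, 'e) chart \<Rightarrow> 'a \<Rightarrow> 'e list \<Rightarrow> real" where
  "iterated_covariant_derivative E \<Gamma> 0 h = (\<lambda>c p vs. h p)"
| "iterated_covariant_derivative E \<Gamma> (Suc j) h =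
     covariant_derivative E \<Gamma> (iterated_covariant_derivative E \<Gamma> j h)"

text \<open>The norm that the metric induces on tensors of rank \<open>j\<close> at \<open>p\<close>: the norm as a
  multilinear form.\<close>

definition tensor_norm ::
    "'e::euclidean_space set \<Rightarrow> ('a, 'e) chart set \<Rightarrow> (('a, 'e) chart \<Rightarrow> 'a \<Rightarrow> 'e \<Rightarrow> 'e \<Rightarrow> real) \<Rightarrow>
     nat \<Rightarrow> (('a, 'e) chart \<Rightarrow> 'a \<Rightarrow> 'e list \<Rightarrow> real) \<Rightarrow> 'a \<Rightarrow> real" where
  "tensor_norm E A g j T p =
     (let c = chart_at A p in
        SUP vs \<in> {vs. length vs = j \<and> (\<forall>v\<in>set vs. v \<in> E \<and> g c p v v \<le> 1)}. \<bar>T c p vs\<bar>)"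


section \<open>The topology of smooth functions and operators on them\<close>

definition exhaustion :: "(nat \<Rightarrow> 'a::topological_space set) \<Rightarrow> bool" where
  "exhaustion V \<longleftrightarrow>
     (\<forall>i. open (V i) \<and> compact (closure (V i)) \<and> closure (V i) \<subseteq> V (Suc i)) \<and> (\<Union>i. V i) = UNIV"

text \<open>The supremum is taken in \<open>[0, \<infinity>)\<close>; adding 0 only matters if \<open>V i\<close> is empty.\<close>

definition Cinf_seminorm ::
    "'e::euclidean_space set \<Rightarrow> ('a::topological_space, 'e) chart set \<Rightarrow>
     (('a, 'e) chart \<Rightarrow> 'a \<Rightarrow> 'e \<Rightarrow> 'e \<Rightarrow> real) \<Rightarrow> (('a, 'e) chart \<Rightarrow> 'a \<Rightarrow> 'e \<Rightarrow> 'e \<Rightarrow> 'e) \<Rightarrow>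
     (nat \<Rightarrow> 'a set) \<Rightarrow> nat \<Rightarrow> nat \<Rightarrow> ('a \<Rightarrow> real) \<Rightarrow> real" where
  "Cinf_seminorm E A g \<Gamma> V i j h =
     Sup (insert 0
       (tensor_norm E A g j (iterated_covariant_derivative E \<Gamma> j h) ` closure (V i)))"

definition Cinf_topology ::
    "'e::euclidean_space set \<Rightarrow> ('a::topological_space, 'e) chart set \<Rightarrow>
     (('a, 'e) chart \<Rightarrow> 'a \<Rightarrow> 'e \<Rightarrow> 'e \<Rightarrow> real) \<Rightarrow> (('a, 'e) chart \<Rightarrow> 'a \<Rightarrow> 'e \<Rightarrow> 'e \<Rightarrow> 'e) \<Rightarrow>
     (nat \<Rightarrow> 'a set) \<Rightarrow> ('a \<Rightarrow> real) topology" where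
  "Cinf_topology E A g \<Gamma> V = topology_generated_by
     {{k \<in> smooth_functions E A. Cinf_seminorm E A g \<Gamma> V i j (\<lambda>x. k x - h x) < \<epsilon>} | i j h \<epsilon>.
        h \<in> smooth_functions E A \<and> \<epsilon> > 0}"

lemma chart_at_in_atlas:
  assumes "smooth_manifold E A"
  shows "chart_at A p \<in> A" "p \<in> fst (chart_at A p)"
proof -
  have "p \<in> (\<Union>c\<in>A. fst c)" using assms by (simp add: smooth_manifold_def)
  then have "\<exists>c. c \<in> A \<and> p \<in> fst c" by auto
  then have "chart_at A p \<in> A \<and> p \<in> fst (chart_at A p)"
    unfolding chart_at_def by (rule someI_ex)
  then show "chart_at A p \<in> A" "p \<in> fst (chart_at A p)" by auto
qed

lemma dir_deriv_zero_space: "dir_deriv {0} F x 0 = 0"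
proof -
  have "at x within {0} = bot"
    by (cases "x = 0") (simp_all add: at_within_eq_bot_iff)
  then have "(F has_derivative (\<lambda>_. 0)) (at x within {0})"
    by (simp add: has_derivative_def)
  then have "F differentiable (at x within {0})" by (auto simp: differentiable_def)
  then have "linear (frechet_derivative F (at x within {0}))" by (rule linear_frechet_derivative)
  then show ?thesis by (simp add: dir_deriv_def linear_0)
qed

lemma iterated_covariant_derivative_zero_function:
  assumes M: "smooth_manifold E A" and conn: "affine_connection E A \<Gamma>"
    and "c \<in> A" "p \<in> fst c" "set vs \<subseteq> E"
  shows "iterated_covariant_derivative E \<Gamma> j (\<lambda>x. 0) c p vs = 0"
proof -
  consider "E = UNIV" | "E = {0}" using M by (auto simp: smooth_manifold_def model_space_def)
  then show ?thesis
  proof cases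
    case 1
    have "iterated_covariant_derivative E \<Gamma> j (\<lambda>x. 0) c p vs = 0" for c p vs
      by (induction j arbitrary: c p vs)
        (auto simp: covariant_derivative_def dir_deriv_def 1 frechet_derivative_const split: list.split)
    then show ?thesis .
  next
    case 2
    have \<Gamma>0: "\<Gamma> c p 0 w = 0" for w
      using conn assms(3,4) by (auto simp: affine_connection_def bilinear_lzero)
    show ?thesis using assms(5)
    proof (induction j arbitrary: vs)
      case (Suc j)
      have "iterated_covariant_derivative E \<Gamma> j (\<lambda>x. 0) c p (ws[k := 0]) = 0"
        if "set ws \<subseteq> E" for ws k
        by (rule Suc.IH) (use that set_update_subset_insert[of ws k 0] in \<open>auto simp: 2\<close>)
      then show ?case using Suc.prems
        by (auto simp: covariant_derivative_def 2 dir_deriv_zero_space \<Gamma>0 split: list.split)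
    qed simp
  qed
qed

lemma Cinf_seminorm_zero_function:
  assumes "smooth_manifold E A" "affine_connection E A \<Gamma>" "riemannian_metric E A g"
  shows "Cinf_seminorm E A g \<Gamma> V i j (\<lambda>x. 0) = 0"
proof -
  have "tensor_norm E A g j (iterated_covariant_derivative E \<Gamma> j (\<lambda>x. 0)) p = 0" for p
  proof -
    define c where "c = chart_at A p"
    have c: "c \<in> A" "p \<in> fst c" using chart_at_in_atlas[OF assms(1)] by (auto simp: c_def)
    let ?S = "{vs. length vs = j \<and> (\<forall>v\<in>set vs. v \<in> E \<and> g c p v v \<le> 1)}"
    have "0 \<in> E" using assms(1) by (auto simp: smooth_manifold_def model_space_def)
    moreover have "g c p 0 0 = 0"
      using assms(3) c by (auto simp: riemannian_metric_def bilinear_lzero)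
    ultimately have "replicate j 0 \<in> ?S" by simp
    then have "?S \<noteq> {}" by blast
    moreover have "\<bar>iterated_covariant_derivative E \<Gamma> j (\<lambda>x. 0) c p vs\<bar> = 0" if "vs \<in> ?S" for vs
      using iterated_covariant_derivative_zero_function[OF assms(1,2) c, of vs j] that by auto
    ultimately show ?thesis unfolding tensor_norm_def Let_def c_def[symmetric] by simp
  qed
  then have "insert 0 (tensor_norm E A g j (iterated_covariant_derivative E \<Gamma> j (\<lambda>x. 0)) ` closure (V i))
      = {0}" by auto
  then show ?thesis unfolding Cinf_seminorm_def by (simp only: cSup_singleton)
qed

lemma topspace_Cinf_topology:
  assumes "smooth_manifold E A" "affine_connection E A \<Gamma>" "riemannian_metric E A g"
  shows "topspace (Cinf_topology E A g \<Gamma> V) = smooth_functions E A"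
proof -
  have "h \<in> {k \<in> smooth_functions E A. Cinf_seminorm E A g \<Gamma> V 0 0 (\<lambda>x. k x - h x) < 1}"
    if "h \<in> smooth_functions E A" for h
    using that by (simp add: Cinf_seminorm_zero_function[OF assms])
  moreover have "{k \<in> smooth_functions E A. Cinf_seminorm E A g \<Gamma> V 0 0 (\<lambda>x. k x - h x) < 1} \<in>
      {{k \<in> smooth_functions E A. Cinf_seminorm E A g \<Gamma> V i j (\<lambda>x. k x - h x) < \<epsilon>} | i j h \<epsilon>.
         h \<in> smooth_functions E A \<and> \<epsilon> > 0}" if "h \<in> smooth_functions E A" for h
    using that zero_less_one[where 'a = real] by blast
  ultimately have "smooth_functions E A \<subseteq> topspace (Cinf_topology E A g \<Gamma> V)"
    unfolding Cinf_topology_def topology_generated_by_topspace by (meson UnionI subsetI)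
  moreover have "topspace (Cinf_topology E A g \<Gamma> V) \<subseteq> smooth_functions E A"
    unfolding Cinf_topology_def topology_generated_by_topspace by blast
  ultimately show ?thesis by (rule equalityI[rotated])
qed

text \<open>Operators on a space of functions are only considered on \<open>topspace X\<close>.\<close>

definition bounded_operator :: "('a \<Rightarrow> real) topology \<Rightarrow> (('a \<Rightarrow> real) \<Rightarrow> 'a \<Rightarrow> real) \<Rightarrow> bool" where
  "bounded_operator X T \<longleftrightarrow>
     continuous_map X X T \<and>
     (\<forall>h \<in> topspace X. \<forall>k \<in> topspace X. \<forall>a b.
        T (\<lambda>x. a * h x + b * k x) = (\<lambda>x. a * T h x + b * T k x))"

definition Aut :: "('a \<Rightarrow> real) topology \<Rightarrow> (('a \<Rightarrow> real) \<Rightarrow> 'a \<Rightarrow> real) set" where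
  "Aut X = {T. bounded_operator X T \<and>
     (\<exists>S. bounded_operator X S \<and> (\<forall>h \<in> topspace X. S (T h) = h \<and> T (S h) = h))}"

definition has_strong_derivative ::
    "('a \<Rightarrow> real) topology \<Rightarrow> (real \<Rightarrow> ('a \<Rightarrow> real) \<Rightarrow> 'a \<Rightarrow> real) \<Rightarrow>
     (('a \<Rightarrow> real) \<Rightarrow> 'a \<Rightarrow> real) \<Rightarrow> real \<Rightarrow> bool" where
  "has_strong_derivative X U D t \<longleftrightarrow>
     (\<forall>h \<in> topspace X. limitin X (\<lambda>s x. (U s h x - U t h x) / (s - t)) (D h) (at t))"

end

theory Submission
  imports Defs
begin

text \<open>
  The analytic core is that the flow of a smooth vector field is smooth in the initial value.  On a
  short time interval \<open>[-a, a]\<close> with \<open>a M \<le> 1/2\<close>, where \<open>M\<close> bounds the equation, all estimates follow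
  from the mean value inequality, and the difference \<open>\<Phi>\<^sub>s y - \<Phi>\<^sub>s x\<close> solves a linear equation
  whose coefficients depend continuously on \<open>(s, x, y)\<close> up to and including the diagonal \<open>x = y\<close>.  Hence
  it is a continuous linear combination of the coordinates of \<open>y - x\<close>, which gives differentiability;
  the derivative again solves a linear equation with coefficients as regular as the flow itself, so
  the regularity can be bootstrapped.  The group law carries smoothness from short to all times.

  The seminorms of the \<open>C\<^sup>\<infinity>\<close>-topology are, locally uniformly, equivalent to suprema of the coordinate
  derivatives, because iterated covariant derivatives are tensorial.  Continuity of \<open>U\<^sub>t\<close> is then the
  chain rule.  By the group law it suffices to differentiate \<open>U\<^sub>s k\<close> at \<open>s = 0\<close>, where
  \<open>(U\<^sub>s k - k)/s\<close> is the integral of \<open>U\<^sub>\<theta>\<^sub>s (\<L>\<^sub>f k)\<close> over \<open>\<theta> \<in> [0, 1]\<close>, and all spatial derivatives of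
  this integral are jointly continuous in \<open>s\<close> and the point.
\<close>


section \<open>Maps of class Ck depending on a parameter\<close>

text \<open>Two kinds of uniformity shape the proof. Limits in the
  \<open>C\<^sup>\<infinity>\<close>-topology require spatial derivatives to converge uniformly on
  compact sets, so \<open>param_Ck\<close> asks for their joint continuity in parameter and point,
  and compactness does the rest. The parameter may range over any topological space: a time s, a
  pair (\<theta>, s) or a single dummy value. Bounds for operators require constants independent of
  the function, so \<open>dominated\<close> compares quantities on sets of pairs (function, point).

  The bound 1/2 on \<open>a * M\<close> has two roles: the maximum of a solution can be absorbed in
  its own estimate, and the Picard iteration contracts.

  Keeping the diagonal in the coefficients turns differentiability into continuity: the equation
  solved for unit initial differences has a jointly continuous solution, whose value on the diagonal
  is the derivative.

  The model space {0} is treated apart. The filter \<open>at x within {0}\<close> is trivial, so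
  every function is differentiable there and derivatives carry no information; but such a manifold
  is discrete and its flow is the identity.\<close>

primrec param_Ck :: "nat \<Rightarrow> 't::topological_space set \<Rightarrow> 'e::euclidean_space set \<Rightarrow>
    ('t \<Rightarrow> 'e \<Rightarrow> 'b::real_normed_vector) \<Rightarrow> bool" where
  "param_Ck 0 J S u \<longleftrightarrow> continuous_on (J \<times> S) (\<lambda>(s, x). u s x)"
| "param_Ck (Suc k) J S u \<longleftrightarrow> continuous_on (J \<times> S) (\<lambda>(s, x). u s x) \<and>
     (\<forall>s\<in>J. \<forall>x\<in>S. u s differentiable (at x)) \<and> (\<forall>v. param_Ck k J S (\<lambda>s x. dir_deriv UNIV (u s) x v))"

lemma dir_deriv_eqI:
  "(F has_derivative F') (at x) \<Longrightarrow> dir_deriv UNIV F x v = F' v"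
  unfolding dir_deriv_def by (metis frechet_derivative_at)

lemma has_derivative_dir_deriv:
  "F differentiable (at x) \<Longrightarrow> (F has_derivative dir_deriv UNIV F x) (at x)"
  unfolding dir_deriv_def by (simp add: frechet_derivative_works)

lemma linear_dir_deriv:
  "F differentiable (at x) \<Longrightarrow> linear (dir_deriv UNIV F x)"
  using has_derivative_dir_deriv has_derivative_linear by blast

text \<open>\<open>param_Ck\<close> controls derivatives in fixed directions only. This expansion
  turns a derivative in a direction that varies with the point into a sum of products of controlled
  functions.\<close>

lemma dir_deriv_sum_Basis:
  fixes F :: "'e::euclidean_space \<Rightarrow> 'b::real_normed_vector"
  assumes "F differentiable (at x)"
  shows "dir_deriv UNIV F x v = (\<Sum>b\<in>Basis. (v \<bullet> b) *\<^sub>R dir_deriv UNIV F x b)"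
proof -
  interpret linear "dir_deriv UNIV F x" using assms by (rule linear_dir_deriv)
  have "dir_deriv UNIV F x v = dir_deriv UNIV F x (\<Sum>b\<in>Basis. (v \<bullet> b) *\<^sub>R b)"
    by (simp add: euclidean_representation)
  then show ?thesis by (simp add: sum scaleR)
qed

lemma differentiable_cong_open:
  assumes "open S" "x \<in> S" "\<And>y. y \<in> S \<Longrightarrow> F y = G y"
  shows "F differentiable (at x) \<longleftrightarrow> G differentiable (at x)"
  using assms unfolding differentiable_def
  by (metis has_derivative_transform_within_open)

lemma dir_deriv_cong_open:
  assumes "open S" "x \<in> S" "\<And>y. y \<in> S \<Longrightarrow> F y = G y"
  shows "dir_deriv UNIV F x = dir_deriv UNIV G x"
proof -
  have "(F has_derivative D) (at x) \<longleftrightarrow> (G has_derivative D) (at x)" for D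
    using assms by (metis has_derivative_transform_within_open)
  then show ?thesis unfolding dir_deriv_def frechet_derivative_def by simp
qed

lemma param_Ck_continuous: "param_Ck k J S u \<Longrightarrow> continuous_on (J \<times> S) (\<lambda>(s, x). u s x)"
  by (cases k) auto

lemma param_Ck_cong:
  assumes "open S" "\<And>s x. s \<in> J \<Longrightarrow> x \<in> S \<Longrightarrow> u s x = w s x"
  shows "param_Ck k J S u \<longleftrightarrow> param_Ck k J S w"
  using assms(2)
proof (induction k arbitrary: u w)
  case 0 then show ?case by (auto intro!: continuous_on_cong)
next
  case (Suc k)
  have "continuous_on (J \<times> S) (\<lambda>(s, x). u s x) \<longleftrightarrow> continuous_on (J \<times> S) (\<lambda>(s, x). w s x)"
    using Suc.prems by (auto intro!: continuous_on_cong)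
  moreover have "s \<in> J \<Longrightarrow> x \<in> S \<Longrightarrow> u s differentiable (at x) \<longleftrightarrow> w s differentiable (at x)" for s x
    using Suc.prems differentiable_cong_open[OF assms(1)] by blast
  moreover have "param_Ck k J S (\<lambda>s x. dir_deriv UNIV (u s) x v) \<longleftrightarrow> param_Ck k J S (\<lambda>s x. dir_deriv UNIV (w s) x v)" for v
    using Suc.prems by (intro Suc.IH fun_cong[OF dir_deriv_cong_open[OF assms(1)]]) auto
  ultimately show ?case by simp
qed

lemma param_Ck_Suc_imp: "param_Ck (Suc k) J S u \<Longrightarrow> param_Ck k J S u"
  by (induction k arbitrary: u) auto

lemma param_Ck_le: "param_Ck k J S u \<Longrightarrow> j \<le> k \<Longrightarrow> param_Ck j J S u"
proof (induction k)
  case (Suc k) then show ?case using param_Ck_Suc_imp le_Suc_eq by metis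
qed auto

lemma param_Ck_subset: "param_Ck k J S u \<Longrightarrow> J' \<subseteq> J \<Longrightarrow> S' \<subseteq> S \<Longrightarrow> param_Ck k J' S' u"
proof (induction k arbitrary: u)
  case 0 then show ?case by (auto elim: continuous_on_subset)
next
  case (Suc k)
  have "J' \<times> S' \<subseteq> J \<times> S" using Suc.prems by blast
  then show ?case using Suc by (auto intro: continuous_on_subset)
qed

lemma param_Ck_SucI:
  assumes "open S" "continuous_on (J \<times> S) (\<lambda>(s, x). u s x)"
    and d: "\<And>s x. s \<in> J \<Longrightarrow> x \<in> S \<Longrightarrow> (u s has_derivative D s x) (at x)"
    and "\<And>v. param_Ck k J S (\<lambda>s x. D s x v)"
  shows "param_Ck (Suc k) J S u"
proof -
  have "param_Ck k J S (\<lambda>s x. dir_deriv UNIV (u s) x v)" for v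
    using assms(4) by (subst param_Ck_cong[OF assms(1)]) (auto simp: dir_deriv_eqI[OF d])
  then show ?thesis using assms(2) d by (auto simp: differentiable_def)
qed

lemma param_Ck_const_in_x:
  assumes "continuous_on J r" shows "param_Ck k J S (\<lambda>s x. r s)"
proof -
  have c: "continuous_on (J \<times> S) (\<lambda>(s, x). r s)"
    unfolding split_beta by (rule continuous_on_compose2[OF assms]) (auto intro: continuous_intros)
  have z: "param_Ck k J S (\<lambda>s x. 0)" for k
    by (induction k) (simp_all add: dir_deriv_def split_beta)
  show ?thesis using c by (cases k) (simp_all add: dir_deriv_def z)
qed

lemma param_Ck_const: "param_Ck k J S (\<lambda>s x. c)"
  by (rule param_Ck_const_in_x) simp

lemma param_Ck_linear:
  assumes "bounded_linear L" "open S" "param_Ck k J S u" shows "param_Ck k J S (\<lambda>s x. L (u s x))"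
  using assms(3)
proof (induction k arbitrary: u)
  case 0 then show ?case
    using bounded_linear.continuous_on[OF assms(1)] by (auto simp: split_beta)
next
  case (Suc k)
  have d: "((\<lambda>x. L (u s x)) has_derivative (\<lambda>v. L (dir_deriv UNIV (u s) x v))) (at x)"
    if "s \<in> J" "x \<in> S" for s x
    using Suc.prems that
    by (intro bounded_linear.has_derivative[OF assms(1)] has_derivative_dir_deriv) auto
  have "continuous_on (J \<times> S) (\<lambda>(s, x). L (u s x))"
    using Suc.prems bounded_linear.continuous_on[OF assms(1)] by (auto simp: split_beta)
  moreover have "param_Ck k J S (\<lambda>s x. L (dir_deriv UNIV (u s) x v))" for v using Suc by auto
  ultimately show ?case by (intro param_Ck_SucI[OF assms(2) _ d])
qed

lemma param_Ck_add:
  assumes "open S" "param_Ck k J S u" "param_Ck k J S w" shows "param_Ck k J S (\<lambda>s x. u s x + w s x)"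
  using assms(2,3)
proof (induction k arbitrary: u w)
  case 0 then show ?case by (auto simp: split_beta intro: continuous_on_add)
next
  case (Suc k)
  have d: "((\<lambda>x. u s x + w s x) has_derivative (\<lambda>v. dir_deriv UNIV (u s) x v + dir_deriv UNIV (w s) x v)) (at x)"
    if "s \<in> J" "x \<in> S" for s x
    using Suc.prems that by (intro has_derivative_add has_derivative_dir_deriv) auto
  have "continuous_on (J \<times> S) (\<lambda>(s, x). u s x + w s x)"
    using Suc.prems by (auto simp: split_beta intro: continuous_on_add)
  moreover have "param_Ck k J S (\<lambda>s x. dir_deriv UNIV (u s) x v + dir_deriv UNIV (w s) x v)" for v
    using Suc by auto
  ultimately show ?case by (intro param_Ck_SucI[OF assms(1) _ d])
qed

lemma param_Ck_sum:
  assumes "open S" "\<And>i. i \<in> I \<Longrightarrow> param_Ck k J S (u i)" shows "param_Ck k J S (\<lambda>s x. \<Sum>i\<in>I. u i s x)"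
  using assms(2)
proof (induction I rule: infinite_finite_induct)
  case (insert i I) then show ?case by (simp add: param_Ck_add[OF assms(1)])
qed (auto intro: param_Ck_const)

lemma param_Ck_bilinear:
  assumes bl: "bounded_bilinear B" and "open S" "param_Ck k J S u" "param_Ck k J S w"
  shows "param_Ck k J S (\<lambda>s x. B (u s x) (w s x))"
  using assms(3,4)
proof (induction k arbitrary: u w)
  case 0 then show ?case
    using bounded_bilinear.continuous_on[OF bl] by (auto simp: split_beta)
next
  case (Suc k)
  have d: "((\<lambda>x. B (u s x) (w s x)) has_derivative
      (\<lambda>v. B (u s x) (dir_deriv UNIV (w s) x v) + B (dir_deriv UNIV (u s) x v) (w s x))) (at x)"
    if "s \<in> J" "x \<in> S" for s x
    using Suc.prems that by (intro bounded_bilinear.FDERIV[OF bl] has_derivative_dir_deriv) auto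
  have "continuous_on (J \<times> S) (\<lambda>(s, x). B (u s x) (w s x))"
    using Suc.prems bounded_bilinear.continuous_on[OF bl] by (auto simp: split_beta)
  moreover have "param_Ck k J S (\<lambda>s x. B (u s x) (dir_deriv UNIV (w s) x v) + B (dir_deriv UNIV (u s) x v) (w s x))" for v
    using Suc.prems param_Ck_Suc_imp[OF Suc.prems(1)] param_Ck_Suc_imp[OF Suc.prems(2)]
    by (intro param_Ck_add[OF assms(2)] Suc.IH) auto
  ultimately show ?case by (intro param_Ck_SucI[OF assms(2) _ d])
qed

lemmas param_Ck_scaleR = param_Ck_bilinear[OF bounded_bilinear_scaleR]
lemmas param_Ck_mult = param_Ck_bilinear[OF bounded_bilinear_mult]

lemma param_Ck_inner_left: "open S \<Longrightarrow> param_Ck k J S u \<Longrightarrow> param_Ck k J S (\<lambda>s x. u s x \<bullet> b)"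
  by (rule param_Ck_linear[OF bounded_linear_inner_left])

lemma param_Ck_diff:
  assumes "open S" "param_Ck k J S u" "param_Ck k J S w" shows "param_Ck k J S (\<lambda>s x. u s x - w s x)"
  using param_Ck_add[OF assms(1,2) param_Ck_linear[OF bounded_linear_minus[OF bounded_linear_ident] assms(1,3)]]
  by simp

text \<open>Both maps share the parameter. In the inductive step the direction
  \<open>dir_deriv UNIV (w s) x v\<close> moves with the point, so the outer derivative is first
  expanded over \<open>Basis\<close>; the induction hypothesis then applies to each basis derivative
  of \<open>u\<close>, with the same inner map.\<close>

lemma param_Ck_chain:
  fixes u :: "'t::topological_space \<Rightarrow> 'd::euclidean_space \<Rightarrow> 'b::real_normed_vector"
    and w :: "'t \<Rightarrow> 'e::euclidean_space \<Rightarrow> 'd"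
  assumes "open S" "open T" "param_Ck k J T u" "param_Ck k J S w" "\<And>s x. s \<in> J \<Longrightarrow> x \<in> S \<Longrightarrow> w s x \<in> T"
  shows "param_Ck k J S (\<lambda>s x. u s (w s x))"
proof -
  have c: "continuous_on (J \<times> S) (\<lambda>(s, x). u s (w s x))"
    if "continuous_on (J \<times> T) (\<lambda>(s, x). u s x)" for u :: "'t \<Rightarrow> 'd \<Rightarrow> 'b"
  proof -
    have w: "continuous_on (J \<times> S) (\<lambda>z. w (fst z) (snd z))"
      using param_Ck_continuous[OF assms(4)] by (simp add: split_beta)
    have "continuous_on (J \<times> S) (\<lambda>z. (\<lambda>(s, x). u s x) (fst z, w (fst z) (snd z)))"
      by (rule continuous_on_compose2[OF that continuous_on_Pair[OF continuous_on_fst[OF continuous_on_id] w]])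
        (auto simp: assms(5))
    then show ?thesis by (simp add: split_beta)
  qed
  show ?thesis using assms(3,4)
  proof (induction k arbitrary: u)
    case 0
    then show ?case using c by simp
  next
    case (Suc k)
    have c: "continuous_on (J \<times> S) (\<lambda>(s, x). u s (w s x))"
      using Suc.prems by (intro c) auto
    have d: "((\<lambda>x. u s (w s x)) has_derivative (\<lambda>v. dir_deriv UNIV (u s) (w s x) (dir_deriv UNIV (w s) x v))) (at x)"
      if "s \<in> J" "x \<in> S" for s x
      using Suc.prems that assms(5)
      by (intro has_derivative_compose[OF has_derivative_dir_deriv has_derivative_dir_deriv]) auto
    have e: "dir_deriv UNIV (u s) (w s x) (dir_deriv UNIV (w s) x v)
        = (\<Sum>b\<in>Basis. (dir_deriv UNIV (w s) x v \<bullet> b) *\<^sub>R dir_deriv UNIV (u s) (w s x) b)"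
      if "s \<in> J" "x \<in> S" for s x v
      using Suc.prems that assms(5) by (intro dir_deriv_sum_Basis) auto
    have "param_Ck k J S (\<lambda>s x. \<Sum>b\<in>Basis. (dir_deriv UNIV (w s) x v \<bullet> b) *\<^sub>R dir_deriv UNIV (u s) (w s x) b)" for v
      using Suc.prems param_Ck_Suc_imp[OF Suc.prems(2)]
      by (intro param_Ck_sum param_Ck_scaleR param_Ck_inner_left assms(1) Suc.IH) auto
    then have "param_Ck k J S (\<lambda>s x. dir_deriv UNIV (u s) (w s x) (dir_deriv UNIV (w s) x v))" for v
      by (subst param_Ck_cong[OF assms(1)]) (auto simp: e)
    then show ?case by (intro param_Ck_SucI[OF assms(1) c d])
  qed
qed

lemma param_Ck_reparam:
  fixes u :: "'t::topological_space \<Rightarrow> 'e::euclidean_space \<Rightarrow> 'b::real_normed_vector"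
  assumes "continuous_on J' r" "r ` J' \<subseteq> J" "param_Ck k J S u"
  shows "param_Ck k J' S (\<lambda>s x. u (r s) x)"
  using assms(3)
proof (induction k arbitrary: u)
  have c: "continuous_on (J' \<times> S) (\<lambda>(s, x). u (r s) x)" if "continuous_on (J \<times> S) (\<lambda>(s, x). u s x)" for u :: "'t \<Rightarrow> 'e \<Rightarrow> 'b"
  proof -
    have r: "continuous_on (J' \<times> S) (\<lambda>z. r (fst z))"
      by (rule continuous_on_compose2[OF assms(1) continuous_on_fst[OF continuous_on_id]]) auto
    have "continuous_on (J' \<times> S) (\<lambda>z. (\<lambda>(s, x). u s x) (r (fst z), snd z))"
      by (rule continuous_on_compose2[OF that continuous_on_Pair[OF r continuous_on_snd[OF continuous_on_id]]])
        (use assms(2) in auto)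
    then show ?thesis by (simp add: split_beta)
  qed
  { case 0 then show ?case using c by simp }
  { case (Suc k)
    have "param_Ck k J' S (\<lambda>s x. dir_deriv UNIV (u (r s)) x v)" for v
      by (rule Suc.IH[of "\<lambda>s x. dir_deriv UNIV (u s) x v"]) (use Suc.prems in auto)
    then show ?case using Suc.prems c assms(2) by auto }
qed

text \<open>A one-point parameter set recovers the plain notion, so the closure rules above
  transfer. \<open>Ck_on (Suc k)\<close> asks for differentiability where \<open>param_Ck\<close>
  also asks for continuity; over \<open>UNIV\<close> the former implies the latter.\<close>

lemma Ck_on_iff_param_Ck: "Ck_on k UNIV S F \<longleftrightarrow> param_Ck k {0::real} S (\<lambda>_. F)"
proof (induction k arbitrary: F)
  have eq: "continuous_on ({0::real} \<times> S) (\<lambda>(s, x). F x) \<longleftrightarrow> continuous_on S F" for F :: "'a \<Rightarrow> 'b"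
  proof
    assume *: "continuous_on ({0::real} \<times> S) (\<lambda>(s, x). F x)"
    have "continuous_on S (\<lambda>x. (\<lambda>(s, x). F x) (0::real, x))"
      by (rule continuous_on_compose2[OF * continuous_on_Pair[OF continuous_on_const continuous_on_id]]) auto
    then show "continuous_on S F" by simp
  next
    assume *: "continuous_on S F"
    have "continuous_on ({0::real} \<times> S) (\<lambda>z. F (snd z))"
      by (rule continuous_on_compose2[OF * continuous_on_snd[OF continuous_on_id]]) auto
    then show "continuous_on ({0::real} \<times> S) (\<lambda>(s, x). F x)" by (simp add: split_beta)
  qed
  { case 0 then show ?case by (simp add: eq) }
  { case (Suc k)
    have "\<forall>x\<in>S. F differentiable (at x) \<Longrightarrow> continuous_on S F"
      by (meson continuous_at_imp_continuous_on differentiable_imp_continuous_within)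
    then show ?case using Suc by (auto simp: eq) }
qed

lemma param_Ck_slice: "param_Ck k J S u \<Longrightarrow> s \<in> J \<Longrightarrow> Ck_on k UNIV S (u s)"
  unfolding Ck_on_iff_param_Ck using param_Ck_reparam[of "{0::real}" "\<lambda>_. s" J k S u] by simp

lemma Ck_on_imp_param_Ck: "Ck_on k UNIV S F \<Longrightarrow> param_Ck k J S (\<lambda>_. F)"
  unfolding Ck_on_iff_param_Ck using param_Ck_reparam[of J "\<lambda>_. 0::real" "{0}" k S "\<lambda>_. F"] by (simp add: image_subset_iff)

section \<open>Smooth functions without a parameter\<close>

abbreviation smooth :: "'e::euclidean_space set \<Rightarrow> ('e \<Rightarrow> 'b::real_normed_vector) \<Rightarrow> bool" where
  "smooth \<equiv> smooth_on UNIV"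

lemma smooth_iff_param_Ck: "smooth S F \<longleftrightarrow> (\<forall>k. param_Ck k {0::real} S (\<lambda>_. F))"
  by (simp add: smooth_on_def Ck_on_iff_param_Ck)

lemma smooth_imp_param_Ck: "smooth S F \<Longrightarrow> param_Ck k J S (\<lambda>_. F)"
  by (simp add: smooth_on_def Ck_on_imp_param_Ck)

lemma smooth_slice: "(\<And>k. param_Ck k J S u) \<Longrightarrow> s \<in> J \<Longrightarrow> smooth S (u s)"
  unfolding smooth_on_def by (blast intro: param_Ck_slice)

lemma smooth_continuous: "smooth S F \<Longrightarrow> continuous_on S F"
  unfolding smooth_on_def by (metis Ck_on.simps(1))

lemma smooth_differentiable: "smooth S F \<Longrightarrow> x \<in> S \<Longrightarrow> F differentiable (at x)"
  unfolding smooth_on_def by (metis Ck_on.simps(2))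

lemma smooth_dir_deriv: "smooth S F \<Longrightarrow> smooth S (\<lambda>x. dir_deriv UNIV F x v)"
  unfolding smooth_on_def by (metis Ck_on.simps(2) UNIV_I)

lemma smooth_subset: "smooth S F \<Longrightarrow> S' \<subseteq> S \<Longrightarrow> smooth S' F"
  unfolding smooth_iff_param_Ck by (blast intro: param_Ck_subset)

lemma smooth_cong: "open S \<Longrightarrow> (\<And>x. x \<in> S \<Longrightarrow> F x = G x) \<Longrightarrow> smooth S F \<longleftrightarrow> smooth S G"
  unfolding smooth_iff_param_Ck using param_Ck_cong[of S "{0::real}" "\<lambda>_. F" "\<lambda>_. G"] by simp

lemma smooth_const: "smooth S (\<lambda>x. c)"
  unfolding smooth_iff_param_Ck by (simp add: param_Ck_const)

lemma smooth_add: "open S \<Longrightarrow> smooth S F \<Longrightarrow> smooth S G \<Longrightarrow> smooth S (\<lambda>x. F x + G x)"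
  unfolding smooth_iff_param_Ck by (simp add: param_Ck_add)

lemma smooth_diff: "open S \<Longrightarrow> smooth S F \<Longrightarrow> smooth S G \<Longrightarrow> smooth S (\<lambda>x. F x - G x)"
  unfolding smooth_iff_param_Ck by (simp add: param_Ck_diff)

lemma smooth_sum: "open S \<Longrightarrow> (\<And>i. i \<in> I \<Longrightarrow> smooth S (F i)) \<Longrightarrow> smooth S (\<lambda>x. \<Sum>i\<in>I. F i x)"
  unfolding smooth_iff_param_Ck by (simp add: param_Ck_sum)

lemma smooth_mult:
  fixes F G :: "'e::euclidean_space \<Rightarrow> real"
  shows "open S \<Longrightarrow> smooth S F \<Longrightarrow> smooth S G \<Longrightarrow> smooth S (\<lambda>x. F x * G x)"
  unfolding smooth_iff_param_Ck by (simp add: param_Ck_mult)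

lemma smooth_inner_left: "open S \<Longrightarrow> smooth S F \<Longrightarrow> smooth S (\<lambda>x. F x \<bullet> b)"
  unfolding smooth_iff_param_Ck by (simp add: param_Ck_inner_left)

lemma smooth_chain:
  "open S \<Longrightarrow> open T \<Longrightarrow> smooth T F \<Longrightarrow> smooth S G \<Longrightarrow> G ` S \<subseteq> T \<Longrightarrow> smooth S (\<lambda>x. F (G x))"
  unfolding smooth_iff_param_Ck by (auto intro!: param_Ck_chain[of S T _ _ "\<lambda>_. F" "\<lambda>_. G"])

text \<open>Derivatives are taken within \<open>UNIV\<close>, so each clause of \<open>Ck_on\<close>
  can be checked at one point with the help of an open neighbourhood.\<close>

lemma smooth_locally:
  assumes "\<And>x. x \<in> S \<Longrightarrow> \<exists>T. open T \<and> x \<in> T \<and> smooth T F"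
  shows "smooth S F"
proof -
  have "Ck_on k UNIV S F" if "\<And>x. x \<in> S \<Longrightarrow> \<exists>T. open T \<and> x \<in> T \<and> Ck_on k UNIV T F" for k
    using that
  proof (induction k arbitrary: F)
    case 0
    have "continuous (at x) F" if "x \<in> S" for x
      using 0[OF that] by (auto simp: continuous_on_eq_continuous_at)
    then show ?case by (simp add: continuous_at_imp_continuous_on)
  next
    case (Suc k)
    have "\<exists>T. open T \<and> x \<in> T \<and> Ck_on k UNIV T (\<lambda>x. dir_deriv UNIV F x v)" if "x \<in> S" for x v
      using Suc.prems[OF that] by auto
    then have "Ck_on k UNIV S (\<lambda>x. dir_deriv UNIV F x v)" for v by (rule Suc.IH)
    then show ?case using Suc.prems by fastforce
  qed
  then show ?thesis using assms unfolding smooth_on_def by blast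
qed

text \<open>Difference quotients that extend continuously to the diagonal: they exist for maps of class
  \<open>C\<^sup>1\<close> (Hadamard), and conversely the derivative is their value on the diagonal.\<close>

definition slopes :: "'t::topological_space set \<Rightarrow> 'e::euclidean_space set \<Rightarrow>
    ('t \<Rightarrow> 'e \<Rightarrow> 'b::real_normed_vector) \<Rightarrow> ('e \<Rightarrow> 't \<Rightarrow> 'e \<times> 'e \<Rightarrow> 'b) \<Rightarrow> bool" where
  "slopes J S u z \<longleftrightarrow> (\<forall>c\<in>Basis. continuous_on (J \<times> (S \<times> S)) (\<lambda>(s, p). z c s p)) \<and>
     (\<forall>s\<in>J. \<forall>x\<in>S. \<forall>y\<in>S. u s y - u s x = (\<Sum>c\<in>Basis. ((y - x) \<bullet> c) *\<^sub>R z c s (x, y)))"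

text \<open>Replacing the slopes at (x, y) by those at (x, x) costs at most
  \<open>norm (y - x)\<close> times the sum of the
  \<open>norm (z c s (x, y) - z c s (x, x))\<close>, and that sum tends to 0 by continuity at the
  diagonal.\<close>

lemma slopes_has_derivative:
  assumes "open S" and sl: "slopes J S u z" and "s \<in> J" "x \<in> S"
  shows "(u s has_derivative (\<lambda>v. \<Sum>c\<in>Basis. (v \<bullet> c) *\<^sub>R z c s (x, x))) (at x)"
  unfolding has_derivative_iff_norm
proof
  show "bounded_linear (\<lambda>v. \<Sum>c\<in>Basis. (v \<bullet> c) *\<^sub>R z c s (x, x))"
    by (intro bounded_linear_sum bounded_linear_compose[OF bounded_linear_scaleR_left bounded_linear_inner_left])
  let ?g = "\<lambda>y. \<Sum>c\<in>Basis. norm (z c s (x, y) - z c s (x, x))"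
  have "continuous_on S (\<lambda>y. z c s (x, y))" if "c \<in> Basis" for c
  proof -
    have "continuous_on (J \<times> (S \<times> S)) (\<lambda>(s, p). z c s p)" using sl that by (simp add: slopes_def)
    moreover have "continuous_on S (\<lambda>y. (s, (x, y)))" by (intro continuous_intros)
    ultimately have "continuous_on S (\<lambda>y. (\<lambda>(s, p). z c s p) (s, (x, y)))"
      by (rule continuous_on_compose2) (use assms(3,4) in auto)
    then show ?thesis by simp
  qed
  then have "isCont (\<lambda>y. z c s (x, y)) x" if "c \<in> Basis" for c
    using assms(1,4) continuous_on_eq_continuous_at that by blast
  then have "isCont ?g x" by (intro continuous_intros) auto
  then have lim: "(?g \<longlongrightarrow> 0) (at x)" unfolding isCont_def by simp
  have "norm (norm (u s y - u s x - (\<Sum>c\<in>Basis. ((y - x) \<bullet> c) *\<^sub>R z c s (x, x))) / norm (y - x)) \<le> ?g y"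
    if "y \<in> S" for y
  proof (cases "y = x")
    case False
    have "u s y - u s x = (\<Sum>c\<in>Basis. ((y - x) \<bullet> c) *\<^sub>R z c s (x, y))"
      using sl assms(3,4) that by (simp add: slopes_def)
    then have "u s y - u s x - (\<Sum>c\<in>Basis. ((y - x) \<bullet> c) *\<^sub>R z c s (x, x))
      = (\<Sum>c\<in>Basis. ((y - x) \<bullet> c) *\<^sub>R (z c s (x, y) - z c s (x, x)))"
      by (simp add: sum_subtractf scaleR_right_diff_distrib)
    also have "norm \<dots> \<le> (\<Sum>c\<in>Basis. norm (y - x) * norm (z c s (x, y) - z c s (x, x)))"
      by (rule sum_norm_le) (simp add: Basis_le_norm mult_right_mono)
    also have "\<dots> = norm (y - x) * ?g y" by (simp add: sum_distrib_left)
    finally show ?thesis using False by (simp add: divide_le_eq mult.commute)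
  qed (simp add: sum_nonneg)
  then have "\<forall>\<^sub>F y in at x. norm (norm (u s y - u s x - (\<Sum>c\<in>Basis. ((y - x) \<bullet> c) *\<^sub>R z c s (x, x))) / norm (y - x)) \<le> ?g y"
    using assms(1,4) unfolding eventually_at_topological by blast
  then show "((\<lambda>y. norm (u s y - u s x - (\<Sum>c\<in>Basis. ((y - x) \<bullet> c) *\<^sub>R z c s (x, x))) / norm (y - x)) \<longlongrightarrow> 0) (at x)"
    using lim by (rule Lim_null_comparison)
qed

lemma slopes_diag:
  assumes "open S" "slopes J S u z" "s \<in> J" "x \<in> S" "c \<in> Basis"
  shows "z c s (x, x) = dir_deriv UNIV (u s) x c"
proof -
  have "dir_deriv UNIV (u s) x c = (\<Sum>b\<in>Basis. (c \<bullet> b) *\<^sub>R z b s (x, x))"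
    by (rule dir_deriv_eqI[OF slopes_has_derivative[OF assms(1-4)]])
  also have "\<dots> = (\<Sum>b\<in>Basis. if b = c then z b s (x, x) else 0)"
    using assms(5) by (intro sum.cong) (auto simp: inner_Basis)
  finally show ?thesis using assms(5) by simp
qed

lemma segment_in_convex:
  fixes x y :: "'e::real_vector"
  assumes "convex S" "x \<in> S" "y \<in> S" "\<theta> \<in> {0..1}" shows "x + \<theta> *\<^sub>R (y - x) \<in> S"
proof -
  have "x + \<theta> *\<^sub>R (y - x) = (1 - \<theta>) *\<^sub>R x + \<theta> *\<^sub>R y" by (simp add: algebra_simps)
  then show ?thesis using assms by (simp add: convex_alt)
qed

text \<open>The fundamental theorem of calculus along the segment from \<open>x\<close> to
  \<open>y\<close>, which convexity keeps in \<open>S\<close>: averaging the derivative over the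
  segment gives slopes that remain continuous where the segment shrinks to a point.\<close>

lemma param_Ck_imp_slopes:
  fixes u :: "'t::topological_space \<Rightarrow> 'e::euclidean_space \<Rightarrow> 'b::banach"
  assumes S: "open S" "convex S" and u: "param_Ck (Suc 0) J S u"
  shows "slopes J S u (\<lambda>c s p. integral {0..1} (\<lambda>\<theta>. dir_deriv UNIV (u s) (fst p + \<theta> *\<^sub>R (snd p - fst p)) c))"
  unfolding slopes_def
proof (intro conjI ballI)
  have dc: "continuous_on (J \<times> S) (\<lambda>q. dir_deriv UNIV (u (fst q)) (snd q) c)" for c
    using u by (simp add: split_beta)
  fix c :: 'e
  have "continuous_on ((J \<times> (S \<times> S)) \<times> {0..1})
     (\<lambda>r. (\<lambda>q. dir_deriv UNIV (u (fst q)) (snd q) c)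
        (fst (fst r), fst (snd (fst r)) + snd r *\<^sub>R (snd (snd (fst r)) - fst (snd (fst r)))))"
    by (rule continuous_on_compose2[OF dc])
      (auto intro!: continuous_intros segment_in_convex[OF S(2)])
  then have "continuous_on (J \<times> (S \<times> S)) (\<lambda>q. integral (cbox 0 1)
      (\<lambda>\<theta>. dir_deriv UNIV (u (fst q)) (fst (snd q) + \<theta> *\<^sub>R (snd (snd q) - fst (snd q))) c))"
    by (intro integral_continuous_on_param) (simp add: split_beta)
  then show "continuous_on (J \<times> (S \<times> S)) (\<lambda>(s, p). integral {0..1}
      (\<lambda>\<theta>. dir_deriv UNIV (u s) (fst p + \<theta> *\<^sub>R (snd p - fst p)) c))"
    by (simp add: split_beta)
next
  fix s x y assume s: "s \<in> J" and xy: "x \<in> S" "y \<in> S"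
  let ?l = "\<lambda>\<theta>. x + \<theta> *\<^sub>R (y - x)"
  let ?d = "\<lambda>c \<theta>. dir_deriv UNIV (u s) (?l \<theta>) c"
  have lS: "?l \<theta> \<in> S" if "\<theta> \<in> {0..1}" for \<theta> using segment_in_convex[OF S(2) xy that] .
  have diff: "u s differentiable (at (?l \<theta>))" if "\<theta> \<in> {0..1}" for \<theta> using u s lS[OF that] by simp
  have "((\<lambda>\<theta>. u s (?l \<theta>)) has_vector_derivative ?d (y - x) \<theta>) (at \<theta> within {0..1})"
    if \<theta>: "\<theta> \<in> {0..1}" for \<theta>
  proof -
    have "((\<lambda>\<theta>. ?l \<theta>) has_derivative (\<lambda>h. h *\<^sub>R (y - x))) (at \<theta> within {0..1})"
      by (auto intro!: derivative_eq_intros)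
    from has_derivative_compose[OF this has_derivative_dir_deriv[OF diff[OF \<theta>]]]
    show ?thesis unfolding has_vector_derivative_def
      by (simp add: linear_cmul[OF linear_dir_deriv[OF diff[OF \<theta>]]])
  qed
  then have 1: "(?d (y - x) has_integral (u s (?l 1) - u s (?l 0))) {0..1}"
    by (intro fundamental_theorem_of_calculus) auto
  have "continuous_on {0..1} (?d c)" for c
  proof -
    have dc: "continuous_on (J \<times> S) (\<lambda>q. dir_deriv UNIV (u (fst q)) (snd q) c)"
      using u by (simp add: split_beta)
    have "continuous_on {0..1} (\<lambda>\<theta>. (\<lambda>q. dir_deriv UNIV (u (fst q)) (snd q) c) (s, ?l \<theta>))"
      by (rule continuous_on_compose2[OF dc]) (use s lS in \<open>auto intro!: continuous_intros\<close>)
    then show ?thesis by simp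
  qed
  then have "(?d c has_integral integral {0..1} (?d c)) {0..1}" for c
    using integrable_continuous_interval integrable_integral by blast
  then have "((\<lambda>\<theta>. \<Sum>c\<in>Basis. ((y - x) \<bullet> c) *\<^sub>R ?d c \<theta>) has_integral
      (\<Sum>c\<in>Basis. ((y - x) \<bullet> c) *\<^sub>R integral {0..1} (?d c))) {0..1}"
    by (intro has_integral_sum has_integral_cmul) auto
  then have "(?d (y - x) has_integral (\<Sum>c\<in>Basis. ((y - x) \<bullet> c) *\<^sub>R integral {0..1} (?d c))) {0..1}"
    by (rule has_integral_eq[rotated]) (simp add: dir_deriv_sum_Basis[OF diff, of _ "y - x"])
  from has_integral_unique[OF 1 this]
  show "u s y - u s x = (\<Sum>c\<in>Basis. ((y - x) \<bullet> c) *\<^sub>R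
      integral {0..1} (\<lambda>\<theta>. dir_deriv UNIV (u s) (fst (x, y) + \<theta> *\<^sub>R (snd (x, y) - fst (x, y))) c))"
    by simp
qed

text \<open>Differentiation under the integral sign by way of slopes: the integrated slopes of the
  integrand are slopes of the integral, and they are continuous as parametric integrals. The
  integration variable is made part of the parameter, so joint continuity in it is at hand.\<close>

lemma param_Ck_integral:
  fixes u :: "real \<times> 't::topological_space \<Rightarrow> 'e::euclidean_space \<Rightarrow> 'b::banach"
  assumes S: "open S" "convex S" and "param_Ck k ({0..1} \<times> J) S u"
  shows "param_Ck k J S (\<lambda>s x. integral {0..1} (\<lambda>\<theta>. u (\<theta>, s) x))"
  using assms(3)
proof (induction k arbitrary: u)
  \<comment> \<open>Applied with \<open>P = S\<close> to functions and with
    \<open>P = S \<times> S\<close> to slopes.\<close>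
  have cont: "continuous_on (J \<times> P) (\<lambda>(s, x). integral {0..1} (\<lambda>\<theta>. u (\<theta>, s) x))"
    if "continuous_on (({0..1} \<times> J) \<times> P) (\<lambda>(s, x). u s x)"
    for P :: "'x::topological_space set" and u :: "real \<times> 't \<Rightarrow> 'x \<Rightarrow> 'b"
  proof -
    have "continuous_on ((J \<times> P) \<times> {0..1}) (\<lambda>r. (\<lambda>(s, x). u s x) ((snd r, fst (fst r)), snd (fst r)))"
      by (rule continuous_on_compose2[OF that]) (auto intro!: continuous_intros)
    then have "continuous_on (J \<times> P) (\<lambda>r. integral (cbox 0 1) (\<lambda>\<theta>. u (\<theta>, fst r) (snd r)))"
      by (intro integral_continuous_on_param) (simp add: split_beta)
    then show ?thesis by (simp add: split_beta)
  qed
  { case 0 then show ?case using cont by simp }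
  { case (Suc k)
    have "param_Ck (Suc 0) ({0..1} \<times> J) S u" using Suc.prems by (rule param_Ck_le) simp
    then obtain z where z: "slopes ({0..1} \<times> J) S u z" using param_Ck_imp_slopes[OF S] by blast
    let ?u = "\<lambda>s x. integral {0..1} (\<lambda>\<theta>. u (\<theta>, s) x)"
    let ?z = "\<lambda>c s p. integral {0..1} (\<lambda>\<theta>. z c (\<theta>, s) p)"
    have int: "(\<lambda>\<theta>. w (\<theta>, s) x) integrable_on {0..1}"
      if w: "continuous_on (({0..1} \<times> J) \<times> P) (\<lambda>(s, x). w s x)" and "s \<in> J" "x \<in> P"
      for P :: "'x::topological_space set" and w :: "real \<times> 't \<Rightarrow> 'x \<Rightarrow> 'b" and s x
    proof -
      have "continuous_on {0..1} (\<lambda>\<theta>. (\<lambda>(s, x). w s x) ((\<theta>, s), x))"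
        by (rule continuous_on_compose2[OF w]) (use that in \<open>auto intro!: continuous_intros\<close>)
      then show ?thesis by (simp add: integrable_continuous_interval)
    qed
    have sl: "slopes J S ?u ?z" unfolding slopes_def
    proof (intro conjI ballI)
      fix c :: 'e assume "c \<in> Basis"
      then show "continuous_on (J \<times> (S \<times> S)) (\<lambda>(s, p). ?z c s p)"
        using z by (intro cont) (simp add: slopes_def)
    next
      fix s x y assume sxy: "s \<in> J" "x \<in> S" "y \<in> S"
      have "((\<lambda>\<theta>. \<Sum>c\<in>Basis. ((y - x) \<bullet> c) *\<^sub>R z c (\<theta>, s) (x, y)) has_integral
          (\<Sum>c\<in>Basis. ((y - x) \<bullet> c) *\<^sub>R ?z c s (x, y))) {0..1}"
        using z sxy by (intro has_integral_sum has_integral_cmul integrable_integral int[of "S \<times> S"])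
          (auto simp: slopes_def)
      moreover have "((\<lambda>\<theta>. u (\<theta>, s) y - u (\<theta>, s) x) has_integral (?u s y - ?u s x)) {0..1}"
        using Suc.prems sxy by (intro has_integral_diff integrable_integral int[of S]) auto
      moreover have "u (\<theta>, s) y - u (\<theta>, s) x = (\<Sum>c\<in>Basis. ((y - x) \<bullet> c) *\<^sub>R z c (\<theta>, s) (x, y))"
        if "\<theta> \<in> {0..1}" for \<theta> using z sxy that by (simp add: slopes_def)
      ultimately show "?u s y - ?u s x = (\<Sum>c\<in>Basis. ((y - x) \<bullet> c) *\<^sub>R ?z c s (x, y))"
        by (metis (no_types, lifting) has_integral_eq has_integral_unique)
    qed
    have D: "?z c s (x, x) = integral {0..1} (\<lambda>\<theta>. dir_deriv UNIV (u (\<theta>, s)) x c)"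
      if "s \<in> J" "x \<in> S" "c \<in> Basis" for c s x
      using slopes_diag[OF S(1) z _ that(2,3)] that(1) by (intro integral_cong) auto
    have "param_Ck k J S (\<lambda>s x. integral {0..1} (\<lambda>\<theta>. dir_deriv UNIV (u (\<theta>, s)) x c))" for c
      by (rule Suc.IH[of "\<lambda>s x. dir_deriv UNIV (u s) x c"]) (use Suc.prems in simp)
    then have "param_Ck k J S (\<lambda>s x. ?z c s (x, x))" if "c \<in> Basis" for c
      using D that by (subst param_Ck_cong[OF S(1), where w = "\<lambda>s x. integral {0..1} (\<lambda>\<theta>. dir_deriv UNIV (u (\<theta>, s)) x c)"]) auto
    then have "param_Ck k J S (\<lambda>s x. \<Sum>c\<in>Basis. (v \<bullet> c) *\<^sub>R ?z c s (x, x))" for v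
      by (intro param_Ck_sum S(1) param_Ck_scaleR param_Ck_const)
    then show ?case
      using Suc.prems by (intro param_Ck_SucI[OF S(1) cont slopes_has_derivative[OF S(1) sl]]) auto }
qed

text \<open>Open sets on the side of the argument and distances on the side of the value: the
  parameter space carries a topology only.\<close>

lemma continuous_on_metric_iff:
  fixes f :: "'a::topological_space \<Rightarrow> 'b::metric_space"
  shows "continuous_on S f \<longleftrightarrow>
    (\<forall>x\<in>S. \<forall>e>0. \<exists>U. open U \<and> x \<in> U \<and> (\<forall>y\<in>U \<inter> S. dist (f y) (f x) < e))"
  (is "?L \<longleftrightarrow> ?R")
proof
  assume L: ?L
  show ?R
  proof (intro ballI allI impI)
    fix x and e :: real assume "x \<in> S" "e > 0"
    then have "\<forall>\<^sub>F y in at x within S. dist (f y) (f x) < e"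
      using L tendstoD unfolding continuous_on_def by blast
    then obtain U where "open U" "x \<in> U" "\<forall>y\<in>U. y \<noteq> x \<longrightarrow> y \<in> S \<longrightarrow> dist (f y) (f x) < e"
      unfolding eventually_at_topological by blast
    then show "\<exists>U. open U \<and> x \<in> U \<and> (\<forall>y\<in>U \<inter> S. dist (f y) (f x) < e)"
      using \<open>e > 0\<close> by (intro exI[of _ U]) (metis Int_iff dist_self)
  qed
next
  assume R: ?R
  have "\<forall>\<^sub>F y in at x within S. dist (f y) (f x) < e" if "x \<in> S" "e > 0" for x e
    using R that unfolding eventually_at_topological by (metis IntI)
  then show ?L unfolding continuous_on_def by (simp add: tendstoI)
qed

section \<open>Short-time existence, uniqueness and continuous dependence for ordinary differential
  equations\<close>

lemma growth_bound:
  fixes z :: "real \<Rightarrow> 'y::real_normed_vector"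
  assumes z: "\<And>s. s \<in> {-a..a} \<Longrightarrow> (z has_vector_derivative z' s) (at s within {-a..a})"
    and B: "\<And>s. s \<in> {-a..a} \<Longrightarrow> norm (z' s) \<le> B" and "s \<in> {-a..a}"
  shows "norm (z s - z 0) \<le> a * B"
proof -
  have "norm (z s - z 0) \<le> B * norm (s - 0)"
  proof (rule differentiable_bound[where f' = "\<lambda>s h. h *\<^sub>R z' s" and S = "{-a..a}"])
    show "onorm (\<lambda>h. h *\<^sub>R z' r) \<le> B" if "r \<in> {-a..a}" for r
      using B[OF that] order_trans[OF norm_ge_zero B[OF that]]
      by (intro onorm_bound) (auto intro: mult_left_mono simp: mult.commute[of B])
  qed (use z assms(3) in \<open>auto simp: has_vector_derivative_def\<close>)
  moreover have "0 \<le> B" using B[OF assms(3)] norm_ge_zero order_trans by blast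
  then have "B * \<bar>s\<bar> \<le> B * a" using assms(3) by (intro mult_left_mono) auto
  ultimately show ?thesis by (simp add: mult.commute[of a])
qed

text \<open>Let \<open>norm (z s)\<close> be largest at \<open>m\<close>. Then \<open>norm (z m)
  \<le> norm (z 0) + a * M * norm (z m) + a * \<eta>\<close>, and since
  \<open>a * M \<le> 1 / 2\<close> half of \<open>norm (z m)\<close> can be moved to the left, which
  produces the factor 2.\<close>

lemma small_time_gronwall:
  fixes z :: "real \<Rightarrow> 'y::real_normed_vector"
  assumes z: "\<And>s. s \<in> {-a..a} \<Longrightarrow> (z has_vector_derivative z' s) (at s within {-a..a})"
    and B: "\<And>s. s \<in> {-a..a} \<Longrightarrow> norm (z' s) \<le> M * norm (z s) + \<eta>"
    and aM: "0 \<le> a" "0 \<le> M" "a * M \<le> 1 / 2" and s: "s \<in> {-a..a}"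
  shows "norm (z s) \<le> 2 * (norm (z 0) + a * \<eta>)"
proof -
  have "continuous_on {-a..a} (\<lambda>s. norm (z s))"
    using z by (intro continuous_on_norm) (meson continuous_on_vector_derivative)
  then obtain m where m: "m \<in> {-a..a}" "\<And>s. s \<in> {-a..a} \<Longrightarrow> norm (z s) \<le> norm (z m)"
    using continuous_attains_sup[of "{-a..a}" "\<lambda>s. norm (z s)"] s by auto
  have "norm (z m - z 0) \<le> a * (M * norm (z m) + \<eta>)"
  proof (rule growth_bound[OF z _ m(1)])
    fix r assume r: "r \<in> {-a..a}"
    show "norm (z' r) \<le> M * norm (z m) + \<eta>"
      using B[OF r] mult_left_mono[OF m(2)[OF r] aM(2)] by simp
  qed
  then have "norm (z m) \<le> norm (z 0) + (a * M) * norm (z m) + a * \<eta>"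
    using norm_triangle_sub[of "z m" "z 0"] by (simp add: algebra_simps)
  moreover have "(a * M) * norm (z m) \<le> 1 / 2 * norm (z m)"
    using aM(3) by (intro mult_right_mono) auto
  ultimately show ?thesis using m(2)[OF s] by (simp add: algebra_simps)
qed

text \<open>The integral operator \<open>P\<close> halves uniform distances because
  \<open>a * M \<le> 1 / 2\<close>, so the steps between iterates, starting from the constant
  function \<open>w\<close>, are dominated by a geometric series, and the iterates converge
  uniformly to a fixed point on the interval.\<close>

lemma picard_existence:
  fixes f :: "real \<Rightarrow> 'y::banach \<Rightarrow> 'y"
  assumes f: "continuous_on ({-a..a} \<times> UNIV) (\<lambda>(s, y). f s y)"
    and lip: "\<And>s y y'. s \<in> {-a..a} \<Longrightarrow> norm (f s y - f s y') \<le> M * norm (y - y')"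
    and aM: "0 \<le> a" "0 \<le> M" "a * M \<le> 1 / 2"
  shows "\<exists>y. y 0 = w \<and> (\<forall>s\<in>{-a..a}. (y has_vector_derivative f s (y s)) (at s within {-a..a}))"
proof -
  define J where "J = {-a..a}"
  \<comment> \<open>The difference of two integrals from \<open>-a\<close> is the oriented integral
    from 0 to \<open>s\<close>, for either sign of \<open>s\<close>.\<close>
  define P where "P g s = w + (integral {-a..s} (\<lambda>r. f r (g r)) - integral {-a..0} (\<lambda>r. f r (g r)))"
    for g s
  have P0: "P g 0 = w" for g by (simp add: P_def)
  have fc: "continuous_on J (\<lambda>s. f s (g s))" if "continuous_on J g" for g
  proof -
    have "continuous_on J (\<lambda>s. (\<lambda>(s, y). f s y) (s, g s))"
      by (rule continuous_on_compose2[OF f]) (use that in \<open>auto simp: J_def intro!: continuous_intros\<close>)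
    then show ?thesis by simp
  qed
  have Pd: "(P g has_vector_derivative f s (g s)) (at s within J)" if "continuous_on J g" "s \<in> J" for g s
  proof -
    have "((\<lambda>s. integral {-a..s} (\<lambda>r. f r (g r))) has_vector_derivative f s (g s)) (at s within {-a..a})"
      by (rule integral_has_vector_derivative) (use fc that in \<open>auto simp: J_def\<close>)
    then show ?thesis unfolding P_def J_def
      by (auto intro!: derivative_eq_intros)
  qed
  have Pc: "continuous_on J (P g)" if "continuous_on J g" for g
    using Pd[OF that] by (rule continuous_on_vector_derivative)
  have contr: "norm (P g s - P h s) \<le> B / 2"
    if "continuous_on J g" "continuous_on J h" "\<And>s. s \<in> J \<Longrightarrow> norm (g s - h s) \<le> B" "s \<in> J" for g h B s
  proof -
    have "0 \<le> B" using that(3)[OF that(4)] norm_ge_zero order_trans by blast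
    have "norm ((P g s - P h s) - (P g 0 - P h 0)) \<le> a * (M * B)"
    proof (rule growth_bound[where z = "\<lambda>s. P g s - P h s" and z' = "\<lambda>s. f s (g s) - f s (h s)"])
      show "((\<lambda>s. P g s - P h s) has_vector_derivative f r (g r) - f r (h r)) (at r within {-a..a})"
        if "r \<in> {-a..a}" for r
        using Pd[of g r] Pd[of h r] \<open>continuous_on J g\<close> \<open>continuous_on J h\<close> that
        by (auto simp: J_def intro: has_vector_derivative_diff)
      show "norm (f r (g r) - f r (h r)) \<le> M * B" if "r \<in> {-a..a}" for r
        using lip[OF that, of "g r" "h r"] \<open>\<And>s. s \<in> J \<Longrightarrow> norm (g s - h s) \<le> B\<close>[of r] that aM(2)
        by (auto simp: J_def intro: order_trans mult_left_mono)
    qed (use that in \<open>auto simp: J_def\<close>)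
    also have "a * (M * B) = (a * M) * B" by simp
    also have "\<dots> \<le> 1 / 2 * B" using aM(3) \<open>0 \<le> B\<close> by (rule mult_right_mono)
    finally show ?thesis by (simp add: P0)
  qed
  define Y where "Y n = (P ^^ n) (\<lambda>_. w)" for n
  have YS: "Y (Suc n) = P (Y n)" for n by (simp add: Y_def)
  have Yc: "continuous_on J (Y n)" for n
    by (induction n) (auto simp: Y_def intro: Pc)
  have "compact ((\<lambda>s. Y 1 s - Y 0 s) ` J)"
    using Yc by (intro compact_continuous_image continuous_on_diff) (auto simp: J_def)
  then obtain D where D: "\<And>s. s \<in> J \<Longrightarrow> norm (Y 1 s - Y 0 s) \<le> D"
    using compact_imp_bounded bounded_iff by (metis (no_types, lifting) imageI)
  have d: "norm (Y (Suc n) s - Y n s) \<le> D * (1 / 2) ^ n" if "s \<in> J" for n s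
    using that
  proof (induction n arbitrary: s)
    case 0 then show ?case using D by simp
  next
    case (Suc n)
    show ?case using contr[OF Yc Yc Suc.IH Suc.prems] by (simp add: YS)
  qed
  have "summable (\<lambda>n. D * (1 / 2) ^ n :: real)" by (intro summable_mult summable_geometric) simp
  then have "uniform_limit J (\<lambda>n s. \<Sum>i<n. Y (Suc i) s - Y i s) (\<lambda>s. \<Sum>i. Y (Suc i) s - Y i s) sequentially"
    by (intro Weierstrass_m_test) (rule d)
  then have "uniform_limit J (\<lambda>n s. Y n s - Y 0 s) (\<lambda>s. \<Sum>i. Y (Suc i) s - Y i s) sequentially"
    by (simp add: sum_lessThan_telescope[of "\<lambda>i. Y i _"])
  then obtain L where L: "uniform_limit J (\<lambda>n s. Y n s - Y 0 s) L sequentially" by blast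
  define y where "y s = L s + Y 0 s" for s
  have lim: "uniform_limit J Y y sequentially"
  proof -
    have "uniform_limit J (\<lambda>n s. (Y n s - Y 0 s) + Y 0 s) (\<lambda>s. L s + Y 0 s) sequentially"
      by (intro uniform_limit_intros L)
    then show ?thesis by (simp add: y_def[abs_def])
  qed
  have yc: "continuous_on J y"
    by (rule uniform_limit_theorem[OF _ lim]) (auto simp: Yc)
  have Plim: "uniform_limit J (\<lambda>n. P (Y n)) (P y) sequentially"
  proof (rule uniform_limitI)
    fix e :: real assume "e > 0"
    have "\<forall>\<^sub>F n in sequentially. \<forall>s\<in>J. dist (Y n s) (y s) < e" using uniform_limitD[OF lim \<open>e > 0\<close>] .
    then show "\<forall>\<^sub>F n in sequentially. \<forall>s\<in>J. dist (P (Y n) s) (P y s) < e"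
    proof eventually_elim
      case (elim n)
      then show ?case using contr[OF Yc yc, where B = e] \<open>e > 0\<close>
        by (fastforce simp: dist_norm intro: less_imp_le)
    qed
  qed
  have Py: "P y s = y s" if "s \<in> J" for s
  proof (rule LIMSEQ_unique)
    show "(\<lambda>n. Y (Suc n) s) \<longlonglongrightarrow> P y s"
      using tendsto_uniform_limitI[OF Plim that] by (simp add: YS)
    show "(\<lambda>n. Y (Suc n) s) \<longlonglongrightarrow> y s"
      by (rule LIMSEQ_Suc) (rule tendsto_uniform_limitI[OF lim that])
  qed
  \<comment> \<open>The fixed point equation holds on the interval only. So \<open>P y\<close> is
    offered as the solution, its derivative and its value at 0 being known outright.\<close>
  have "f s (P y s) = f s (y s)" if "s \<in> J" for s using Py that by simp
  then have "(P y has_vector_derivative f s (P y s)) (at s within {-a..a})" if "s \<in> {-a..a}" for s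
    using Pd[OF yc, of s] that by (simp add: J_def)
  then show ?thesis using P0 by blast
qed

text \<open>The equations are solved separately for each \<open>p\<close>. Joint continuity comes
  from \<open>small_time_gronwall\<close>: for \<open>p\<close> near \<open>p0\<close> the
  difference of the two solutions satisfies the estimate with a defect \<open>\<eta>\<close>, which
  bounds, uniformly in time, the change of the equation along the solution for
  \<open>p0\<close>.\<close>

lemma picard_parametric:
  fixes f :: "real \<Rightarrow> 'p::topological_space \<Rightarrow> 'y::banach \<Rightarrow> 'y"
  assumes f: "continuous_on ({-a..a} \<times> P \<times> UNIV) (\<lambda>(s, p, y). f s p y)"
    and lip: "\<And>s p y y'. s \<in> {-a..a} \<Longrightarrow> p \<in> P \<Longrightarrow> norm (f s p y - f s p y') \<le> M * norm (y - y')"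
    and aM: "0 \<le> a" "0 \<le> M" "a * M \<le> 1 / 2"
  shows "\<exists>z. continuous_on ({-a..a} \<times> P) (\<lambda>(s, p). z s p) \<and> (\<forall>p\<in>P. z 0 p = w \<and>
    (\<forall>s\<in>{-a..a}. ((\<lambda>s. z s p) has_vector_derivative f s p (z s p)) (at s within {-a..a})))"
proof -
  let ?J = "{-a..a}"
  have "\<exists>y. y 0 = w \<and> (\<forall>s\<in>?J. (y has_vector_derivative f s p (y s)) (at s within ?J))" if "p \<in> P" for p
  proof (rule picard_existence[OF _ _ aM])
    have "continuous_on (?J \<times> UNIV) (\<lambda>q. (\<lambda>(s, p, y). f s p y) (fst q, p, snd q))"
      by (rule continuous_on_compose2[OF f]) (use that in \<open>auto intro!: continuous_intros\<close>)
    then show "continuous_on (?J \<times> UNIV) (\<lambda>(s, y). f s p y)" by (simp add: split_beta)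
  qed (use lip that in auto)
  then obtain y where y: "\<And>p. p \<in> P \<Longrightarrow> y p 0 = w"
    "\<And>p s. p \<in> P \<Longrightarrow> s \<in> ?J \<Longrightarrow> (y p has_vector_derivative f s p (y p s)) (at s within ?J)"
    by metis
  have yc: "continuous_on ?J (y p)" if "p \<in> P" for p
    using y(2)[OF that] by (rule continuous_on_vector_derivative)
  have "continuous_on (?J \<times> P) (\<lambda>(s, p). y p s)"
    unfolding continuous_on_metric_iff
  proof clarsimp
    fix s0 p0 and e :: real assume s0: "- a \<le> s0" "s0 \<le> a" and p0: "p0 \<in> P" and e: "e > 0"
    have s0: "s0 \<in> ?J" using s0 by simp
    \<comment> \<open>Gronwall yields the bound \<open>2 * (a * \<eta>) < e / 2\<close>; the other
      half of \<open>e\<close> is left for moving \<open>s\<close> along the solution for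
      \<open>p0\<close>. The summand 4 in the denominator covers \<open>a = 0\<close>.\<close>
    define \<eta> where "\<eta> = e / (4 * a + 4)"
    have \<eta>: "\<eta> > 0" "2 * (a * \<eta>) < e / 2"
      using e aM(1) by (auto simp: \<eta>_def field_simps)
    have "continuous_on (P \<times> ?J) (\<lambda>q. (\<lambda>(s, p, y). f s p y) (snd q, fst q, y p0 (snd q)))"
      by (rule continuous_on_compose2[OF f])
        (auto intro!: continuous_intros continuous_on_compose2[OF yc[OF p0]])
    \<comment> \<open>Compactness of the time interval makes one neighbourhood of \<open>p0\<close>
      good for all times.\<close>
    then obtain X0 where X0: "p0 \<in> X0" "open X0"
      "\<forall>p\<in>X0 \<inter> P. \<forall>s\<in>?J. dist (f s p (y p0 s)) (f s p0 (y p0 s)) \<le> \<eta>"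
      by (rule continuous_on_prod_compactE[OF _ compact_Icc p0 \<eta>(1)]) auto
    have near: "norm (y p s - y p0 s) < e / 2" if "p \<in> X0 \<inter> P" "s \<in> ?J" for p s
    proof -
      have "norm (y p s - y p0 s) \<le> 2 * (norm (y p 0 - y p0 0) + a * \<eta>)"
      proof (rule small_time_gronwall[where z = "\<lambda>s. y p s - y p0 s"
            and z' = "\<lambda>s. f s p (y p s) - f s p0 (y p0 s)", OF _ _ aM])
        show "((\<lambda>s. y p s - y p0 s) has_vector_derivative f r p (y p r) - f r p0 (y p0 r)) (at r within ?J)"
          if "r \<in> ?J" for r
          using y(2) \<open>p \<in> X0 \<inter> P\<close> p0 that by (auto intro: has_vector_derivative_diff)
        show "norm (f r p (y p r) - f r p0 (y p0 r)) \<le> M * norm (y p r - y p0 r) + \<eta>"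
          if "r \<in> ?J" for r
        proof -
          have "norm (f r p (y p0 r) - f r p0 (y p0 r)) \<le> \<eta>"
            using X0(3) \<open>p \<in> X0 \<inter> P\<close> that by (simp add: dist_norm)
          moreover have "norm (f r p (y p r) - f r p (y p0 r)) \<le> M * norm (y p r - y p0 r)"
            using lip \<open>p \<in> X0 \<inter> P\<close> that by simp
          moreover have "f r p (y p r) - f r p0 (y p0 r)
              = (f r p (y p r) - f r p (y p0 r)) + (f r p (y p0 r) - f r p0 (y p0 r))" by simp
          ultimately show ?thesis using norm_triangle_le add_mono by metis
        qed
      qed (rule that(2))
      then show ?thesis using y(1) p0 that(1) \<eta>(2) by simp
    qed
    obtain U where U: "open U" "s0 \<in> U" "\<And>s. s \<in> U \<inter> ?J \<Longrightarrow> dist (y p0 s) (y p0 s0) < e / 2"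
      using yc[OF p0] s0 e unfolding continuous_on_metric_iff by (metis half_gt_zero)
    show "\<exists>W. open W \<and> (s0, p0) \<in> W \<and>
        (\<forall>q\<in>W \<inter> ?J \<times> P. dist (case q of (s, p) \<Rightarrow> y p s) (y p0 s0) < e)"
    proof (intro exI[of _ "U \<times> X0"] conjI ballI)
      fix q assume "q \<in> (U \<times> X0) \<inter> ?J \<times> P"
      then obtain s p where q: "q = (s, p)" "s \<in> U \<inter> ?J" "p \<in> X0 \<inter> P" by auto
      have "dist (y p s) (y p0 s) < e / 2" using near q by (simp add: dist_norm)
      with U(3)[OF q(2)] dist_triangle[of "y p s" "y p0 s0" "y p0 s"]
      show "dist (case q of (s, p) \<Rightarrow> y p s) (y p0 s0) < e" by (simp add: q(1))
    qed (use U X0 in \<open>auto intro: open_Times\<close>)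
  qed
  then show ?thesis using y by (intro exI[of _ "\<lambda>s p. y p s"]) auto
qed

section \<open>Linear differential equations with parameters\<close>

text \<open>A matrix-vector product with the matrix given by its columns. Regularity of a linear
  equation is thus expressed by that of vector valued functions, one for each \<open>b\<close>, for
  which \<open>param_Ck\<close> and \<open>slopes\<close> are available.\<close>

definition apply_columns :: "('y::euclidean_space \<Rightarrow> 'y) \<Rightarrow> 'y \<Rightarrow> 'y" where
  "apply_columns \<alpha> y = (\<Sum>b\<in>Basis. (y \<bullet> b) *\<^sub>R \<alpha> b)"

lemma apply_columns_diff: "apply_columns \<alpha> (y - y') = apply_columns \<alpha> y - apply_columns \<alpha> y'"
  by (simp add: apply_columns_def inner_diff_left scaleR_diff_left sum_subtractf)

lemma apply_columns_sum: "apply_columns \<alpha> (\<Sum>c\<in>C. r c *\<^sub>R z c) = (\<Sum>c\<in>C. r c *\<^sub>R apply_columns \<alpha> (z c))"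
proof -
  have "linear (apply_columns \<alpha>)" unfolding apply_columns_def
    by (intro linear_compose_sum ballI) (auto intro!: linearI simp: inner_add_left algebra_simps)
  then show ?thesis by (simp add: linear_sum linear_cmul)
qed

lemma norm_apply_columns_le:
  assumes "(\<Sum>b\<in>Basis. norm (\<alpha> b)) \<le> M" shows "norm (apply_columns \<alpha> y) \<le> M * norm y"
proof -
  have "norm (apply_columns \<alpha> y) \<le> (\<Sum>b\<in>Basis. norm (\<alpha> b) * norm y)"
    unfolding apply_columns_def by (rule sum_norm_le) (simp add: Basis_le_norm mult.commute[of "norm (\<alpha> _)"] mult_right_mono)
  also have "\<dots> \<le> M * norm y" unfolding sum_distrib_right[symmetric]
    using assms by (rule mult_right_mono) simp
  finally show ?thesis .
qed

lemma linear_ode_parametric: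
  fixes \<alpha> :: "'y::euclidean_space \<Rightarrow> real \<Rightarrow> 'p::topological_space \<Rightarrow> 'y"
  assumes \<alpha>: "\<And>b. b \<in> Basis \<Longrightarrow> continuous_on ({-a..a} \<times> P) (\<lambda>(s, p). \<alpha> b s p)"
    and \<beta>: "continuous_on ({-a..a} \<times> P) (\<lambda>(s, p). \<beta> s p)"
    and M: "\<And>s p. s \<in> {-a..a} \<Longrightarrow> p \<in> P \<Longrightarrow> (\<Sum>b\<in>Basis. norm (\<alpha> b s p)) \<le> M"
    and aM: "0 \<le> a" "0 \<le> M" "a * M \<le> 1 / 2"
  shows "\<exists>z. continuous_on ({-a..a} \<times> P) (\<lambda>(s, p). z s p) \<and> (\<forall>p\<in>P. z 0 p = w \<and>
    (\<forall>s\<in>{-a..a}. ((\<lambda>s. z s p) has_vector_derivative apply_columns (\<lambda>b. \<alpha> b s p) (z s p) + \<beta> s p) (at s within {-a..a})))"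
proof (rule picard_parametric[OF _ _ aM, where f = "\<lambda>s p y. apply_columns (\<lambda>b. \<alpha> b s p) y + \<beta> s p"])
  have c: "continuous_on ({-a..a} \<times> P \<times> (UNIV :: 'y set)) (\<lambda>q. g (fst q) (fst (snd q)))"
    if "continuous_on ({-a..a} \<times> P) (\<lambda>(s, p). g s p)" for g :: "real \<Rightarrow> 'p \<Rightarrow> 'y"
  proof -
    have "continuous_on ({-a..a} \<times> P \<times> (UNIV :: 'y set)) (\<lambda>q. (\<lambda>(s, p). g s p) (fst q, fst (snd q)))"
      by (rule continuous_on_compose2[OF that]) (auto intro!: continuous_intros)
    then show ?thesis by simp
  qed
  show "continuous_on ({-a..a} \<times> P \<times> UNIV) (\<lambda>(s, p, y). apply_columns (\<lambda>b. \<alpha> b s p) y + \<beta> s p)"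
    unfolding apply_columns_def split_beta
    by (intro continuous_on_add continuous_on_sum continuous_on_scaleR c \<alpha> \<beta>) (auto intro!: continuous_intros)
next
  fix s p y y' assume "s \<in> {-a..a}" "p \<in> P"
  then show "norm ((apply_columns (\<lambda>b. \<alpha> b s p) y + \<beta> s p) - (apply_columns (\<lambda>b. \<alpha> b s p) y' + \<beta> s p)) \<le> M * norm (y - y')"
    using norm_apply_columns_le[OF M, of s p "y - y'"] by (simp add: apply_columns_diff)
qed

lemma linear_ode_zero:
  assumes z: "\<And>s. s \<in> {-a..a} \<Longrightarrow> (z has_vector_derivative apply_columns (\<lambda>b. \<alpha> b s) (z s)) (at s within {-a..a})"
    and "z 0 = 0"
    and M: "\<And>s. s \<in> {-a..a} \<Longrightarrow> (\<Sum>b\<in>Basis. norm (\<alpha> b s)) \<le> M"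
    and aM: "0 \<le> a" "0 \<le> M" "a * M \<le> 1 / 2" and s: "s \<in> {-a..a}"
  shows "z s = 0"
proof -
  have "norm (z s) \<le> 2 * (norm (z 0) + a * 0)"
    by (rule small_time_gronwall[OF z _ aM s]) (simp_all add: norm_apply_columns_le M)
  then show ?thesis using assms(2) by simp
qed

text \<open>If the differences \<open>u y - u x\<close> solve a linear equation whose coefficients are continuous in
  \<open>(s, x, y)\<close>, then solving it with \<open>y - x\<close> replaced by the basis vectors yields slopes of \<open>u\<close>.\<close>

lemma linear_ode_slopes:
  fixes u :: "real \<Rightarrow> 'e::euclidean_space \<Rightarrow> 'y::euclidean_space"
  assumes \<alpha>: "\<And>b. b \<in> Basis \<Longrightarrow> continuous_on ({-a..a} \<times> (S \<times> S)) (\<lambda>(s, p). \<alpha> b s p)"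
    and \<gamma>: "\<And>c. c \<in> Basis \<Longrightarrow> continuous_on ({-a..a} \<times> (S \<times> S)) (\<lambda>(s, p). \<gamma> c s p)"
    and M: "\<And>s p. s \<in> {-a..a} \<Longrightarrow> p \<in> S \<times> S \<Longrightarrow> (\<Sum>b\<in>Basis. norm (\<alpha> b s p)) \<le> M"
    and aM: "0 \<le> a" "0 \<le> M" "a * M \<le> 1 / 2"
    and init: "\<And>x y. x \<in> S \<Longrightarrow> y \<in> S \<Longrightarrow> u 0 y - u 0 x = (\<Sum>c\<in>Basis. ((y - x) \<bullet> c) *\<^sub>R w c)"
    and ode: "\<And>x y s. x \<in> S \<Longrightarrow> y \<in> S \<Longrightarrow> s \<in> {-a..a} \<Longrightarrow>
      ((\<lambda>s. u s y - u s x) has_vector_derivative apply_columns (\<lambda>b. \<alpha> b s (x, y)) (u s y - u s x)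
        + (\<Sum>c\<in>Basis. ((y - x) \<bullet> c) *\<^sub>R \<gamma> c s (x, y))) (at s within {-a..a})"
  shows "\<exists>z. slopes {-a..a} S u z \<and> (\<forall>x\<in>S. \<forall>c\<in>Basis. z c 0 (x, x) = w c \<and> (\<forall>s\<in>{-a..a}.
    ((\<lambda>s. z c s (x, x)) has_vector_derivative apply_columns (\<lambda>b. \<alpha> b s (x, x)) (z c s (x, x)) + \<gamma> c s (x, x))
      (at s within {-a..a})))"
proof -
  let ?J = "{-a..a}"
  have "\<exists>z. continuous_on (?J \<times> (S \<times> S)) (\<lambda>(s, p). z s p) \<and> (\<forall>p\<in>S \<times> S. z 0 p = w c \<and>
    (\<forall>s\<in>?J. ((\<lambda>s. z s p) has_vector_derivative apply_columns (\<lambda>b. \<alpha> b s p) (z s p) + \<gamma> c s p) (at s within ?J)))"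
    if "c \<in> Basis" for c
    by (rule linear_ode_parametric[OF \<alpha> \<gamma>[OF that] M aM])
  then obtain z where zc: "\<And>c. c \<in> Basis \<Longrightarrow> continuous_on (?J \<times> (S \<times> S)) (\<lambda>(s, p). z c s p)"
    and z0: "\<And>c p. c \<in> Basis \<Longrightarrow> p \<in> S \<times> S \<Longrightarrow> z c 0 p = w c"
    and zd: "\<And>c p s. c \<in> Basis \<Longrightarrow> p \<in> S \<times> S \<Longrightarrow> s \<in> ?J \<Longrightarrow>
      ((\<lambda>s. z c s p) has_vector_derivative apply_columns (\<lambda>b. \<alpha> b s p) (z c s p) + \<gamma> c s p) (at s within ?J)"
    by metis
  have "u s y - u s x = (\<Sum>c\<in>Basis. ((y - x) \<bullet> c) *\<^sub>R z c s (x, y))"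
    if s: "s \<in> ?J" and xy: "x \<in> S" "y \<in> S" for s x y
  proof -
    \<comment> \<open>Both sides solve the same inhomogeneous linear equation with the same initial
      value, so their difference vanishes by \<open>linear_ode_zero\<close>.\<close>
    let ?D = "\<lambda>s. (u s y - u s x) - (\<Sum>c\<in>Basis. ((y - x) \<bullet> c) *\<^sub>R z c s (x, y))"
    have "?D s = 0"
    proof (rule linear_ode_zero[where z = ?D and \<alpha> = "\<lambda>b s. \<alpha> b s (x, y)", OF _ _ _ aM s])
      show "?D 0 = 0" using init xy z0 by simp
      show "(\<Sum>b\<in>Basis. norm (\<alpha> b r (x, y))) \<le> M" if "r \<in> ?J" for r using M that xy by simp
      fix r assume r: "r \<in> ?J"
      have "(?D has_vector_derivative (apply_columns (\<lambda>b. \<alpha> b r (x, y)) (u r y - u r x)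
          + (\<Sum>c\<in>Basis. ((y - x) \<bullet> c) *\<^sub>R \<gamma> c r (x, y)))
          - (\<Sum>c\<in>Basis. ((y - x) \<bullet> c) *\<^sub>R (apply_columns (\<lambda>b. \<alpha> b r (x, y)) (z c r (x, y)) + \<gamma> c r (x, y)))) (at r within ?J)"
        using xy r by (intro has_vector_derivative_diff ode has_vector_derivative_sum
            bounded_linear.has_vector_derivative[OF bounded_linear_scaleR_right] zd) auto
      then show "(?D has_vector_derivative apply_columns (\<lambda>b. \<alpha> b r (x, y)) (?D r)) (at r within ?J)"
        by (simp add: apply_columns_diff apply_columns_sum scaleR_add_right sum.distrib)
    qed
    then show ?thesis by simp
  qed
  then have "slopes ?J S u z" using zc by (simp add: slopes_def)
  then show ?thesis using z0 zd by (intro exI[of _ z]) simp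
qed

text \<open>Differentiating the equation in \<open>x\<close> yields, for each slope of
  \<open>u\<close>, a linear equation with the same columns \<open>\<alpha>\<close> and a new
  inhomogeneous term built from \<open>u\<close> and the derivatives of \<open>\<alpha>\<close> and
  \<open>\<beta>\<close>. So \<open>\<alpha>\<close> and its bound stay fixed in the induction while
  \<open>\<beta>\<close>, \<open>u\<close> and the initial value vary.\<close>

lemma linear_ode_param_Ck:
  fixes u :: "real \<Rightarrow> 'e::euclidean_space \<Rightarrow> 'y::euclidean_space"
  assumes S: "open S" "convex S" and aM: "0 \<le> a" "0 \<le> M" "a * M \<le> 1 / 2"
    and M: "\<And>s x. s \<in> {-a..a} \<Longrightarrow> x \<in> S \<Longrightarrow> (\<Sum>b\<in>Basis. norm (\<alpha> b s x)) \<le> M"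
    and "\<And>b. b \<in> Basis \<Longrightarrow> param_Ck k {-a..a} S (\<alpha> b)" "param_Ck k {-a..a} S \<beta>"
    and "\<And>x. x \<in> S \<Longrightarrow> u 0 x = w"
    and "\<And>s x. s \<in> {-a..a} \<Longrightarrow> x \<in> S \<Longrightarrow>
      ((\<lambda>s. u s x) has_vector_derivative apply_columns (\<lambda>b. \<alpha> b s x) (u s x) + \<beta> s x) (at s within {-a..a})"
  shows "param_Ck k {-a..a} S u"
  using assms(7-)
proof (induction k arbitrary: \<beta> u w)
  let ?J = "{-a..a}"
  \<comment> \<open>Only the individual solutions are given. Joint continuity is imported from
    \<open>linear_ode_parametric\<close>, whose solution agrees with \<open>u\<close> by
    uniqueness.\<close>
  have cont: "continuous_on (?J \<times> S) (\<lambda>(s, x). u s x)"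
    if \<alpha>: "\<And>b. b \<in> Basis \<Longrightarrow> continuous_on (?J \<times> S) (\<lambda>(s, x). \<alpha> b s x)"
      and \<beta>: "continuous_on (?J \<times> S) (\<lambda>(s, x). \<beta> s x)"
      and u0: "\<And>x. x \<in> S \<Longrightarrow> u 0 x = w"
      and ud: "\<And>s x. s \<in> ?J \<Longrightarrow> x \<in> S \<Longrightarrow>
        ((\<lambda>s. u s x) has_vector_derivative apply_columns (\<lambda>b. \<alpha> b s x) (u s x) + \<beta> s x) (at s within ?J)"
    for \<beta> u :: "real \<Rightarrow> 'e \<Rightarrow> 'y" and w
  proof -
    obtain v where v: "continuous_on (?J \<times> S) (\<lambda>(s, x). v s x)" "\<And>x. x \<in> S \<Longrightarrow> v 0 x = w"
      "\<And>s x. s \<in> ?J \<Longrightarrow> x \<in> S \<Longrightarrow>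
        ((\<lambda>s. v s x) has_vector_derivative apply_columns (\<lambda>b. \<alpha> b s x) (v s x) + \<beta> s x) (at s within ?J)"
      using linear_ode_parametric[OF \<alpha> \<beta> M aM, of w] by blast
    have "u s x = v s x" if "s \<in> ?J" "x \<in> S" for s x
    proof -
      have "u s x - v s x = 0"
      proof (rule linear_ode_zero[where z = "\<lambda>s. u s x - v s x" and \<alpha> = "\<lambda>b s. \<alpha> b s x", OF _ _ _ aM that(1)])
        show "((\<lambda>s. u s x - v s x) has_vector_derivative apply_columns (\<lambda>b. \<alpha> b r x) (u r x - v r x)) (at r within ?J)"
          if "r \<in> ?J" for r
          using has_vector_derivative_diff[OF ud[OF that \<open>x \<in> S\<close>] v(3)[OF that \<open>x \<in> S\<close>]] by (simp add: apply_columns_diff)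
      qed (use u0 v(2) M that in auto)
      then show ?thesis by simp
    qed
    then show ?thesis using v(1) by (auto intro: continuous_on_cong[THEN iffD1, rotated -1])
  qed
  { case 0
    have "continuous_on (?J \<times> S) (\<lambda>(s, x). u s x)"
      by (rule cont[of \<beta> u w]) (use 0 in auto)
    then show ?case by simp }
  { case (Suc k)
    have uc: "continuous_on (?J \<times> S) (\<lambda>(s, x). u s x)"
      by (rule cont[of \<beta> u w]) (use Suc.prems in auto)
    have C1: "param_Ck (Suc 0) ?J S (\<alpha> b)" if "b \<in> Basis" for b
      by (rule param_Ck_le[OF Suc.prems(1)[OF that]]) simp
    have "\<exists>A. slopes ?J S (\<alpha> b) A" if "b \<in> Basis" for b
      using param_Ck_imp_slopes[OF S C1[OF that]] by blast
    then obtain A where A: "\<And>b. b \<in> Basis \<Longrightarrow> slopes ?J S (\<alpha> b) (A b)" by metis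
    have "param_Ck (Suc 0) ?J S \<beta>" by (rule param_Ck_le[OF Suc.prems(2)]) simp
    from param_Ck_imp_slopes[OF S this] obtain B where B: "slopes ?J S \<beta> B" by blast
    \<comment> \<open>In \<alpha>(y) u(y) - \<alpha>(x) u(x) the difference of \<open>u\<close> is
      multiplied by \<alpha> at \<open>y\<close>, hence \<open>snd p\<close> in the columns below,
      and the difference of \<alpha> acts on \<open>u\<close> at \<open>x\<close>, hence
      \<open>fst p\<close> here.\<close>
    let ?\<gamma> = "\<lambda>c s p. (\<Sum>b\<in>Basis. (u s (fst p) \<bullet> b) *\<^sub>R A b c s p) + B c s p"
    have "\<exists>z. slopes ?J S u z \<and> (\<forall>x\<in>S. \<forall>c\<in>Basis. z c 0 (x, x) = 0 \<and> (\<forall>s\<in>?J.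
      ((\<lambda>s. z c s (x, x)) has_vector_derivative apply_columns (\<lambda>b. \<alpha> b s (snd (x, x))) (z c s (x, x)) + ?\<gamma> c s (x, x))
        (at s within ?J)))"
    proof (rule linear_ode_slopes[OF _ _ _ aM])
      have c2: "continuous_on (?J \<times> (S \<times> S)) (\<lambda>q. g (fst q) (snd (snd q)))"
        "continuous_on (?J \<times> (S \<times> S)) (\<lambda>q. g (fst q) (fst (snd q)))"
        if "continuous_on (?J \<times> S) (\<lambda>(s, x). g s x)" for g :: "real \<Rightarrow> 'e \<Rightarrow> 'y"
      proof -
        have "continuous_on (?J \<times> (S \<times> S)) (\<lambda>q. (\<lambda>(s, x). g s x) (fst q, snd (snd q)))"
          by (rule continuous_on_compose2[OF that]) (auto intro!: continuous_intros)
        then show "continuous_on (?J \<times> (S \<times> S)) (\<lambda>q. g (fst q) (snd (snd q)))" by simp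
        have "continuous_on (?J \<times> (S \<times> S)) (\<lambda>q. (\<lambda>(s, x). g s x) (fst q, fst (snd q)))"
          by (rule continuous_on_compose2[OF that]) (auto intro!: continuous_intros)
        then show "continuous_on (?J \<times> (S \<times> S)) (\<lambda>q. g (fst q) (fst (snd q)))" by simp
      qed
      show "continuous_on (?J \<times> (S \<times> S)) (\<lambda>(s, p). \<alpha> b s (snd p))" if "b \<in> Basis" for b
        using c2(1)[OF param_Ck_continuous[OF Suc.prems(1)[OF that]]] by (simp add: split_beta)
      show "continuous_on (?J \<times> (S \<times> S)) (\<lambda>(s, p). ?\<gamma> c s p)" if "c \<in> Basis" for c
        using A B that c2(2)[OF uc] unfolding slopes_def split_beta
        by (intro continuous_on_add continuous_on_sum continuous_on_scaleR continuous_on_inner continuous_on_const) auto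
      show "(\<Sum>b\<in>Basis. norm (\<alpha> b s (snd p))) \<le> M" if "s \<in> ?J" "p \<in> S \<times> S" for s p
        using M that by auto
      show "u 0 y - u 0 x = (\<Sum>c\<in>Basis. ((y - x) \<bullet> c) *\<^sub>R 0)" if "x \<in> S" "y \<in> S" for x y
        using Suc.prems(3) that by simp
      fix x y s assume xy: "x \<in> S" "y \<in> S" and s: "s \<in> ?J"
      have "apply_columns (\<lambda>b. \<alpha> b s y) (u s x) - apply_columns (\<lambda>b. \<alpha> b s x) (u s x)
          = (\<Sum>b\<in>Basis. (u s x \<bullet> b) *\<^sub>R (\<alpha> b s y - \<alpha> b s x))"
        by (simp add: apply_columns_def sum_subtractf scaleR_diff_right)
      also have "\<dots> = (\<Sum>b\<in>Basis. (u s x \<bullet> b) *\<^sub>R (\<Sum>c\<in>Basis. ((y - x) \<bullet> c) *\<^sub>R A b c s (x, y)))"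
        using A xy s by (simp add: slopes_def)
      also have "\<dots> = (\<Sum>c\<in>Basis. ((y - x) \<bullet> c) *\<^sub>R (\<Sum>b\<in>Basis. (u s x \<bullet> b) *\<^sub>R A b c s (x, y)))"
        by (simp add: scaleR_sum_right mult.commute) (rule sum.swap)
      finally have 1: "apply_columns (\<lambda>b. \<alpha> b s y) (u s x) - apply_columns (\<lambda>b. \<alpha> b s x) (u s x)
        = (\<Sum>c\<in>Basis. ((y - x) \<bullet> c) *\<^sub>R (\<Sum>b\<in>Basis. (u s x \<bullet> b) *\<^sub>R A b c s (x, y)))" .
      have 2: "\<beta> s y - \<beta> s x = (\<Sum>c\<in>Basis. ((y - x) \<bullet> c) *\<^sub>R B c s (x, y))"
        using B xy s by (simp add: slopes_def)
      have "(apply_columns (\<lambda>b. \<alpha> b s y) (u s y) + \<beta> s y) - (apply_columns (\<lambda>b. \<alpha> b s x) (u s x) + \<beta> s x)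
         = apply_columns (\<lambda>b. \<alpha> b s y) (u s y - u s x)
           + ((apply_columns (\<lambda>b. \<alpha> b s y) (u s x) - apply_columns (\<lambda>b. \<alpha> b s x) (u s x)) + (\<beta> s y - \<beta> s x))"
        by (simp add: apply_columns_diff)
      also have "\<dots> = apply_columns (\<lambda>b. \<alpha> b s (snd (x, y))) (u s y - u s x) + (\<Sum>c\<in>Basis. ((y - x) \<bullet> c) *\<^sub>R ?\<gamma> c s (x, y))"
        unfolding 1 2 by (simp add: sum.distrib scaleR_add_right)
      finally show "((\<lambda>s. u s y - u s x) has_vector_derivative
          apply_columns (\<lambda>b. \<alpha> b s (snd (x, y))) (u s y - u s x) + (\<Sum>c\<in>Basis. ((y - x) \<bullet> c) *\<^sub>R ?\<gamma> c s (x, y))) (at s within ?J)"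
        using has_vector_derivative_diff[OF Suc.prems(4)[OF s xy(2)] Suc.prems(4)[OF s xy(1)]] by simp
    qed
    then obtain z where sl: "slopes ?J S u z"
      and z0: "\<And>x c. x \<in> S \<Longrightarrow> c \<in> Basis \<Longrightarrow> z c 0 (x, x) = 0"
      and zd: "\<And>x c s. x \<in> S \<Longrightarrow> c \<in> Basis \<Longrightarrow> s \<in> ?J \<Longrightarrow>
        ((\<lambda>s. z c s (x, x)) has_vector_derivative apply_columns (\<lambda>b. \<alpha> b s x) (z c s (x, x)) + ?\<gamma> c s (x, x)) (at s within ?J)"
      by auto
    have uk: "param_Ck k ?J S u"
      using Suc.prems param_Ck_Suc_imp by (intro Suc.IH[of \<beta> u w]) blast+
    have zk: "param_Ck k ?J S (\<lambda>s x. z c s (x, x))" if c: "c \<in> Basis" for c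
    proof (rule Suc.IH[where \<beta> = "\<lambda>s x. ?\<gamma> c s (x, x)" and w = 0])
      show "param_Ck k ?J S (\<alpha> b)" if "b \<in> Basis" for b
        by (rule param_Ck_Suc_imp[OF Suc.prems(1)[OF that]])
      show "z c 0 (x, x) = 0" if "x \<in> S" for x by (rule z0[OF that c])
      show "((\<lambda>s. z c s (x, x)) has_vector_derivative apply_columns (\<lambda>b. \<alpha> b s x) (z c s (x, x)) + ?\<gamma> c s (x, x)) (at s within ?J)"
        if "s \<in> ?J" "x \<in> S" for s x by (rule zd[OF that(2) c that(1)])
      show "param_Ck k ?J S (\<lambda>s x. ?\<gamma> c s (x, x))"
      \<comment> \<open>Off the diagonal the slopes are only known to be continuous; on it they are
        derivatives of \<open>\<alpha>\<close> and \<open>\<beta>\<close> and have class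
        \<open>k\<close>.\<close>
      proof (subst param_Ck_cong[OF S(1)])
        show "?\<gamma> c s (x, x) = (\<Sum>b\<in>Basis. (u s x \<bullet> b) *\<^sub>R dir_deriv UNIV (\<alpha> b s) x c) + dir_deriv UNIV (\<beta> s) x c"
          if "s \<in> ?J" "x \<in> S" for s x
          using slopes_diag[OF S(1) A that c] slopes_diag[OF S(1) B that c] by simp
        show "param_Ck k ?J S (\<lambda>s x. (\<Sum>b\<in>Basis. (u s x \<bullet> b) *\<^sub>R dir_deriv UNIV (\<alpha> b s) x c) + dir_deriv UNIV (\<beta> s) x c)"
          using Suc.prems(1,2) by (intro param_Ck_add param_Ck_sum param_Ck_scaleR param_Ck_inner_left S(1) uk) auto
      qed
    qed
    have "param_Ck k ?J S (\<lambda>s x. \<Sum>c\<in>Basis. (v \<bullet> c) *\<^sub>R z c s (x, x))" for v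
    proof (rule param_Ck_sum[OF S(1)])
      fix c :: 'e assume "c \<in> Basis"
      show "param_Ck k ?J S (\<lambda>s x. (v \<bullet> c) *\<^sub>R z c s (x, x))"
        by (rule param_Ck_scaleR[OF S(1) param_Ck_const zk[OF \<open>c \<in> Basis\<close>]])
    qed
    with slopes_has_derivative[OF S(1) sl] show ?case
      by (intro param_Ck_SucI[OF S(1) uc]) }
qed

section \<open>Smooth dependence of a flow on the initial value\<close>

text \<open>Three radii govern the local flow: initial values within \<open>r\<close>, trajectories
  in the compact ball of radius \<open>2 * r\<close>, smoothness on the open ball of radius
  \<open>3 * r\<close>. Slopes live on the last, and compactness of the middle one supplies a single
  \<open>M\<close> bounding both the field and the columns of its slopes.\<close>

lemma smooth_field_slopes:
  fixes X :: "'e::euclidean_space \<Rightarrow> 'e"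
  assumes "r > 0" and X: "smooth (ball x0 (3 * r)) X"
  shows "\<exists>h M. 0 \<le> M \<and> (\<forall>b\<in>Basis. continuous_on (cball x0 (2 * r) \<times> cball x0 (2 * r)) (h b)) \<and>
    (\<forall>y\<in>cball x0 (2 * r). norm (X y) \<le> M \<and> (\<forall>b\<in>Basis. h b (y, y) = dir_deriv UNIV X y b) \<and>
      (\<forall>z\<in>cball x0 (2 * r). X z - X y = apply_columns (\<lambda>b. h b (y, z)) (z - y) \<and> (\<Sum>b\<in>Basis. norm (h b (y, z))) \<le> M))"
proof -
  let ?K = "cball x0 (2 * r)" and ?B = "ball x0 (3 * r)"
  have KB: "?K \<subseteq> ?B" using assms(1) by auto
  have "param_Ck (Suc 0) {0::real} ?B (\<lambda>_. X)" using X by (rule smooth_imp_param_Ck)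
  from param_Ck_imp_slopes[OF open_ball convex_ball this]
  obtain z where z: "slopes {0::real} ?B (\<lambda>_. X) z" by blast
  define h where "h b p = z b 0 p" for b p
  have hc: "continuous_on (?K \<times> ?K) (h b)" if "b \<in> Basis" for b
  proof -
    have "continuous_on ({0} \<times> (?B \<times> ?B)) (\<lambda>(s, p). z b s p)" using z that by (simp add: slopes_def)
    then have "continuous_on (?K \<times> ?K) (\<lambda>p. (\<lambda>(s, p). z b s p) (0, p))"
      by (rule continuous_on_compose2) (use KB in \<open>auto intro!: continuous_intros\<close>)
    then show ?thesis by (simp add: h_def[abs_def])
  qed
  have "compact ((\<lambda>p. \<Sum>b\<in>Basis. norm (h b p)) ` (?K \<times> ?K))"
    by (intro compact_continuous_image continuous_on_sum continuous_on_norm hc compact_Times) auto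
  from compact_imp_bounded[OF this]
  obtain M1 where M1: "\<And>p. p \<in> ?K \<times> ?K \<Longrightarrow> norm (\<Sum>b\<in>Basis. norm (h b p)) \<le> M1"
    unfolding bounded_iff by blast
  have "continuous_on ?K X" using smooth_continuous[OF X] KB continuous_on_subset by blast
  then have "compact (X ` ?K)" by (intro compact_continuous_image) auto
  from compact_imp_bounded[OF this]
  obtain M2 where M2: "\<And>y. y \<in> ?K \<Longrightarrow> norm (X y) \<le> M2"
    unfolding bounded_iff by blast
  show ?thesis
  proof (intro exI[of _ h] exI[of _ "max 0 (max M1 M2)"] conjI ballI)
    fix y assume y: "y \<in> ?K"
    show "norm (X y) \<le> max 0 (max M1 M2)" using M2[OF y] by simp
    show "h b (y, y) = dir_deriv UNIV X y b" if "b \<in> Basis" for b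
      using slopes_diag[OF open_ball z _ _ that] y KB unfolding h_def by blast
    fix z' assume z': "z' \<in> ?K"
    show "X z' - X y = apply_columns (\<lambda>b. h b (y, z')) (z' - y)"
      using z y z' KB unfolding slopes_def apply_columns_def h_def by blast
    show "(\<Sum>b\<in>Basis. norm (h b (y, z'))) \<le> max 0 (max M1 M2)"
      using M1[of "(y, z')"] y z' by (simp add: abs_of_nonneg sum_nonneg)
  qed (use hc in auto)
qed

text \<open>\<open>M\<close> comes before \<open>a\<close> and \<open>\<Phi>\<close>, so that the
  time bound can be chosen from \<open>M\<close>, and confinement to the ball be proved, before
  regularity is claimed. \<open>\<Phi>\<close> is any family of solutions, so the flow of a manifold
  read in a chart fits.\<close>

lemma local_flow_param_Ck:
  fixes X :: "'e::euclidean_space \<Rightarrow> 'e"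
  assumes r: "r > 0" and X: "smooth (ball x0 (3 * r)) X"
  shows "\<exists>M\<ge>0. (\<forall>y\<in>cball x0 (2 * r). norm (X y) \<le> M) \<and>
    (\<forall>y\<in>cball x0 (2 * r). \<forall>z\<in>cball x0 (2 * r). norm (X z - X y) \<le> M * norm (z - y)) \<and>
    (\<forall>a \<Phi>. 0 \<le> a \<longrightarrow> a * M \<le> 1 / 2 \<longrightarrow>
      (\<forall>x\<in>ball x0 r. \<Phi> 0 x = x \<and> (\<forall>s\<in>{-a..a}. \<Phi> s x \<in> cball x0 (2 * r) \<and>
         ((\<lambda>s. \<Phi> s x) has_vector_derivative X (\<Phi> s x)) (at s within {-a..a}))) \<longrightarrow>
      (\<forall>k. param_Ck k {-a..a} (ball x0 r) \<Phi>))"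
proof -
  let ?K = "cball x0 (2 * r)" and ?S = "ball x0 r"
  obtain h M where M0: "0 \<le> M"
    and h1: "\<forall>b\<in>Basis. continuous_on (?K \<times> ?K) (h b)"
    and h2: "\<forall>y\<in>?K. norm (X y) \<le> M \<and> (\<forall>b\<in>Basis. h b (y, y) = dir_deriv UNIV X y b) \<and>
      (\<forall>z\<in>?K. X z - X y = apply_columns (\<lambda>b. h b (y, z)) (z - y) \<and> (\<Sum>b\<in>Basis. norm (h b (y, z))) \<le> M)"
    using smooth_field_slopes[OF assms] by (elim exE conjE)
  note hc = h1[rule_format]
  have XM: "norm (X y) \<le> M" and hd: "b \<in> Basis \<Longrightarrow> h b (y, y) = dir_deriv UNIV X y b"
    if "y \<in> ?K" for y b using h2 that by auto
  have hX: "X z - X y = apply_columns (\<lambda>b. h b (y, z)) (z - y)" and hM: "(\<Sum>b\<in>Basis. norm (h b (y, z))) \<le> M"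
    if "y \<in> ?K" "z \<in> ?K" for y z using h2 that by auto
  have lip: "norm (X z - X y) \<le> M * norm (z - y)" if "y \<in> ?K" "z \<in> ?K" for y z
    unfolding hX[OF that] by (rule norm_apply_columns_le[OF hM[OF that]])
  have "param_Ck k {-a..a} ?S \<Phi>"
    if a: "0 \<le> a" "a * M \<le> 1 / 2" and
      \<Phi>: "\<forall>x\<in>?S. \<Phi> 0 x = x \<and> (\<forall>s\<in>{-a..a}. \<Phi> s x \<in> ?K \<and>
         ((\<lambda>s. \<Phi> s x) has_vector_derivative X (\<Phi> s x)) (at s within {-a..a}))" for a \<Phi> k
  proof -
    let ?J = "{-a..a}"
    have \<Phi>0: "\<Phi> 0 x = x" if "x \<in> ?S" for x using \<Phi> that by blast
    have \<Phi>K: "\<Phi> s x \<in> ?K" if "s \<in> ?J" "x \<in> ?S" for s x using \<Phi> that by blast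
    have \<Phi>d: "((\<lambda>s. \<Phi> s x) has_vector_derivative X (\<Phi> s x)) (at s within ?J)"
      if "s \<in> ?J" "x \<in> ?S" for s x using \<Phi> that by blast
    have \<Phi>l: "dist (\<Phi> s y) (\<Phi> s x) \<le> 2 * dist y x" if "s \<in> ?J" "x \<in> ?S" "y \<in> ?S" for s x y
    proof -
      have "norm (\<Phi> s y - \<Phi> s x) \<le> 2 * (norm (\<Phi> 0 y - \<Phi> 0 x) + a * 0)"
        using that lip \<Phi>K
        by (intro small_time_gronwall[where z = "\<lambda>s. \<Phi> s y - \<Phi> s x" and z' = "\<lambda>s. X (\<Phi> s y) - X (\<Phi> s x)",
              OF _ _ a(1) M0 a(2) that(1)] has_vector_derivative_diff \<Phi>d) auto
      then show ?thesis using \<Phi>0 that by (simp add: dist_norm)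
    qed
    have \<Phi>c: "continuous_on (?J \<times> ?S) (\<lambda>(s, x). \<Phi> s x)"
      unfolding continuous_on_metric_iff
    proof clarsimp
      fix s1 x1 and e :: real assume s1: "- a \<le> s1" "s1 \<le> a" and x1: "dist x0 x1 < r" and e: "e > 0"
      have "continuous_on ?J (\<lambda>s. \<Phi> s x1)"
        by (rule continuous_on_vector_derivative[OF \<Phi>d]) (use x1 in auto)
      then obtain U where U: "open U" "s1 \<in> U" "\<forall>s\<in>U \<inter> ?J. dist (\<Phi> s x1) (\<Phi> s1 x1) < e / 2"
        using s1 e unfolding continuous_on_metric_iff by (metis half_gt_zero atLeastAtMost_iff)
      show "\<exists>W. open W \<and> (s1, x1) \<in> W \<and>
        (\<forall>q\<in>W \<inter> ?J \<times> ?S. dist (case q of (s, x) \<Rightarrow> \<Phi> s x) (\<Phi> s1 x1) < e)"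
      proof (intro exI[of _ "U \<times> ball x1 (e / 4)"] conjI ballI)
        fix q assume "q \<in> U \<times> ball x1 (e / 4) \<inter> ?J \<times> ?S"
        then obtain s x where q: "q = (s, x)" "s \<in> U \<inter> ?J" "dist x x1 < e / 4" "x \<in> ?S"
          by (auto simp: dist_commute)
        have "dist (\<Phi> s x) (\<Phi> s x1) \<le> 2 * dist x x1" using q x1 by (intro \<Phi>l) auto
        moreover have "dist (\<Phi> s x1) (\<Phi> s1 x1) < e / 2" using U(3) q(2) by blast
        ultimately show "dist (case q of (s, x) \<Rightarrow> \<Phi> s x) (\<Phi> s1 x1) < e"
          using dist_triangle[of "\<Phi> s x" "\<Phi> s1 x1" "\<Phi> s x1"] q by simp
      qed (use U e in \<open>auto intro: open_Times\<close>)
    qed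
    have "\<exists>z. slopes ?J ?S \<Phi> z \<and> (\<forall>x\<in>?S. \<forall>c\<in>Basis. z c 0 (x, x) = c \<and> (\<forall>s\<in>?J.
      ((\<lambda>s. z c s (x, x)) has_vector_derivative apply_columns (\<lambda>b. h b (\<Phi> s (fst (x, x)), \<Phi> s (snd (x, x)))) (z c s (x, x)) + 0)
        (at s within ?J)))"
    \<comment> \<open>The difference of two trajectories solves a homogeneous equation whose columns
      are slopes of \<open>X\<close>. On the diagonal it is the variational equation, and the
      initial slopes are the basis vectors since \<open>\<Phi> 0\<close> is the identity on the
      ball.\<close>
    proof (rule linear_ode_slopes[OF _ _ _ a(1) M0 a(2), where \<gamma> = "\<lambda>c s p. 0"
          and \<alpha> = "\<lambda>b s p. h b (\<Phi> s (fst p), \<Phi> s (snd p))"])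
      have "continuous_on (?J \<times> (?S \<times> ?S)) (\<lambda>q. (\<lambda>(s, x). \<Phi> s x) (fst q, fst (snd q)))"
        by (rule continuous_on_compose2[OF \<Phi>c]) (auto intro!: continuous_intros)
      moreover have "continuous_on (?J \<times> (?S \<times> ?S)) (\<lambda>q. (\<lambda>(s, x). \<Phi> s x) (fst q, snd (snd q)))"
        by (rule continuous_on_compose2[OF \<Phi>c]) (auto intro!: continuous_intros)
      ultimately have "continuous_on (?J \<times> (?S \<times> ?S)) (\<lambda>q. (\<Phi> (fst q) (fst (snd q)), \<Phi> (fst q) (snd (snd q))))"
        by (auto intro: continuous_on_Pair)
      then show "continuous_on (?J \<times> (?S \<times> ?S)) (\<lambda>(s, p). h b (\<Phi> s (fst p), \<Phi> s (snd p)))"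
        if "b \<in> Basis" for b
        unfolding split_beta by (rule continuous_on_compose2[OF hc[OF that]]) (use \<Phi>K in auto)
      show "(\<Sum>b\<in>Basis. norm (h b (\<Phi> s (fst p), \<Phi> s (snd p)))) \<le> M" if "s \<in> ?J" "p \<in> ?S \<times> ?S" for s p
        using that by (intro hM \<Phi>K) auto
      show "\<Phi> 0 y - \<Phi> 0 x = (\<Sum>c\<in>Basis. ((y - x) \<bullet> c) *\<^sub>R c)" if "x \<in> ?S" "y \<in> ?S" for x y
        using \<Phi>0 that by (simp add: euclidean_representation)
      show "((\<lambda>s. \<Phi> s y - \<Phi> s x) has_vector_derivative
          apply_columns (\<lambda>b. h b (\<Phi> s (fst (x, y)), \<Phi> s (snd (x, y)))) (\<Phi> s y - \<Phi> s x)
          + (\<Sum>c\<in>Basis. ((y - x) \<bullet> c) *\<^sub>R 0)) (at s within ?J)"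
        if "x \<in> ?S" "y \<in> ?S" "s \<in> ?J" for x y s
        using has_vector_derivative_diff[OF \<Phi>d[OF that(3,2)] \<Phi>d[OF that(3,1)]]
        by (simp add: hX[OF \<Phi>K[OF that(3,1)] \<Phi>K[OF that(3,2)]])
    qed simp
    then obtain z where sl: "slopes ?J ?S \<Phi> z"
      and z0: "\<And>x c. x \<in> ?S \<Longrightarrow> c \<in> Basis \<Longrightarrow> z c 0 (x, x) = c"
      and zd: "\<And>x c s. x \<in> ?S \<Longrightarrow> c \<in> Basis \<Longrightarrow> s \<in> ?J \<Longrightarrow> ((\<lambda>s. z c s (x, x)) has_vector_derivative
          apply_columns (\<lambda>b. h b (\<Phi> s x, \<Phi> s x)) (z c s (x, x)) + 0) (at s within ?J)"
      by auto
    show "param_Ck k ?J ?S \<Phi>"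
    \<comment> \<open>The bootstrap: class \<open>k\<close> of \<open>\<Phi>\<close> gives class
      \<open>k\<close> to the coefficients \<open>dir_deriv UNIV X (\<Phi> s x) b\<close> of the
      variational equation, hence to its solutions, which make up the derivative of
      \<open>\<Phi>\<close>; so \<open>\<Phi>\<close> has class \<open>Suc k\<close>.\<close>
    proof (induction k)
      case 0 then show ?case using \<Phi>c by simp
    next
      case (Suc k)
      have "param_Ck k ?J ?S (\<lambda>s x. z c s (x, x))" if c: "c \<in> Basis" for c
      proof (rule linear_ode_param_Ck[OF open_ball convex_ball a(1) M0 a(2), where \<beta> = "\<lambda>s x. 0"
            and \<alpha> = "\<lambda>b s x. h b (\<Phi> s x, \<Phi> s x)" and w = c])
        show "param_Ck k ?J ?S (\<lambda>s x. h b (\<Phi> s x, \<Phi> s x))" if b: "b \<in> Basis" for b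
        proof (subst param_Ck_cong[OF open_ball])
          show "h b (\<Phi> s x, \<Phi> s x) = dir_deriv UNIV X (\<Phi> s x) b" if "s \<in> ?J" "x \<in> ?S" for s x
            using hd[OF \<Phi>K[OF that] b] .
          have "\<Phi> s x \<in> ball x0 (3 * r)" if "s \<in> ?J" "x \<in> ?S" for s x
            using \<Phi>K[OF that] r by auto
          then show "param_Ck k ?J ?S (\<lambda>s x. dir_deriv UNIV X (\<Phi> s x) b)"
            by (intro param_Ck_chain[of ?S "ball x0 (3 * r)" k ?J "\<lambda>_ x. dir_deriv UNIV X x b" \<Phi>]
                smooth_imp_param_Ck smooth_dir_deriv X Suc.IH) auto
        qed
      qed (use hM \<Phi>K z0 zd c in \<open>auto intro: param_Ck_const\<close>)
      then have "param_Ck k ?J ?S (\<lambda>s x. (v \<bullet> c) *\<^sub>R z c s (x, x))" if "c \<in> Basis" for v c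
        using param_Ck_scaleR[OF open_ball param_Ck_const] that by blast
      then have "param_Ck k ?J ?S (\<lambda>s x. \<Sum>c\<in>Basis. (v \<bullet> c) *\<^sub>R z c s (x, x))" for v
        by (rule param_Ck_sum[OF open_ball])
      with slopes_has_derivative[OF open_ball sl] show ?case
        by (intro param_Ck_SucI[OF open_ball \<Phi>c])
    qed
  qed
  then show ?thesis using M0 XM lip by (intro exI[of _ M]) blast
qed

section \<open>Smooth maps and flows on manifolds\<close>

locale manifold =
  fixes A :: "('a::{t2_space,second_countable_topology}, 'e::euclidean_space) chart set"
  assumes smooth_manifold: "smooth_manifold UNIV A"
begin

lemma ex_chart: "\<exists>c\<in>A. p \<in> fst c"
  using chart_at_in_atlas[OF smooth_manifold] by blast

lemma
  assumes "c \<in> A"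
  shows open_dom: "open (fst c)" and open_im: "open (snd c ` fst c)"
    and chart_homeo: "homeomorphism (fst c) (snd c ` fst c) (snd c) (chart_inv c)"
  using smooth_manifold assms unfolding smooth_manifold_def is_chart_def by auto

lemma
  assumes "c \<in> A"
  shows inv_chart: "p \<in> fst c \<Longrightarrow> chart_inv c (snd c p) = p"
    and chart_inv: "x \<in> snd c ` fst c \<Longrightarrow> snd c (chart_inv c x) = x"
    and chart_inv_dom: "x \<in> snd c ` fst c \<Longrightarrow> chart_inv c x \<in> fst c"
    and continuous_chart: "continuous_on (fst c) (snd c)"
    and continuous_chart_inv: "continuous_on (snd c ` fst c) (chart_inv c)"
  using chart_homeo[OF assms] unfolding homeomorphism_def by auto

lemma open_chart_image:
  assumes "c \<in> A" "open W" "W \<subseteq> fst c" shows "open (snd c ` W)"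
proof -
  have "snd c ` W = chart_inv c -` W \<inter> snd c ` fst c"
    using assms inv_chart[OF assms(1)] chart_inv[OF assms(1)] by (auto simp: image_iff)
  then show ?thesis
    using continuous_on_open_vimage[OF open_im[OF assms(1)]] continuous_chart_inv[OF assms(1)] assms(2)
    by (metis Int_commute)
qed

lemma open_chart_vimage:
  assumes "c \<in> A" "open T" shows "open (fst c \<inter> snd c -` T)"
  using continuous_on_open_vimage[OF open_dom[OF assms(1)]] continuous_chart[OF assms(1)] assms(2)
  by (metis Int_commute)

lemma smooth_transition:
  assumes "c \<in> A" "d \<in> A" shows "smooth (snd c ` (fst c \<inter> fst d)) (transition c d)"
  using smooth_manifold assms unfolding smooth_manifold_def by auto

lemma smooth_function_chart:
  "h \<in> smooth_functions UNIV A \<Longrightarrow> c \<in> A \<Longrightarrow> smooth (snd c ` fst c) (\<lambda>y. h (chart_inv c y))"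
  unfolding smooth_functions_def comp_def by simp

text \<open>Asking \<open>F\<close> to map \<open>W\<close> into one chart domain makes continuity
  of \<open>F\<close> on \<open>W\<close> a consequence: \<open>F\<close> is recovered there from
  its smooth coordinate form.\<close>

definition smooth_map_at :: "('a \<Rightarrow> 'a) \<Rightarrow> 'a \<Rightarrow> bool" where
  "smooth_map_at F p \<longleftrightarrow> (\<exists>c\<in>A. \<exists>d\<in>A. \<exists>W. open W \<and> p \<in> W \<and> W \<subseteq> fst c \<and> F ` W \<subseteq> fst d \<and>
     smooth (snd c ` W) (\<lambda>y. snd d (F (chart_inv c y))))"

text \<open>Changing charts composes the coordinate form with transition maps on both sides.
  Continuity of \<open>F\<close> is obtained first, since it makes the set of points sent into the
  domain of \<open>d\<close> open.\<close>

lemma smooth_map_at_charts: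
  assumes "smooth_map_at F p" and c: "c \<in> A" "p \<in> fst c" and d: "d \<in> A" "F p \<in> fst d"
  shows "\<exists>W. open W \<and> p \<in> W \<and> W \<subseteq> fst c \<and> F ` W \<subseteq> fst d \<and> continuous_on W F \<and>
     smooth (snd c ` W) (\<lambda>y. snd d (F (chart_inv c y)))"
proof -
  obtain c' d' W where c': "c' \<in> A" and d': "d' \<in> A" and W: "open W" "p \<in> W" "W \<subseteq> fst c'" "F ` W \<subseteq> fst d'"
    and sm: "smooth (snd c' ` W) (\<lambda>y. snd d' (F (chart_inv c' y)))"
    using assms(1) unfolding smooth_map_at_def by blast
  have "continuous_on W (\<lambda>q. snd d' (F (chart_inv c' (snd c' q))))"
    by (rule continuous_on_compose2[OF smooth_continuous[OF sm] continuous_on_subset[OF continuous_chart[OF c'] W(3)]]) simp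
  then have "continuous_on W (\<lambda>q. chart_inv d' (snd d' (F (chart_inv c' (snd c' q)))))"
    by (rule continuous_on_compose2[OF continuous_chart_inv[OF d']])
      (use W inv_chart[OF c'] in \<open>auto simp: subset_iff image_subset_iff\<close>)
  moreover have "chart_inv d' (snd d' (F (chart_inv c' (snd c' q)))) = F q" if "q \<in> W" for q
  proof -
    have "chart_inv c' (snd c' q) = q" using that W inv_chart[OF c'] by auto
    moreover have "F q \<in> fst d'" using that W by auto
    ultimately show ?thesis using inv_chart[OF d'] by simp
  qed
  ultimately have FC: "continuous_on W F" by (simp cong: continuous_on_cong)
  let ?W = "W \<inter> fst c \<inter> (F -` fst d \<inter> W)"
  have "open (F -` fst d \<inter> W)"
    using continuous_on_open_vimage[OF W(1)] FC open_dom[OF d(1)] by blast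
  then have oW: "open ?W" using W(1) open_dom[OF c(1)] by blast
  have o1: "open (snd c ` ?W)" by (rule open_chart_image[OF c(1) oW]) blast
  have o2: "open (snd c' ` ?W)" by (rule open_chart_image[OF c' oW]) (use W in blast)
  have o3: "open (snd d' ` (fst d' \<inter> fst d))"
    by (rule open_chart_image[OF d' open_Int[OF open_dom[OF d'] open_dom[OF d(1)]]]) blast
  have s1: "smooth (snd c ` ?W) (transition c c')"
    by (rule smooth_subset[OF smooth_transition[OF c(1) c']]) (use W in blast)
  have s2: "smooth (snd c' ` ?W) (\<lambda>y. snd d' (F (chart_inv c' y)))"
    by (rule smooth_subset[OF sm]) blast
  have s3: "smooth (snd c' ` ?W) (\<lambda>y. transition d' d (snd d' (F (chart_inv c' y))))"
    by (rule smooth_chain[OF o2 o3 smooth_transition[OF d' d(1)] s2])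
      (use W inv_chart[OF c'] in \<open>auto simp: subset_iff image_subset_iff\<close>)
  have s4: "smooth (snd c ` ?W) (\<lambda>y. transition d' d (snd d' (F (chart_inv c' (transition c c' y)))))"
    by (rule smooth_chain[OF o1 o2 s3 s1]) (use inv_chart[OF c(1)] in \<open>auto simp: transition_def\<close>)
  have "smooth (snd c ` ?W) (\<lambda>y. snd d (F (chart_inv c y)))"
  proof (rule smooth_cong[OF o1, THEN iffD1, OF _ s4])
    fix y assume "y \<in> snd c ` ?W"
    then obtain q where q: "q \<in> ?W" "y = snd c q" by blast
    have "chart_inv c y = q" using q inv_chart[OF c(1)] by simp
    moreover have "chart_inv c' (snd c' q) = q" using q W inv_chart[OF c'] by auto
    moreover have "chart_inv d' (snd d' (F q)) = F q" using q W inv_chart[OF d'] by auto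
    ultimately show "transition d' d (snd d' (F (chart_inv c' (transition c c' y)))) = snd d (F (chart_inv c y))"
      by (simp add: transition_def)
  qed
  then show ?thesis
    using oW W(2) c(2) d(2) FC by (intro exI[of _ ?W]) (auto elim: continuous_on_subset)
qed

lemma smooth_map_at_compose:
  assumes "smooth_map_at F p" "smooth_map_at G (F p)" shows "smooth_map_at (\<lambda>x. G (F x)) p"
proof -
  obtain c d e where c: "c \<in> A" "p \<in> fst c" and d: "d \<in> A" "F p \<in> fst d" and e: "e \<in> A" "G (F p) \<in> fst e"
    using ex_chart by meson
  obtain W where W: "open W" "p \<in> W" "W \<subseteq> fst c" "F ` W \<subseteq> fst d" "continuous_on W F"
     "smooth (snd c ` W) (\<lambda>y. snd d (F (chart_inv c y)))"
    using smooth_map_at_charts[OF assms(1) c d] by blast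
  obtain V where V: "open V" "F p \<in> V" "V \<subseteq> fst d" "G ` V \<subseteq> fst e"
     "smooth (snd d ` V) (\<lambda>y. snd e (G (chart_inv d y)))"
    using smooth_map_at_charts[OF assms(2) d e] by blast
  let ?W = "F -` V \<inter> W"
  have oW: "open ?W" using continuous_on_open_vimage[OF W(1)] W(5) V(1) by blast
  have o1: "open (snd c ` ?W)" by (rule open_chart_image[OF c(1) oW]) (use W in blast)
  have o2: "open (snd d ` V)" by (rule open_chart_image[OF d(1) V(1,3)])
  have "smooth (snd c ` ?W) (\<lambda>y. snd e (G (chart_inv d (snd d (F (chart_inv c y))))))"
    by (rule smooth_chain[OF o1 o2 V(5) smooth_subset[OF W(6)]]) (use W inv_chart[OF c(1)] in auto)
  then have "smooth (snd c ` ?W) (\<lambda>y. snd e (G (F (chart_inv c y))))"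
  proof (rule smooth_cong[OF o1, THEN iffD1, rotated])
    fix y assume "y \<in> snd c ` ?W"
    then obtain q where q: "q \<in> ?W" "y = snd c q" by blast
    have "chart_inv c y = q" using q W inv_chart[OF c(1)] by auto
    moreover have "chart_inv d (snd d (F q)) = F q" using q W inv_chart[OF d(1)] by auto
    ultimately show "snd e (G (chart_inv d (snd d (F (chart_inv c y))))) = snd e (G (F (chart_inv c y)))"
      by simp
  qed
  then show ?thesis unfolding smooth_map_at_def
    using c d e oW W V by (intro bexI[of _ c] bexI[of _ e] exI[of _ ?W]) auto
qed

lemma smooth_functions_compose:
  assumes "\<And>p. smooth_map_at F p" and h: "h \<in> smooth_functions UNIV A"
  shows "h \<circ> F \<in> smooth_functions UNIV A"
  unfolding smooth_functions_def
proof (clarify, rule smooth_locally)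
  fix c :: "('a, 'e) chart" and y assume c: "c \<in> A" and y: "y \<in> snd c ` fst c"
  define p where "p = chart_inv c y"
  have p: "p \<in> fst c" "y = snd c p" using chart_inv chart_inv_dom c y by (auto simp: p_def)
  obtain d where d: "d \<in> A" "F p \<in> fst d" using ex_chart by blast
  obtain W where W: "open W" "p \<in> W" "W \<subseteq> fst c" "F ` W \<subseteq> fst d"
     "smooth (snd c ` W) (\<lambda>y. snd d (F (chart_inv c y)))"
    using smooth_map_at_charts[OF assms(1) c p(1) d] by blast
  have oW: "open (snd c ` W)" by (rule open_chart_image[OF c W(1,3)])
  have "smooth (snd c ` W) (\<lambda>y. h (chart_inv d (snd d (F (chart_inv c y)))))"
    by (rule smooth_chain[OF oW open_im[OF d(1)] smooth_function_chart[OF h d(1)] W(5)])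
      (use W inv_chart[OF c] in \<open>auto simp: subset_iff image_subset_iff\<close>)
  then have "smooth (snd c ` W) (h \<circ> F \<circ> chart_inv c)"
  proof (rule smooth_cong[OF oW, THEN iffD1, rotated])
    fix y assume "y \<in> snd c ` W"
    then have "chart_inv c y \<in> W" using W inv_chart[OF c] by auto
    then show "h (chart_inv d (snd d (F (chart_inv c y)))) = (h \<circ> F \<circ> chart_inv c) y"
      using W inv_chart[OF d(1)] by auto
  qed
  then show "\<exists>T. open T \<and> y \<in> T \<and> smooth T (h \<circ> F \<circ> chart_inv c)"
    using oW W(2) p by blast
qed

lemma smooth_functions_combination:
  assumes "h \<in> smooth_functions UNIV A" "k \<in> smooth_functions UNIV A"
  shows "(\<lambda>x. a * h x + b * k x) \<in> smooth_functions UNIV A"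
  using assms smooth_const open_im unfolding smooth_functions_def comp_def
  by (auto intro!: smooth_add smooth_mult)

end

section \<open>Integral curves and the flow of a complete vector field\<close>

lemma integral_curve_shift:
  assumes "integral_curve A f \<gamma>" shows "integral_curve A f (\<lambda>t. \<gamma> (t + s))"
proof -
  have "((snd c \<circ> (\<lambda>t. \<gamma> (t + s))) has_vector_derivative f c (\<gamma> (t + s))) (at t)"
    if "c \<in> A" "\<gamma> (t + s) \<in> fst c" for c t
  proof -
    have "((snd c \<circ> \<gamma>) has_vector_derivative f c (\<gamma> (t + s))) (at (t + s))"
      using assms that unfolding integral_curve_def by blast
    moreover have "((\<lambda>t. t + s) has_vector_derivative 1) (at t)"
      by (auto intro!: derivative_eq_intros)
    ultimately have "((snd c \<circ> \<gamma>) \<circ> (\<lambda>t. t + s) has_vector_derivative 1 *\<^sub>R f c (\<gamma> (t + s))) (at t)"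
      by (intro vector_diff_chain_at) auto
    then show ?thesis by (simp add: comp_def)
  qed
  moreover have "continuous_on UNIV (\<lambda>t. \<gamma> (t + s))"
    by (rule continuous_on_compose2[OF _ continuous_on_add[OF continuous_on_id continuous_on_const]])
      (use assms in \<open>auto simp: integral_curve_def\<close>)
  ultimately show ?thesis unfolding integral_curve_def by blast
qed

locale complete_field = manifold A
  for A :: "('a::{t2_space,second_countable_topology}, 'e::euclidean_space) chart set" +
  fixes f :: "('a, 'e) chart \<Rightarrow> 'a \<Rightarrow> 'e"
  assumes smooth_vector_field: "smooth_vector_field UNIV A f"
    and complete: "complete_vector_field A f"
begin

abbreviation X :: "('a, 'e) chart \<Rightarrow> 'e \<Rightarrow> 'e" where
  "X c y \<equiv> f c (chart_inv c y)"

lemma smooth_X: "c \<in> A \<Longrightarrow> smooth (snd c ` fst c) (X c)"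
  using smooth_vector_field unfolding smooth_vector_field_def comp_def by auto

lemma transform_f:
  "c \<in> A \<Longrightarrow> d \<in> A \<Longrightarrow> p \<in> fst c \<Longrightarrow> p \<in> fst d \<Longrightarrow>
    f d p = dir_deriv UNIV (transition c d) (snd c p) (f c p)"
  using smooth_vector_field unfolding smooth_vector_field_def by blast

lemma smooth_ball:
  assumes c: "c \<in> A" "p \<in> fst c"
  obtains r where "r > 0" "cball (snd c p) (3 * r) \<subseteq> snd c ` fst c" "smooth (ball (snd c p) (3 * r)) (X c)"
proof -
  obtain e where e: "e > 0" "cball (snd c p) e \<subseteq> snd c ` fst c"
    using open_im[OF c(1)] c(2) unfolding open_contains_cball by (metis imageI)
  have "smooth (ball (snd c p) e) (X c)"
    by (rule smooth_subset[OF smooth_X[OF c(1)]]) (use e ball_subset_cball in blast)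
  then show ?thesis using that[of "e / 3"] e by simp
qed

lemma curve_chart_derivative:
  assumes "integral_curve A f \<gamma>" "c \<in> A" "\<gamma> t \<in> fst c"
  shows "((\<lambda>t. snd c (\<gamma> t)) has_vector_derivative X c (snd c (\<gamma> t))) (at t within S)"
proof -
  have "((snd c \<circ> \<gamma>) has_vector_derivative f c (\<gamma> t)) (at t)"
    using assms unfolding integral_curve_def by blast
  then show ?thesis using assms by (simp add: comp_def inv_chart has_vector_derivative_at_within)
qed

text \<open>In a chart around the common point both curves solve the same equation with a Lipschitz
  right-hand side, and \<open>small_time_gronwall\<close> with \<open>\<eta> = 0\<close> bounds
  their distance by twice their distance at time \<open>t\<close>, which is 0.\<close>

lemma curves_locally_equal:
  assumes \<gamma>: "integral_curve A f \<gamma>" and \<delta>: "integral_curve A f \<delta>" and eq: "\<gamma> t = \<delta> t"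
  shows "\<exists>a>0. \<forall>s. dist s t < a \<longrightarrow> \<gamma> s = \<delta> s"
proof -
  obtain c where c: "c \<in> A" "\<gamma> t \<in> fst c" using ex_chart by blast
  let ?x = "snd c (\<gamma> t)"
  obtain r where r: "r > 0" "cball ?x (3 * r) \<subseteq> snd c ` fst c" "smooth (ball ?x (3 * r)) (X c)"
    using smooth_ball[OF c] by blast
  obtain M where M: "0 \<le> M"
    "\<And>y z. y \<in> cball ?x (2 * r) \<Longrightarrow> z \<in> cball ?x (2 * r) \<Longrightarrow> norm (X c z - X c y) \<le> M * norm (z - y)"
    using local_flow_param_Ck[OF r(1,3)] by blast
  let ?W = "fst c \<inter> snd c -` ball ?x (2 * r)"
  have oW: "open ?W" by (rule open_chart_vimage[OF c(1) open_ball])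
  have "open (\<gamma> -` ?W \<inter> \<delta> -` ?W)"
    using \<gamma> \<delta> unfolding integral_curve_def by (intro open_Int open_vimage[OF oW]) auto
  moreover have "t \<in> \<gamma> -` ?W \<inter> \<delta> -` ?W" using c eq r(1) by simp
  ultimately obtain e where e: "e > 0" "\<And>s. dist s t < e \<Longrightarrow> s \<in> \<gamma> -` ?W \<inter> \<delta> -` ?W"
    unfolding open_dist by blast
  \<comment> \<open>\<open>e / 2\<close> keeps both curves in the ball where \<open>M\<close> is a
    Lipschitz constant, and the other bound gives \<open>a * M \<le> 1 / 2\<close>; adding 1 to
    \<open>M\<close> covers \<open>M = 0\<close>.\<close>
  define a where "a = min (e / 2) (1 / (2 * (M + 1)))"
  have a: "a > 0" "a < e" using e(1) M(1) by (auto simp: a_def)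
  have aM: "a * M \<le> 1 / 2"
  proof -
    have "a * M \<le> (1 / (2 * (M + 1))) * (M + 1)" using a(1) M(1) by (intro mult_mono) (auto simp: a_def)
    also have "\<dots> = 1 / 2" using M(1) by (simp add: field_simps)
    finally show ?thesis .
  qed
  have "\<gamma> (s + t) = \<delta> (s + t)" if s: "s \<in> {-a..a}" for s
  proof -
    have near: "\<gamma> (r + t) \<in> ?W" "\<delta> (r + t) \<in> ?W" if "r \<in> {-a..a}" for r
      using e(2)[of "r + t"] that a(2) by (auto simp: dist_real_def)
    have "norm (snd c (\<gamma> (s + t)) - snd c (\<delta> (s + t)))
        \<le> 2 * (norm (snd c (\<gamma> (0 + t)) - snd c (\<delta> (0 + t))) + a * 0)"
    proof (rule small_time_gronwall[where z = "\<lambda>s. snd c (\<gamma> (s + t)) - snd c (\<delta> (s + t))"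
          and z' = "\<lambda>s. X c (snd c (\<gamma> (s + t))) - X c (snd c (\<delta> (s + t)))", OF _ _ _ M(1) aM s])
      fix q assume q: "q \<in> {-a..a}"
      show "((\<lambda>s. snd c (\<gamma> (s + t)) - snd c (\<delta> (s + t))) has_vector_derivative
          X c (snd c (\<gamma> (q + t))) - X c (snd c (\<delta> (q + t)))) (at q within {-a..a})"
        using near[OF q]
        by (intro has_vector_derivative_diff[OF
              curve_chart_derivative[OF integral_curve_shift[OF \<gamma>, of t] c(1)]
              curve_chart_derivative[OF integral_curve_shift[OF \<delta>, of t] c(1)]]) blast+
      show "norm (X c (snd c (\<gamma> (q + t))) - X c (snd c (\<delta> (q + t))))
          \<le> M * norm (snd c (\<gamma> (q + t)) - snd c (\<delta> (q + t))) + 0"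
        using near[OF q] M(2)[of "snd c (\<delta> (q + t))" "snd c (\<gamma> (q + t))"] by auto
    qed (use a in auto)
    then have "snd c (\<gamma> (s + t)) = snd c (\<delta> (s + t))" using eq by simp
    then show ?thesis using near[OF s] inv_chart[OF c(1)] by (metis IntD1)
  qed
  then have "\<gamma> s = \<delta> s" if "dist s t < a" for s
    using that \<open>\<And>s. s \<in> {-a..a} \<Longrightarrow> \<gamma> (s + t) = \<delta> (s + t)\<close>[of "s - t"]
    by (simp add: dist_real_def abs_less_iff)
  then show ?thesis using a(1) by blast
qed

text \<open>The set of times of agreement is closed because the manifold is Hausdorff, open by
  \<open>curves_locally_equal\<close>, and the real line is connected.\<close>

lemma integral_curve_unique:
  assumes \<gamma>: "integral_curve A f \<gamma>" and \<delta>: "integral_curve A f \<delta>" and eq: "\<gamma> t0 = \<delta> t0"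
  shows "\<gamma> = \<delta>"
proof -
  let ?S = "{t. \<gamma> t = \<delta> t}"
  have "closed ?S" using \<gamma> \<delta> unfolding integral_curve_def by (intro closed_Collect_eq) auto
  moreover have "open ?S"
    unfolding open_dist using curves_locally_equal[OF \<gamma> \<delta>] by auto
  moreover have "t0 \<in> ?S" using eq by simp
  ultimately have "?S = UNIV" using clopen[of ?S] by blast
  then show ?thesis by auto
qed

abbreviation \<Phi> :: "real \<Rightarrow> 'a \<Rightarrow> 'a" where "\<Phi> \<equiv> flow A f"

lemma flow_eq:
  assumes "integral_curve A f \<gamma>" shows "\<Phi> t (\<gamma> 0) = \<gamma> t"
proof -
  have "(THE \<delta>. integral_curve A f \<delta> \<and> \<delta> 0 = \<gamma> 0) = \<gamma>"
    using assms integral_curve_unique by (intro the_equality) auto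
  then show ?thesis by (simp add: flow_def)
qed

lemma flow_curve: "integral_curve A f (\<lambda>t. \<Phi> t x)"
  and flow_0: "\<Phi> 0 x = x"
proof -
  obtain \<gamma> where \<gamma>: "integral_curve A f \<gamma>" "\<gamma> 0 = x"
    using complete unfolding complete_vector_field_def by blast
  then have "\<Phi> t x = \<gamma> t" for t using flow_eq by blast
  then show "integral_curve A f (\<lambda>t. \<Phi> t x)" "\<Phi> 0 x = x" using \<gamma> by auto
qed

lemma flow_add: "\<Phi> (s + t) x = \<Phi> s (\<Phi> t x)"
  using flow_eq[OF integral_curve_shift[OF flow_curve, of t x], of s] by simp

lemma continuous_flow_time: "continuous_on UNIV (\<lambda>t. \<Phi> t x)"
  using flow_curve unfolding integral_curve_def by blast

text \<open>A first exit argument in both time directions. Were there a bad time, take one,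
  \<open>s1\<close>, of least modulus. Up to then the speed is at most \<open>M\<close>, so the
  coordinates have moved by at most \<open>a * M < r\<close> from a point within \<open>r\<close> of
  \<open>x0\<close>, and the curve is still inside at \<open>s1\<close>.\<close>

lemma curve_stays_in_ball:
  assumes \<gamma>: "integral_curve A f \<gamma>" and c: "c \<in> A" and K: "cball x0 (2 * r) \<subseteq> snd c ` fst c"
    and M: "\<And>y. y \<in> cball x0 (2 * r) \<Longrightarrow> norm (X c y) \<le> M"
    and a: "a * M < r" and init: "\<gamma> 0 \<in> fst c" "snd c (\<gamma> 0) \<in> ball x0 r" and s: "s \<in> {-a..a}"
  shows "\<gamma> s \<in> fst c \<and> snd c (\<gamma> s) \<in> ball x0 (2 * r)"
proof (rule ccontr)
  let ?W = "fst c \<inter> snd c -` ball x0 (2 * r)" and ?K = "chart_inv c ` cball x0 (2 * r)"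
  have r: "r > 0" using init(2) by (metis ball_eq_empty empty_iff not_le)
  have \<gamma>c: "continuous_on UNIV \<gamma>" using \<gamma> unfolding integral_curve_def by blast
  assume "\<not> ?thesis"
  then have ne: "s \<in> {-a..a} - \<gamma> -` ?W" using s by auto
  have "open (\<gamma> -` ?W)" by (rule open_vimage[OF open_chart_vimage[OF c open_ball] \<gamma>c])
  then have cpt: "compact ({-a..a} - \<gamma> -` ?W)" by (rule compact_diff[OF compact_Icc])
  have "continuous_on ({-a..a} - \<gamma> -` ?W) (\<lambda>s. \<bar>s\<bar>)" by (intro continuous_intros)
  then have "\<exists>s1\<in>{-a..a} - \<gamma> -` ?W. \<forall>s\<in>{-a..a} - \<gamma> -` ?W. \<bar>s1\<bar> \<le> \<bar>s\<bar>"
    by (rule continuous_attains_inf[OF cpt, rotated]) (rule notI, use ne in \<open>simp only: empty_iff\<close>)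
  then obtain s1 where s1: "s1 \<in> {-a..a} - \<gamma> -` ?W" and
    s1_le: "\<forall>s\<in>{-a..a} - \<gamma> -` ?W. \<bar>s1\<bar> \<le> \<bar>s\<bar>" by (rule bexE)
  have "\<gamma> 0 \<in> ?W" using init r by auto
  then have s1p: "\<bar>s1\<bar> > 0" using s1 by (cases "s1 = 0") auto
  have b: "ball 0 \<bar>s1\<bar> \<subseteq> \<gamma> -` ?K"
  proof
    fix q :: real assume "q \<in> ball 0 \<bar>s1\<bar>"
    then have "\<bar>q\<bar> < \<bar>s1\<bar>" by simp
    then have "q \<in> {-a..a}" "\<not> \<bar>s1\<bar> \<le> \<bar>q\<bar>" using s1 by auto
    then have "q \<in> \<gamma> -` ?W" using s1_le by blast
    then show "q \<in> \<gamma> -` ?K" using inv_chart[OF c] by (auto intro!: image_eqI[of _ _ "snd c (\<gamma> q)"])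
  qed
  \<comment> \<open>The image of the closed ball under \<open>chart_inv\<close> is compact, hence
    closed in the Hausdorff space, so at the two end times of modulus \<open>\<bar>s1\<bar>\<close>
    the curve cannot have left the chart domain.\<close>
  have "compact ?K"
    by (rule compact_continuous_image[OF continuous_on_subset[OF continuous_chart_inv[OF c] K]]) simp
  then have "closed (\<gamma> -` ?K)" by (intro closed_vimage compact_imp_closed \<gamma>c)
  then have "cball 0 \<bar>s1\<bar> \<subseteq> \<gamma> -` ?K"
    using closure_minimal[OF b] closure_ball[OF s1p, of "0::real"] by simp
  then have in_K: "\<gamma> q \<in> ?K" if "q \<in> {-\<bar>s1\<bar>..\<bar>s1\<bar>}" for q
    using that by (auto simp: abs_le_iff subset_iff)
  have in_dom: "\<gamma> q \<in> fst c" "snd c (\<gamma> q) \<in> cball x0 (2 * r)" if q: "q \<in> {-\<bar>s1\<bar>..\<bar>s1\<bar>}" for q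
  proof -
    obtain y where "y \<in> cball x0 (2 * r)" "\<gamma> q = chart_inv c y" using in_K[OF q] by blast
    then show "\<gamma> q \<in> fst c" "snd c (\<gamma> q) \<in> cball x0 (2 * r)"
      using K chart_inv[OF c] chart_inv_dom[OF c] by (auto simp: subset_iff)
  qed
  have "norm (snd c (\<gamma> s1) - snd c (\<gamma> 0)) \<le> \<bar>s1\<bar> * M"
    using in_dom M by (intro growth_bound[OF curve_chart_derivative[OF \<gamma> c]]) auto
  also have "\<dots> \<le> a * M" using s1 order_trans[OF norm_ge_zero M[of x0]] r by (intro mult_right_mono) auto
  also have "\<dots> < r" by (rule a)
  finally have "dist x0 (snd c (\<gamma> s1)) < r + r"
    using init(2) dist_triangle[of x0 "snd c (\<gamma> s1)" "snd c (\<gamma> 0)"] by (simp add: dist_norm norm_minus_commute)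
  moreover have "s1 \<in> {-\<bar>s1\<bar>..\<bar>s1\<bar>}" by auto
  ultimately have "\<gamma> s1 \<in> ?W" using in_dom(1)[of s1] by simp
  then show False using s1 by blast
qed

lemma local_flow:
  assumes c: "c \<in> A" "p \<in> fst c"
  obtains a r where "a > 0" "r > 0" "ball (snd c p) r \<subseteq> snd c ` fst c"
    "\<And>s x. s \<in> {-a..a} \<Longrightarrow> x \<in> ball (snd c p) r \<Longrightarrow> \<Phi> s (chart_inv c x) \<in> fst c"
    "\<And>k. param_Ck k {-a..a} (ball (snd c p) r) (\<lambda>s x. snd c (\<Phi> s (chart_inv c x)))"
proof -
  let ?x = "snd c p"
  obtain r where r: "r > 0" "cball ?x (3 * r) \<subseteq> snd c ` fst c" "smooth (ball ?x (3 * r)) (X c)"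
    using smooth_ball[OF c] by blast
  have K: "cball ?x (2 * r) \<subseteq> snd c ` fst c" and B: "ball ?x r \<subseteq> snd c ` fst c"
    using r(1) by (auto intro!: subsetD[OF r(2)])
  obtain M where M0: "0 \<le> M" and M1: "\<forall>y\<in>cball ?x (2 * r). norm (X c y) \<le> M"
    and sm: "\<forall>a \<Psi>. 0 \<le> a \<longrightarrow> a * M \<le> 1 / 2 \<longrightarrow>
      (\<forall>x\<in>ball ?x r. \<Psi> 0 x = x \<and> (\<forall>s\<in>{-a..a}. \<Psi> s x \<in> cball ?x (2 * r) \<and>
         ((\<lambda>s. \<Psi> s x) has_vector_derivative X c (\<Psi> s x)) (at s within {-a..a}))) \<longrightarrow>
      (\<forall>k. param_Ck k {-a..a} (ball ?x r) \<Psi>)"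
    using local_flow_param_Ck[OF r(1,3)] by (elim exE conjE)
  note M = M0 M1[rule_format]
  \<comment> \<open>The bound 1/2 serves the differential equation, \<open>r / 2\<close> makes
    \<open>a * M < r\<close> strict for confinement, and \<open>M + 1\<close> avoids division by
    0.\<close>
  define a where "a = min (1 / 2) (r / 2) / (M + 1)"
  have a: "a > 0" using r M(1) by (simp add: a_def)
  have "a * M \<le> a * (M + 1)" using a by simp
  also have "\<dots> = min (1 / 2) (r / 2)" using M(1) by (simp add: a_def)
  finally have aM: "a * M \<le> 1 / 2" "a * M < r" using r(1) by auto
  have stay: "\<Phi> s (chart_inv c x) \<in> fst c \<and> snd c (\<Phi> s (chart_inv c x)) \<in> ball ?x (2 * r)"
    if "s \<in> {-a..a}" "x \<in> ball ?x r" for s x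
    by (rule curve_stays_in_ball[OF flow_curve c(1) K M(2) aM(2) _ _ that(1)])
      (use that B chart_inv[OF c(1)] chart_inv_dom[OF c(1)] in \<open>auto simp: flow_0 subset_iff\<close>)
  show ?thesis
  proof (rule that[OF a r(1) B])
    show "\<Phi> s (chart_inv c x) \<in> fst c" if "s \<in> {-a..a}" "x \<in> ball ?x r" for s x
      using stay that by blast
    show "param_Ck k {-a..a} (ball ?x r) (\<lambda>s x. snd c (\<Phi> s (chart_inv c x)))" for k
    proof (rule sm[rule_format, OF less_imp_le[OF a] aM(1)], intro conjI ballI)
      fix x assume x: "x \<in> ball ?x r"
      show "snd c (\<Phi> 0 (chart_inv c x)) = x" using x B chart_inv[OF c(1)] by (auto simp: flow_0)
      fix s assume s: "s \<in> {-a..a}"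
      show "snd c (\<Phi> s (chart_inv c x)) \<in> cball ?x (2 * r)" using stay[OF s x] by auto
      show "((\<lambda>s. snd c (\<Phi> s (chart_inv c x))) has_vector_derivative X c (snd c (\<Phi> s (chart_inv c x)))) (at s within {-a..a})"
        using stay[OF s x] by (intro curve_chart_derivative[OF flow_curve c(1)]) auto
    qed
  qed
qed

lemma smooth_flow_small_time:
  "\<exists>a>0. \<exists>W. open W \<and> p \<in> W \<and> (\<forall>s\<in>{-a..a}. \<forall>q\<in>W. smooth_map_at (\<Phi> s) q)"
proof -
  obtain c where c: "c \<in> A" "p \<in> fst c" using ex_chart by blast
  obtain a r where a: "a > 0" and r: "r > 0" "ball (snd c p) r \<subseteq> snd c ` fst c"
    and dom: "\<And>s x. s \<in> {-a..a} \<Longrightarrow> x \<in> ball (snd c p) r \<Longrightarrow> \<Phi> s (chart_inv c x) \<in> fst c"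
    and sm: "\<And>k. param_Ck k {-a..a} (ball (snd c p) r) (\<lambda>s x. snd c (\<Phi> s (chart_inv c x)))"
    by (rule local_flow[OF c]) blast
  let ?W = "fst c \<inter> snd c -` ball (snd c p) r"
  have W: "open ?W" "p \<in> ?W" "?W \<subseteq> fst c" using open_chart_vimage[OF c(1) open_ball] c r(1) by auto
  have "smooth_map_at (\<Phi> s) q" if s: "s \<in> {-a..a}" and q: "q \<in> ?W" for s q
    unfolding smooth_map_at_def
  proof (intro bexI[OF _ c(1)] exI[of _ ?W] conjI W q)
    show "\<Phi> s ` ?W \<subseteq> fst c" using dom[OF s] inv_chart[OF c(1)] by force
    show "smooth (snd c ` ?W) (\<lambda>y. snd c (\<Phi> s (chart_inv c y)))"
      by (rule smooth_subset[OF smooth_slice[OF sm s]]) auto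
  qed
  then show ?thesis using a W by blast
qed

text \<open>For fixed \<open>p\<close> the set of times at which the flow is smooth at
  \<open>p\<close> is open and closed: near the trajectory point \<open>\<Phi> r p\<close> the flow
  is smooth for all short times, and \<open>\<Phi> t = \<Phi> (t - s) \<circ> \<Phi> s\<close>
  carries smoothness from any time \<open>s\<close> near \<open>r\<close> to any other
  \<open>t\<close> near \<open>r\<close>.\<close>

lemma smooth_flow: "smooth_map_at (\<Phi> t) p"
proof -
  let ?P = "{s. smooth_map_at (\<Phi> s) p}"
  have key: "\<exists>e>0. \<forall>s t. dist s r < e \<longrightarrow> dist t r < e \<longrightarrow> s \<in> ?P \<longrightarrow> t \<in> ?P" for r
  proof -
    obtain a W where a: "a > 0" and W: "open W" "\<Phi> r p \<in> W"
      and sm: "\<And>s q. s \<in> {-a..a} \<Longrightarrow> q \<in> W \<Longrightarrow> smooth_map_at (\<Phi> s) q"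
      using smooth_flow_small_time[of "\<Phi> r p"] by blast
    have "open ((\<lambda>s. \<Phi> s p) -` W)" by (rule open_vimage[OF W(1) continuous_flow_time])
    then obtain e where e: "e > 0" "\<And>s. dist s r < e \<Longrightarrow> \<Phi> s p \<in> W"
      using W(2) unfolding open_dist by (metis vimageD vimageI)
    have *: "t \<in> ?P" if "dist s r < min e (a / 2)" "dist t r < min e (a / 2)" "s \<in> ?P" for s t
    proof -
      have "\<bar>s - r\<bar> < a / 2" "\<bar>t - r\<bar> < a / 2" using that(1,2) by (simp_all add: dist_real_def)
      then have "t - s \<in> {-a..a}" unfolding atLeastAtMost_iff by linarith
      then have "smooth_map_at (\<Phi> (t - s)) (\<Phi> s p)" using sm e(2) that(1) by simp
      with that(3) have "smooth_map_at (\<lambda>x. \<Phi> (t - s) (\<Phi> s x)) p"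
        using smooth_map_at_compose[of "\<Phi> s" p "\<Phi> (t - s)"] by simp
      then show ?thesis by (simp add: flow_add[symmetric])
    qed
    have "min e (a / 2) > 0" using e(1) a by simp
    with * show ?thesis by blast
  qed
  have "open ?P" unfolding open_dist using key by (metis dist_self)
  moreover have "open (- ?P)" unfolding open_dist using key by (metis ComplD ComplI dist_self)
  moreover have "0 \<in> ?P"
    using smooth_flow_small_time[of p] by (force simp: less_imp_le)
  ultimately have "?P = UNIV" using clopen[of ?P] unfolding closed_def by blast
  then show ?thesis by blast
qed

text \<open>The chain rule for the transition map matches the transformation law of
  \<open>f\<close>, so the arbitrary chart in the definition may be replaced by any chart around
  \<open>p\<close>.\<close>

lemma lie_derivative_chart:
  assumes h: "h \<in> smooth_functions UNIV A" and c: "c \<in> A" "p \<in> fst c"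
  shows "lie_derivative UNIV A f h p = dir_deriv UNIV (\<lambda>y. h (chart_inv c y)) (snd c p) (f c p)"
proof -
  let ?d = "chart_at A p"
  have d: "?d \<in> A" "p \<in> fst ?d" using chart_at_in_atlas[OF smooth_manifold] by auto
  have o: "open (fst c \<inter> fst ?d)" using open_dom c d by blast
  have oi: "open (snd ?d ` (fst c \<inter> fst ?d))" using open_chart_image[OF d(1) o] by blast
  have pi: "snd ?d p \<in> snd ?d ` (fst c \<inter> fst ?d)" using c d by blast
  have t: "transition ?d c differentiable (at (snd ?d p))"
    using smooth_differentiable[OF smooth_transition[OF d(1) c(1)]] c d by blast
  have tp: "transition ?d c (snd ?d p) = snd c p" by (simp add: transition_def inv_chart[OF d])
  have hd: "(\<lambda>y. h (chart_inv c y)) differentiable (at (transition ?d c (snd ?d p)))"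
    unfolding tp using smooth_differentiable[OF smooth_function_chart[OF h c(1)]] c by blast
  have "dir_deriv UNIV (h \<circ> chart_inv ?d) (snd ?d p)
      = dir_deriv UNIV (\<lambda>y. h (chart_inv c (transition ?d c y))) (snd ?d p)"
    by (rule dir_deriv_cong_open[OF oi pi]) (auto simp: transition_def inv_chart[OF d(1)] inv_chart[OF c(1)])
  then have "lie_derivative UNIV A f h p = dir_deriv UNIV (\<lambda>y. h (chart_inv c (transition ?d c y))) (snd ?d p) (f ?d p)"
    by (simp add: lie_derivative_def Let_def)
  also have "\<dots> = dir_deriv UNIV (\<lambda>y. h (chart_inv c y)) (transition ?d c (snd ?d p))
      (dir_deriv UNIV (transition ?d c) (snd ?d p) (f ?d p))"
    by (rule dir_deriv_eqI[OF has_derivative_compose[OF has_derivative_dir_deriv[OF t] has_derivative_dir_deriv[OF hd]]])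
  finally show ?thesis by (simp add: tp transform_f[OF d(1) c(1) d(2) c(2)])
qed

lemma smooth_lie_derivative:
  assumes h: "h \<in> smooth_functions UNIV A"
  shows "lie_derivative UNIV A f h \<in> smooth_functions UNIV A"
  unfolding smooth_functions_def
proof clarify
  fix c :: "('a, 'e) chart" assume c: "c \<in> A"
  have "smooth (snd c ` fst c) (\<lambda>y. \<Sum>b\<in>Basis. (X c y \<bullet> b) * dir_deriv UNIV (\<lambda>y. h (chart_inv c y)) y b)"
    by (intro smooth_sum smooth_mult smooth_inner_left open_im[OF c] smooth_X[OF c]
        smooth_dir_deriv[OF smooth_function_chart[OF h c]])
  then show "smooth (snd c ` fst c) (lie_derivative UNIV A f h \<circ> chart_inv c)"
  proof (rule smooth_cong[OF open_im[OF c], THEN iffD1, rotated])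
    fix y assume y: "y \<in> snd c ` fst c"
    have "(lie_derivative UNIV A f h \<circ> chart_inv c) y = dir_deriv UNIV (\<lambda>y. h (chart_inv c y)) y (X c y)"
      using lie_derivative_chart[OF h c chart_inv_dom[OF c y]] chart_inv[OF c y] by simp
    also have "\<dots> = (\<Sum>b\<in>Basis. (X c y \<bullet> b) * dir_deriv UNIV (\<lambda>y. h (chart_inv c y)) y b)"
      unfolding real_scaleR_def[symmetric]
      by (rule dir_deriv_sum_Basis[OF smooth_differentiable[OF smooth_function_chart[OF h c] y]])
    finally show "(\<Sum>b\<in>Basis. (X c y \<bullet> b) * dir_deriv UNIV (\<lambda>y. h (chart_inv c y)) y b)
        = (lie_derivative UNIV A f h \<circ> chart_inv c) y" by simp
  qed
qed

lemma derivative_along_curve: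
  assumes h: "h \<in> smooth_functions UNIV A" and \<gamma>: "integral_curve A f \<gamma>"
  shows "((\<lambda>t. h (\<gamma> t)) has_vector_derivative lie_derivative UNIV A f h (\<gamma> t)) (at t)"
proof -
  obtain c where c: "c \<in> A" "\<gamma> t \<in> fst c" using ex_chart by blast
  have d: "(\<lambda>y. h (chart_inv c y)) differentiable (at (snd c (\<gamma> t)))"
    using smooth_differentiable[OF smooth_function_chart[OF h c(1)]] c by blast
  have "((\<lambda>t. snd c (\<gamma> t)) has_derivative (\<lambda>s. s *\<^sub>R f c (\<gamma> t))) (at t)"
    using curve_chart_derivative[OF \<gamma> c, of UNIV] inv_chart[OF c] by (simp add: has_vector_derivative_def)
  from has_derivative_compose[OF this has_derivative_dir_deriv[OF d]]
  have "((\<lambda>t. h (chart_inv c (snd c (\<gamma> t)))) has_vector_derivative lie_derivative UNIV A f h (\<gamma> t)) (at t)"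
    unfolding has_vector_derivative_def
    by (simp add: linear_cmul[OF linear_dir_deriv[OF d]] lie_derivative_chart[OF h c])
  moreover have "open (\<gamma> -` fst c)"
    using \<gamma> unfolding integral_curve_def by (intro open_vimage open_dom[OF c(1)]) auto
  ultimately show ?thesis
    using c(2) by (elim has_vector_derivative_transform_within_open[where S = "\<gamma> -` fst c"])
      (auto simp: inv_chart[OF c(1)])
qed

section \<open>The Koopman operators as a one-parameter group commuting with the Lie
  derivative\<close>

abbreviation U :: "real \<Rightarrow> ('a \<Rightarrow> real) \<Rightarrow> 'a \<Rightarrow> real" where "U \<equiv> koopman A f"

lemma smooth_koopman: "h \<in> smooth_functions UNIV A \<Longrightarrow> U t h \<in> smooth_functions UNIV A"
  unfolding koopman_def using smooth_flow by (rule smooth_functions_compose)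

lemma koopman_add: "U (s + t) h = U t (U s h)"
  by (auto simp: koopman_def flow_add)

lemma koopman_0: "U 0 h = h"
  by (auto simp: koopman_def flow_0)

text \<open>Both sides are the derivative at \<open>s = 0\<close> of
  \<open>h (\<Phi> s (\<Phi> t p))\<close>: once with \<open>h\<close> along the curve starting at
  \<open>\<Phi> t p\<close>, once, since time translations commute, with \<open>U t h\<close> along
  the curve starting at \<open>p\<close>.\<close>

lemma koopman_lie_derivative:
  assumes h: "h \<in> smooth_functions UNIV A"
  shows "U t (lie_derivative UNIV A f h) = lie_derivative UNIV A f (U t h)"
proof
  fix p
  have "((\<lambda>s. U t h (\<Phi> s p)) has_vector_derivative lie_derivative UNIV A f (U t h) (\<Phi> 0 p)) (at 0)"
    by (rule derivative_along_curve[OF smooth_koopman[OF h] flow_curve])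
  moreover have "U t h (\<Phi> s p) = h (\<Phi> s (\<Phi> t p))" for s
    by (simp add: koopman_def flow_add[symmetric] add.commute)
  ultimately have "((\<lambda>s. h (\<Phi> s (\<Phi> t p))) has_vector_derivative lie_derivative UNIV A f (U t h) p) (at 0)"
    by (simp add: flow_0)
  moreover have "((\<lambda>s. h (\<Phi> s (\<Phi> t p))) has_vector_derivative lie_derivative UNIV A f h (\<Phi> 0 (\<Phi> t p))) (at 0)"
    by (rule derivative_along_curve[OF h flow_curve])
  ultimately show "U t (lie_derivative UNIV A f h) p = lie_derivative UNIV A f (U t h) p"
    using vector_derivative_unique_at by (simp add: koopman_def flow_0) blast
qed

end

section \<open>Norms of iterated derivatives\<close>

text \<open>The sum runs over ordered words of at most \<open>j\<close> basis directions, so that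
  the recursion peels off one differentiation at a time, as do the product rule, the chain rule and
  the covariant derivative.\<close>

primrec jet_norm :: "nat \<Rightarrow> ('e::euclidean_space \<Rightarrow> real) \<Rightarrow> 'e \<Rightarrow> real" where
  "jet_norm 0 F x = \<bar>F x\<bar>"
| "jet_norm (Suc j) F x = \<bar>F x\<bar> + (\<Sum>b\<in>Basis. jet_norm j (\<lambda>y. dir_deriv UNIV F y b) x)"

lemma jet_norm_nonneg: "0 \<le> jet_norm j F x"
  by (induction j arbitrary: F) (auto intro!: add_nonneg_nonneg sum_nonneg)

lemma abs_le_jet_norm: "\<bar>F x\<bar> \<le> jet_norm j F x"
  by (cases j) (auto intro!: sum_nonneg jet_norm_nonneg)

lemma jet_norm_Suc_mono: "jet_norm j F x \<le> jet_norm (Suc j) F x"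
proof (induction j arbitrary: F)
  case 0 then show ?case by (simp add: sum_nonneg)
next
  case (Suc j)
  have "(\<Sum>b\<in>Basis. jet_norm j (\<lambda>y. dir_deriv UNIV F y b) x) \<le> (\<Sum>b\<in>Basis. jet_norm (Suc j) (\<lambda>y. dir_deriv UNIV F y b) x)"
    by (rule sum_mono) (rule Suc)
  then show ?case by simp
qed

lemma jet_norm_dir_deriv_le: "b \<in> Basis \<Longrightarrow> jet_norm j (\<lambda>y. dir_deriv UNIV F y b) x \<le> jet_norm (Suc j) F x"
  using member_le_sum[of b Basis "\<lambda>b. jet_norm j (\<lambda>y. dir_deriv UNIV F y b) x"] jet_norm_nonneg
  by fastforce

lemma jet_norm_cong:
  assumes "open S" "x \<in> S" "\<And>y. y \<in> S \<Longrightarrow> F y = G y" shows "jet_norm j F x = jet_norm j G x"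
  using assms(3)
proof (induction j arbitrary: F G)
  case 0 then show ?case using assms(2) by simp
next
  case (Suc j)
  have "jet_norm j (\<lambda>y. dir_deriv UNIV F y b) x = jet_norm j (\<lambda>y. dir_deriv UNIV G y b) x" for b
    using Suc.prems by (intro Suc.IH fun_cong[OF dir_deriv_cong_open[OF assms(1)]]) auto
  then show ?case using Suc.prems[OF assms(2)] by simp
qed

lemma jet_norm_add:
  assumes "open S" "x \<in> S" "smooth S F" "smooth S G"
  shows "jet_norm j (\<lambda>y. F y + G y) x \<le> jet_norm j F x + jet_norm j G x"
  using assms(3,4)
proof (induction j arbitrary: F G)
  case 0 then show ?case by simp
next
  case (Suc j)
  have "jet_norm j (\<lambda>y. dir_deriv UNIV (\<lambda>y. F y + G y) y b) x
      \<le> jet_norm j (\<lambda>y. dir_deriv UNIV F y b) x + jet_norm j (\<lambda>y. dir_deriv UNIV G y b) x" for b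
  proof -
    have "dir_deriv UNIV (\<lambda>y. F y + G y) y b = dir_deriv UNIV F y b + dir_deriv UNIV G y b" if "y \<in> S" for y
      using Suc.prems that
      by (intro dir_deriv_eqI[OF has_derivative_add[OF has_derivative_dir_deriv has_derivative_dir_deriv]] smooth_differentiable)
    then have "jet_norm j (\<lambda>y. dir_deriv UNIV (\<lambda>y. F y + G y) y b) x
      = jet_norm j (\<lambda>y. dir_deriv UNIV F y b + dir_deriv UNIV G y b) x"
      by (rule jet_norm_cong[OF assms(1,2)])
    also have "\<dots> \<le> jet_norm j (\<lambda>y. dir_deriv UNIV F y b) x + jet_norm j (\<lambda>y. dir_deriv UNIV G y b) x"
      by (intro Suc.IH smooth_dir_deriv Suc.prems)
    finally show ?thesis .
  qed
  then have "(\<Sum>b\<in>Basis. jet_norm j (\<lambda>y. dir_deriv UNIV (\<lambda>y. F y + G y) y b) x)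
      \<le> (\<Sum>b\<in>Basis. jet_norm j (\<lambda>y. dir_deriv UNIV F y b) x + jet_norm j (\<lambda>y. dir_deriv UNIV G y b) x)"
    by (rule sum_mono)
  then show ?case unfolding jet_norm.simps sum.distrib using abs_triangle_ineq[of "F x" "G x"] by linarith
qed

lemma jet_norm_0: "jet_norm j (\<lambda>y. 0) x = 0"
  by (induction j) (auto simp: dir_deriv_def)

lemma jet_norm_sum:
  assumes "open S" "x \<in> S" "\<And>i. i \<in> I \<Longrightarrow> smooth S (F i)"
  shows "jet_norm j (\<lambda>y. \<Sum>i\<in>I. F i y) x \<le> (\<Sum>i\<in>I. jet_norm j (F i) x)"
  using assms(3)
proof (induction I rule: infinite_finite_induct)
  case (insert i I)
  have "jet_norm j (\<lambda>y. F i y + (\<Sum>i\<in>I. F i y)) x \<le> jet_norm j (F i) x + jet_norm j (\<lambda>y. \<Sum>i\<in>I. F i y) x"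
    using insert.prems by (intro jet_norm_add[OF assms(1,2)] smooth_sum[OF assms(1)]) auto
  then show ?case using insert by fastforce
qed (simp_all add: jet_norm_0)

text \<open>Each differentiation splits a product into two terms, hence the factor
  \<open>2 ^ j\<close>.\<close>

lemma jet_norm_mult:
  assumes "open S" "x \<in> S" "smooth S F" "smooth S G"
  shows "jet_norm j (\<lambda>y. F y * G y) x \<le> 2 ^ j * (jet_norm j F x * jet_norm j G x)"
  using assms(3,4)
proof (induction j arbitrary: F G)
  case 0 then show ?case by (simp add: abs_mult)
next
  case (Suc j)
  let ?F = "\<lambda>b y. dir_deriv UNIV F y b" and ?G = "\<lambda>b y. dir_deriv UNIV G y b"
  have *: "jet_norm j (\<lambda>y. dir_deriv UNIV (\<lambda>y. F y * G y) y b) x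
      \<le> 2 ^ j * (jet_norm (Suc j) F x * jet_norm j (?G b) x) + 2 ^ j * (jet_norm j (?F b) x * jet_norm (Suc j) G x)" for b
  proof -
    have "dir_deriv UNIV (\<lambda>y. F y * G y) y b = F y * ?G b y + ?F b y * G y" if "y \<in> S" for y
      using Suc.prems that
      by (intro dir_deriv_eqI[OF has_derivative_mult[OF has_derivative_dir_deriv has_derivative_dir_deriv]] smooth_differentiable)
    then have "jet_norm j (\<lambda>y. dir_deriv UNIV (\<lambda>y. F y * G y) y b) x = jet_norm j (\<lambda>y. F y * ?G b y + ?F b y * G y) x"
      by (rule jet_norm_cong[OF assms(1,2)])
    also have "\<dots> \<le> jet_norm j (\<lambda>y. F y * ?G b y) x + jet_norm j (\<lambda>y. ?F b y * G y) x"
      by (intro jet_norm_add[OF assms(1,2)] smooth_mult assms(1) Suc.prems smooth_dir_deriv)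
    also have "\<dots> \<le> 2 ^ j * (jet_norm j F x * jet_norm j (?G b) x) + 2 ^ j * (jet_norm j (?F b) x * jet_norm j G x)"
      by (intro add_mono Suc.IH Suc.prems smooth_dir_deriv)
    also have "\<dots> \<le> 2 ^ j * (jet_norm (Suc j) F x * jet_norm j (?G b) x) + 2 ^ j * (jet_norm j (?F b) x * jet_norm (Suc j) G x)"
      by (intro add_mono mult_left_mono mult_right_mono jet_norm_Suc_mono jet_norm_nonneg) simp_all
    finally show ?thesis .
  qed
  let ?N = "jet_norm (Suc j) F x" and ?M = "jet_norm (Suc j) G x"
  let ?f = "\<Sum>b\<in>Basis. jet_norm j (?F b) x" and ?g = "\<Sum>b\<in>Basis. jet_norm j (?G b) x"
  have "(\<Sum>b\<in>Basis. jet_norm j (\<lambda>y. dir_deriv UNIV (\<lambda>y. F y * G y) y b) x)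
      \<le> (\<Sum>b\<in>Basis. 2 ^ j * (?N * jet_norm j (?G b) x) + 2 ^ j * (jet_norm j (?F b) x * ?M))"
    by (rule sum_mono) (rule *)
  also have "\<dots> = 2 ^ j * (?N * ?g + ?f * ?M)"
    by (simp only: sum.distrib sum_distrib_left[symmetric] sum_distrib_right[symmetric] distrib_left)
  finally have "jet_norm (Suc j) (\<lambda>y. F y * G y) x \<le> \<bar>F x\<bar> * \<bar>G x\<bar> + 2 ^ j * (?N * ?g + ?f * ?M)"
    by (simp add: abs_mult)
  \<comment> \<open>The term of order 0 is inflated to the shape of the others, so that the sums
    complete to the two full jet norms.\<close>
  also have "\<bar>F x\<bar> * \<bar>G x\<bar> \<le> 2 ^ j * (?N * \<bar>G x\<bar> + \<bar>F x\<bar> * ?M)"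
  proof -
    have "1 * (\<bar>F x\<bar> * \<bar>G x\<bar>) \<le> 2 ^ j * (?N * \<bar>G x\<bar> + \<bar>F x\<bar> * ?M)"
      by (intro mult_mono order_trans[OF mult_right_mono[OF abs_le_jet_norm[of F x "Suc j"] abs_ge_zero[of "G x"]]])
        (auto intro!: mult_nonneg_nonneg jet_norm_nonneg simp del: jet_norm.simps)
    then show ?thesis by simp
  qed
  also have "2 ^ j * (?N * \<bar>G x\<bar> + \<bar>F x\<bar> * ?M) + 2 ^ j * (?N * ?g + ?f * ?M) = 2 ^ Suc j * (?N * ?M)"
    by (simp add: algebra_simps)
  finally show ?case by simp
qed

lemma continuous_jet_norm:
  assumes "param_Ck j J S u" shows "continuous_on (J \<times> S) (\<lambda>(s, x). jet_norm j (u s) x)"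
  using assms
proof (induction j arbitrary: u)
  case 0 then show ?case by (auto simp: split_beta intro: continuous_on_rabs)
next
  case (Suc j)
  have "continuous_on (J \<times> S) (\<lambda>z. jet_norm j (\<lambda>y. dir_deriv UNIV (u (fst z)) y b) (snd z))" for b
    using Suc.IH[of "\<lambda>s x. dir_deriv UNIV (u s) x b"] Suc.prems by (simp add: split_beta)
  then show ?case using Suc.prems
    by (auto simp: split_beta intro!: continuous_on_add continuous_on_rabs continuous_on_sum)
qed

lemma continuous_jet_norm_smooth:
  assumes "smooth S F" shows "continuous_on S (jet_norm j F)"
proof -
  have "continuous_on ({0::real} \<times> S) (\<lambda>(s, x). jet_norm j F x)"
    by (rule continuous_jet_norm[OF smooth_imp_param_Ck[OF assms]])
  then have "continuous_on S (\<lambda>x. (\<lambda>(s, x). jet_norm j F x) (0::real, x))"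
    by (rule continuous_on_compose2) (auto intro!: continuous_intros)
  then show ?thesis by simp
qed

lemma jet_norm_bounded_on_compact:
  assumes "smooth S F" "compact K" "K \<subseteq> S"
  obtains B where "0 \<le> B" "\<And>x. x \<in> K \<Longrightarrow> jet_norm j F x \<le> B"
proof -
  have "compact (jet_norm j F ` K)"
    by (rule compact_continuous_image[OF continuous_on_subset[OF continuous_jet_norm_smooth[OF assms(1)] assms(3)] assms(2)])
  from compact_imp_bounded[OF this] obtain B where "\<And>y. y \<in> jet_norm j F ` K \<Longrightarrow> norm y \<le> B"
    unfolding bounded_iff by blast
  then have "jet_norm j F x \<le> max 0 B" if "x \<in> K" for x
    using that by fastforce
  then show ?thesis using that[of "max 0 B"] by simp
qed

text \<open>One constant for the whole of \<open>Z\<close>. In the main applications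
  \<open>Z\<close> consists of pairs of a function and a point, and uniformity in the function is
  what continuity of operators requires.\<close>

definition dominated :: "'z set \<Rightarrow> ('z \<Rightarrow> real) \<Rightarrow> ('z \<Rightarrow> real) \<Rightarrow> bool" where
  "dominated Z f g \<longleftrightarrow> (\<exists>C\<ge>0. \<forall>z\<in>Z. f z \<le> C * g z)"

lemma dominated_le: "(\<And>z. z \<in> Z \<Longrightarrow> f z \<le> g z) \<Longrightarrow> dominated Z f g"
  unfolding dominated_def by (rule exI[of _ 1]) simp

lemma dominated_trans:
  assumes "dominated Z f g" "dominated Z g h" shows "dominated Z f h"
proof -
  obtain C where C: "C \<ge> 0" "\<forall>z\<in>Z. f z \<le> C * g z" using assms(1) unfolding dominated_def by blast
  obtain D where D: "D \<ge> 0" "\<forall>z\<in>Z. g z \<le> D * h z" using assms(2) unfolding dominated_def by blast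
  have "f z \<le> C * D * h z" if "z \<in> Z" for z
    using C(2) mult_left_mono[OF D(2)[rule_format, OF that] C(1)] that by fastforce
  then show ?thesis unfolding dominated_def using C(1) D(1) by (intro exI[of _ "C * D"]) simp
qed

lemma dominated_le_left:
  "(\<And>z. z \<in> Z \<Longrightarrow> f z \<le> f' z) \<Longrightarrow> dominated Z f' g \<Longrightarrow> dominated Z f g"
  using dominated_trans dominated_le by blast

lemma dominated_le_right:
  "dominated Z f g \<Longrightarrow> (\<And>z. z \<in> Z \<Longrightarrow> g z \<le> g' z) \<Longrightarrow> dominated Z f g'"
  using dominated_trans dominated_le by blast

lemma dominated_add:
  assumes "dominated Z f g" "dominated Z f' g" shows "dominated Z (\<lambda>z. f z + f' z) g"
proof -
  obtain C where C: "C \<ge> 0" "\<forall>z\<in>Z. f z \<le> C * g z" using assms(1) unfolding dominated_def by blast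
  obtain D where D: "D \<ge> 0" "\<forall>z\<in>Z. f' z \<le> D * g z" using assms(2) unfolding dominated_def by blast
  have "f z + f' z \<le> (C + D) * g z" if "z \<in> Z" for z
    using C(2) D(2) that by (auto simp: distrib_right intro: add_mono)
  then show ?thesis unfolding dominated_def using C(1) D(1) by (intro exI[of _ "C + D"]) simp
qed

lemma dominated_sum:
  "(\<And>i. i \<in> I \<Longrightarrow> dominated Z (f i) g) \<Longrightarrow> dominated Z (\<lambda>z. \<Sum>i\<in>I. f i z) g"
proof (induction I rule: infinite_finite_induct)
  case (insert i I) then show ?case by (simp add: dominated_add)
qed (auto simp: dominated_def intro: exI[of _ 0])

lemma dominated_mult_bounded:
  assumes "\<And>z. z \<in> Z \<Longrightarrow> 0 \<le> a z \<and> a z \<le> B" "dominated Z f g" "\<And>z. z \<in> Z \<Longrightarrow> 0 \<le> g z" "0 \<le> B"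
  shows "dominated Z (\<lambda>z. a z * f z) g"
proof -
  obtain C where C: "C \<ge> 0" "\<forall>z\<in>Z. f z \<le> C * g z" using assms(2) unfolding dominated_def by blast
  have "a z * f z \<le> (B * C) * g z" if "z \<in> Z" for z
  proof -
    have "a z * f z \<le> a z * (C * g z)" using assms(1)[OF that] C(2) that by (intro mult_left_mono) auto
    also have "\<dots> \<le> B * (C * g z)" using assms(1,3)[OF that] C(1) by (intro mult_right_mono) auto
    finally show ?thesis by simp
  qed
  then show ?thesis unfolding dominated_def using C(1) assms(4) by (intro exI[of _ "B * C"]) simp
qed

lemma dominated_reparam:
  "dominated Z f g \<Longrightarrow> (\<And>z. z \<in> Z' \<Longrightarrow> m z \<in> Z) \<Longrightarrow> dominated Z' (\<lambda>z. f (m z)) (\<lambda>z. g (m z))"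
  unfolding dominated_def by blast

text \<open>The coefficients \<open>a i\<close> do not depend on \<open>z\<close>, and their jets
  are bounded on the compact set \<open>K\<close>; the product rule then charges the rest to the
  jets of the varying functions \<open>F i z\<close>.\<close>

lemma dominated_jet_norm_combination:
  assumes "open S" "compact K" "K \<subseteq> S" and a: "\<And>i. i \<in> I \<Longrightarrow> smooth S (a i)"
    and Z: "\<And>z. z \<in> Z \<Longrightarrow> x z \<in> K"
    and F: "\<And>i z. i \<in> I \<Longrightarrow> z \<in> Z \<Longrightarrow> smooth S (F i z)"
    and dom: "\<And>i. i \<in> I \<Longrightarrow> dominated Z (\<lambda>z. jet_norm j (F i z) (x z)) g" and g: "\<And>z. z \<in> Z \<Longrightarrow> 0 \<le> g z"
  shows "dominated Z (\<lambda>z. jet_norm j (\<lambda>y. \<Sum>i\<in>I. a i y * F i z y) (x z)) g"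
proof (rule dominated_le_left)
  show "jet_norm j (\<lambda>y. \<Sum>i\<in>I. a i y * F i z y) (x z)
      \<le> (\<Sum>i\<in>I. (2 ^ j * jet_norm j (a i) (x z)) * jet_norm j (F i z) (x z))" if "z \<in> Z" for z
  proof -
    have "x z \<in> S" using Z[OF that] assms(3) by blast
    have "jet_norm j (\<lambda>y. \<Sum>i\<in>I. a i y * F i z y) (x z) \<le> (\<Sum>i\<in>I. jet_norm j (\<lambda>y. a i y * F i z y) (x z))"
      using a F that by (intro jet_norm_sum[OF assms(1) \<open>x z \<in> S\<close>] smooth_mult[OF assms(1)]) auto
    also have "\<dots> \<le> (\<Sum>i\<in>I. 2 ^ j * (jet_norm j (a i) (x z) * jet_norm j (F i z) (x z)))"
      using a F that by (intro sum_mono jet_norm_mult[OF assms(1) \<open>x z \<in> S\<close>]) auto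
    finally show ?thesis by (simp add: mult.assoc)
  qed
  show "dominated Z (\<lambda>z. \<Sum>i\<in>I. (2 ^ j * jet_norm j (a i) (x z)) * jet_norm j (F i z) (x z)) g"
  proof (rule dominated_sum)
    fix i assume i: "i \<in> I"
    obtain B where B: "0 \<le> B" "\<And>x. x \<in> K \<Longrightarrow> jet_norm j (a i) x \<le> B"
      using jet_norm_bounded_on_compact[OF a[OF i] assms(2,3)] by blast
    show "dominated Z (\<lambda>z. (2 ^ j * jet_norm j (a i) (x z)) * jet_norm j (F i z) (x z)) g"
      by (rule dominated_mult_bounded[where B = "2 ^ j * B", OF _ dom[OF i] g])
        (use B Z jet_norm_nonneg in \<open>auto intro!: mult_left_mono mult_nonneg_nonneg\<close>)
  qed
qed

lemma dir_deriv_chain_Basis: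
  fixes F :: "'d::euclidean_space \<Rightarrow> real"
  assumes "F differentiable (at (G x))" "G differentiable (at x)"
  shows "dir_deriv UNIV (\<lambda>y. F (G y)) x v = (\<Sum>b\<in>Basis. (dir_deriv UNIV G x v \<bullet> b) * dir_deriv UNIV F (G x) b)"
  unfolding dir_deriv_eqI[OF has_derivative_compose[OF has_derivative_dir_deriv[OF assms(2)] has_derivative_dir_deriv[OF assms(1)]]]
    real_scaleR_def[symmetric]
  by (rule dir_deriv_sum_Basis[OF assms(1)])

text \<open>Each basis derivative of \<open>F \<circ> G\<close> is a combination of basis
  derivatives of \<open>F\<close>, composed with \<open>G\<close>, with coefficients from
  \<open>G\<close> alone. As \<open>F\<close> ranges over all smooth functions on \<open>T\<close>,
  the induction hypothesis applies to the derivatives of \<open>F\<close> with the same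
  constant.\<close>

lemma dominated_chain:
  fixes G :: "'e::euclidean_space \<Rightarrow> 'd::euclidean_space"
  assumes S: "open S" and T: "open T" and G: "smooth S G" "G ` S \<subseteq> T" and K: "compact K" "K \<subseteq> S"
  shows "dominated ({F. smooth T F} \<times> K) (\<lambda>z. jet_norm j (\<lambda>y. fst z (G y)) (snd z)) (\<lambda>z. jet_norm j (fst z) (G (snd z)))"
proof (induction j)
  case 0 then show ?case by (simp add: dominated_le)
next
  case (Suc j)
  let ?Z = "{F. smooth T F} \<times> K"
  let ?g = "\<lambda>z. jet_norm (Suc j) (fst z) (G (snd z))"
  have "dominated ?Z (\<lambda>z. jet_norm j (\<lambda>y. dir_deriv UNIV (\<lambda>y. fst z (G y)) y b) (snd z)) ?g" for b
  proof (rule dominated_le_left)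
    show "jet_norm j (\<lambda>y. dir_deriv UNIV (\<lambda>y. fst z (G y)) y b) (snd z)
      \<le> jet_norm j (\<lambda>y. \<Sum>b'\<in>Basis. (dir_deriv UNIV G y b \<bullet> b') * dir_deriv UNIV (fst z) (G y) b') (snd z)" if "z \<in> ?Z" for z
    proof (rule eq_refl, rule jet_norm_cong[OF S])
      show "snd z \<in> S" using that K by auto
      show "dir_deriv UNIV (\<lambda>y. fst z (G y)) y b = (\<Sum>b'\<in>Basis. (dir_deriv UNIV G y b \<bullet> b') * dir_deriv UNIV (fst z) (G y) b')"
        if "y \<in> S" for y
        using that \<open>z \<in> ?Z\<close> G by (intro dir_deriv_chain_Basis smooth_differentiable[of T] smooth_differentiable[of S]) auto
    qed
    show "dominated ?Z (\<lambda>z. jet_norm j (\<lambda>y. \<Sum>b'\<in>Basis. (dir_deriv UNIV G y b \<bullet> b') * dir_deriv UNIV (fst z) (G y) b') (snd z)) ?g"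
    proof (rule dominated_jet_norm_combination[OF S K])
      fix b' :: 'd assume b': "b' \<in> Basis"
      show "smooth S (\<lambda>y. dir_deriv UNIV G y b \<bullet> b')" by (intro smooth_inner_left S smooth_dir_deriv G)
      show "smooth S (\<lambda>y. dir_deriv UNIV (fst z) (G y) b')" if "z \<in> ?Z" for z
        using that by (intro smooth_chain[OF S T _ G] smooth_dir_deriv) auto
      have "dominated ?Z (\<lambda>z. jet_norm j (\<lambda>y. dir_deriv UNIV (fst z) (G y) b') (snd z))
          (\<lambda>z. jet_norm j (\<lambda>y. dir_deriv UNIV (fst z) y b') (G (snd z)))"
        using dominated_reparam[OF Suc, of ?Z "\<lambda>z. (\<lambda>y. dir_deriv UNIV (fst z) y b', snd z)"]
        by (auto simp: smooth_dir_deriv)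
      then show "dominated ?Z (\<lambda>z. jet_norm j (\<lambda>y. dir_deriv UNIV (fst z) (G y) b') (snd z)) ?g"
        by (rule dominated_le_right) (rule jet_norm_dir_deriv_le[OF b'])
    qed (auto intro: jet_norm_nonneg simp del: jet_norm.simps)
  qed
  moreover have "dominated ?Z (\<lambda>z. \<bar>fst z (G (snd z))\<bar>) ?g" by (rule dominated_le) (rule abs_le_jet_norm)
  ultimately show ?case by (subst jet_norm.simps) (intro dominated_add dominated_sum)
qed

text \<open>Multilinearity in a form suited to list arguments. Only lists of length \<open>j\<close>
  are constrained; the values of \<open>T\<close> elsewhere carry no meaning.\<close>

definition slotwise_linear :: "nat \<Rightarrow> ('e::euclidean_space list \<Rightarrow> real) \<Rightarrow> bool" where
  "slotwise_linear j T \<longleftrightarrow> (\<forall>ws k. length ws = j \<longrightarrow> k < j \<longrightarrow> linear (\<lambda>v. T (ws[k := v])))"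

lemma slotwise_linear_hd:
  assumes "slotwise_linear (Suc j) T" "length ws = j" shows "linear (\<lambda>v. T (v # ws))"
proof -
  have "linear (\<lambda>v. T ((0 # ws)[0 := v]))"
    using assms unfolding slotwise_linear_def by (metis length_Cons zero_less_Suc)
  then show ?thesis by simp
qed

lemma slotwise_linear_tl:
  assumes "slotwise_linear (Suc j) T" shows "slotwise_linear j (\<lambda>ws. T (v # ws))"
  unfolding slotwise_linear_def
proof (intro allI impI)
  fix ws :: "'a list" and k assume "length ws = j" "k < j"
  then have "linear (\<lambda>w. T ((v # ws)[Suc k := w]))"
    using assms unfolding slotwise_linear_def by (metis length_Cons Suc_less_eq)
  then show "linear (\<lambda>w. T (v # ws[k := w]))" by simp
qed

lemma linear_sum_Basis:
  fixes L :: "'e::euclidean_space \<Rightarrow> real"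
  assumes "linear L" shows "L v = (\<Sum>b\<in>Basis. (v \<bullet> b) * L b)"
proof -
  have "L v = L (\<Sum>b\<in>Basis. (v \<bullet> b) *\<^sub>R b)" by (simp add: euclidean_representation)
  then show ?thesis by (simp add: linear_sum[OF assms] linear_cmul[OF assms])
qed

lemma slotwise_linear_scale:
  "slotwise_linear j T \<Longrightarrow> length ws = j \<Longrightarrow> T (map (\<lambda>v. e *\<^sub>R v) ws) = e ^ j * T ws"
proof (induction j arbitrary: T ws)
  case (Suc j)
  then obtain v vs where ws: "ws = v # vs" "length vs = j" by (cases ws) auto
  have "T (e *\<^sub>R v # map (\<lambda>v. e *\<^sub>R v) vs) = e ^ j * T (e *\<^sub>R v # vs)"
    by (rule Suc.IH[OF slotwise_linear_tl[OF Suc.prems(1)] ws(2)])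
  also have "T (e *\<^sub>R v # vs) = e * T (v # vs)"
    using linear_cmul[OF slotwise_linear_hd[OF Suc.prems(1) ws(2)]] by simp
  finally show ?case using ws by simp
qed simp

primrec basis_sum :: "nat \<Rightarrow> ('e::euclidean_space list \<Rightarrow> real) \<Rightarrow> real" where
  "basis_sum 0 T = \<bar>T []\<bar>"
| "basis_sum (Suc j) T = (\<Sum>b\<in>Basis. basis_sum j (\<lambda>ws. T (b # ws)))"

text \<open>Every slot is expanded over \<open>Basis\<close>; each coordinate of an entry is at most
  \<open>R\<close> in modulus, and the \<open>j\<close> factors are collected.\<close>

lemma slotwise_linear_bound:
  "slotwise_linear j T \<Longrightarrow> length ws = j \<Longrightarrow> (\<And>v. v \<in> set ws \<Longrightarrow> norm v \<le> R) \<Longrightarrow> 0 \<le> R \<Longrightarrow>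
    \<bar>T ws\<bar> \<le> R ^ j * basis_sum j T"
proof (induction j arbitrary: T ws)
  case (Suc j)
  then obtain v vs where ws: "ws = v # vs" "length vs = j" by (cases ws) auto
  have "\<bar>T ws\<bar> \<le> (\<Sum>b\<in>Basis. \<bar>(v \<bullet> b) * T (b # vs)\<bar>)"
    unfolding ws(1) linear_sum_Basis[OF slotwise_linear_hd[OF Suc.prems(1) ws(2)], of v] by (rule sum_abs)
  also have "\<dots> \<le> (\<Sum>b\<in>Basis. R * (R ^ j * basis_sum j (\<lambda>ws. T (b # ws))))"
  proof (rule sum_mono)
    fix b :: 'a assume b: "b \<in> Basis"
    have "\<bar>v \<bullet> b\<bar> \<le> R" using Basis_le_norm[OF b, of v] Suc.prems(3)[of v] ws by simp
    moreover have "\<bar>T (b # vs)\<bar> \<le> R ^ j * basis_sum j (\<lambda>ws. T (b # ws))"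
      using Suc.prems(3,4) ws by (intro Suc.IH slotwise_linear_tl[OF Suc.prems(1)]) auto
    ultimately show "\<bar>(v \<bullet> b) * T (b # vs)\<bar> \<le> R * (R ^ j * basis_sum j (\<lambda>ws. T (b # ws)))"
      unfolding abs_mult by (intro mult_mono) (auto simp: Suc.prems(4))
  qed
  finally show ?case by (simp add: sum_distrib_left mult.assoc)
qed simp

lemma dominated_basis_sum:
  "(\<And>ws. length ws = j \<Longrightarrow> dominated Z (\<lambda>z. \<bar>T z ws\<bar>) g) \<Longrightarrow> dominated Z (\<lambda>z. basis_sum j (T z)) g"
proof (induction j arbitrary: T)
  case (Suc j)
  have "dominated Z (\<lambda>z. basis_sum j (\<lambda>ws. T z (b # ws))) g" for b
    by (rule Suc.IH) (simp add: Suc.prems)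
  then show ?case by (simp add: dominated_sum)
qed simp

text \<open>The product rule for a form \<open>G y\<close> whose arguments \<open>B y w\<close> also
  move with \<open>y\<close>: one term for the form, one for each slot. Expanding the first argument
  over \<open>Basis\<close> leaves a form of rank one less with a constant first entry, which drives
  the induction.\<close>

lemma has_derivative_slotwise_linear:
  fixes G :: "'x::euclidean_space \<Rightarrow> 'e::euclidean_space list \<Rightarrow> real"
  assumes S: "open S" "x \<in> S"
    and "\<And>y. y \<in> S \<Longrightarrow> slotwise_linear j (G y)"
    and "\<And>us. length us = j \<Longrightarrow> ((\<lambda>y. G y us) has_derivative dG us) (at x)"
    and B: "\<And>w. ((\<lambda>y. B y w) has_derivative dB w) (at x)"
    and "length ws = j"
  shows "((\<lambda>y. G y (map (B y) ws)) has_derivative (\<lambda>v. dG (map (B x) ws) v +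
    (\<Sum>k<length ws. G x ((map (B x) ws)[k := dB (ws ! k) v])))) (at x)"
  using assms(3,4,6)
proof (induction j arbitrary: G dG ws)
  case 0 then show ?case by simp
next
  case (Suc j)
  then obtain w us where ws: "ws = w # us" "length us = j" by (cases ws) auto
  let ?us = "map (B x) us"
  let ?I = "\<lambda>b v. dG (b # ?us) v + (\<Sum>k<length us. G x (b # ?us[k := dB (us ! k) v]))"
  have IH: "((\<lambda>y. G y (b # map (B y) us)) has_derivative ?I b) (at x)" for b
    using Suc.prems ws by (intro Suc.IH[of "\<lambda>y us. G y (b # us)" "\<lambda>us. dG (b # us)"] slotwise_linear_tl) auto
  have ex: "G y (u # vs) = (\<Sum>b\<in>Basis. (u \<bullet> b) * G y (b # vs))" if "y \<in> S" "length vs = j" for y u vs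
    by (rule linear_sum_Basis[OF slotwise_linear_hd[OF Suc.prems(1)[OF that(1)] that(2)]])
  have "((\<lambda>y. \<Sum>b\<in>Basis. (B y w \<bullet> b) * G y (b # map (B y) us)) has_derivative
     (\<lambda>v. \<Sum>b\<in>Basis. (B x w \<bullet> b) * ?I b v + (dB w v \<bullet> b) * G x (b # ?us))) (at x)"
    by (intro has_derivative_sum has_derivative_mult[OF has_derivative_inner_left[OF B] IH])
  then have 1: "((\<lambda>y. G y (map (B y) ws)) has_derivative
     (\<lambda>v. \<Sum>b\<in>Basis. (B x w \<bullet> b) * ?I b v + (dB w v \<bullet> b) * G x (b # ?us))) (at x)"
  proof (rule has_derivative_transform_within_open[OF _ S])
    show "(\<Sum>b\<in>Basis. (B y w \<bullet> b) * G y (b # map (B y) us)) = G y (map (B y) ws)" if "y \<in> S" for y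
      using ex[OF that, of "map (B y) us" "B y w"] ws by simp
  qed
  \<comment> \<open>\<open>dG\<close> is given for each list separately; uniqueness of derivatives
    makes it linear in the first slot.\<close>
  have 2: "dG (u # vs) v = (\<Sum>b\<in>Basis. (u \<bullet> b) * dG (b # vs) v)" if "length vs = j" for u vs v
  proof -
    have "((\<lambda>y. \<Sum>b\<in>Basis. (u \<bullet> b) * G y (b # vs)) has_derivative (\<lambda>v. \<Sum>b\<in>Basis. (u \<bullet> b) * dG (b # vs) v)) (at x)"
      using Suc.prems(2) that by (intro has_derivative_sum has_derivative_mult_right) auto
    then have *: "((\<lambda>y. G y (u # vs)) has_derivative (\<lambda>v. \<Sum>b\<in>Basis. (u \<bullet> b) * dG (b # vs) v)) (at x)"
      by (rule has_derivative_transform_within_open[OF _ S]) (simp add: ex that)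
    have "((\<lambda>y. G y (u # vs)) has_derivative dG (u # vs)) (at x)" using Suc.prems(2) that by simp
    from fun_cong[OF has_derivative_unique[OF this *]] show ?thesis .
  qed
  have "(\<Sum>b\<in>Basis. (B x w \<bullet> b) * ?I b v + (dB w v \<bullet> b) * G x (b # ?us))
     = dG (map (B x) ws) v + (\<Sum>k<length ws. G x ((map (B x) ws)[k := dB (ws ! k) v]))" for v
  proof -
    have "(\<Sum>b\<in>Basis. (B x w \<bullet> b) * (\<Sum>k<length us. G x (b # ?us[k := dB (us ! k) v])))
        = (\<Sum>k<length us. G x (B x w # ?us[k := dB (us ! k) v]))"
    proof -
      have "G x (B x w # ?us[k := dB (us ! k) v]) = (\<Sum>b\<in>Basis. (B x w \<bullet> b) * G x (b # ?us[k := dB (us ! k) v]))" for k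
        by (rule ex[OF S(2)]) (simp add: ws)
      then show ?thesis by (simp add: sum_distrib_left sum.swap[of _ _ Basis])
    qed
    moreover have "(\<Sum>b\<in>Basis. (dB w v \<bullet> b) * G x (b # ?us)) = G x (dB w v # ?us)"
      by (rule ex[OF S(2), symmetric]) (simp add: ws)
    moreover have "(\<Sum>b\<in>Basis. (B x w \<bullet> b) * dG (b # ?us) v) = dG (B x w # ?us) v"
      by (rule 2[symmetric]) (simp add: ws)
    ultimately show ?thesis
      by (simp add: ws sum.distrib distrib_left sum.lessThan_Suc_shift del: sum.lessThan_Suc)
  qed
  then show ?case using 1 by simp
qed

section \<open>Covariant derivatives in charts\<close>

lemma linear_Basis_sum: "linear (\<lambda>w::'e::euclidean_space. \<Sum>b\<in>Basis. (w \<bullet> b) * (r b :: real))"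
  by (intro linear_compose_sum ballI linearI) (simp_all add: inner_add_left distrib_right)

locale metric_connection = manifold A
  for A :: "('a::{t2_space,second_countable_topology}, 'e::euclidean_space) chart set" +
  fixes g :: "('a, 'e) chart \<Rightarrow> 'a \<Rightarrow> 'e \<Rightarrow> 'e \<Rightarrow> real"
    and \<Gamma> :: "('a, 'e) chart \<Rightarrow> 'a \<Rightarrow> 'e \<Rightarrow> 'e \<Rightarrow> 'e"
  assumes riemannian_metric: "riemannian_metric UNIV A g"
    and affine_connection: "affine_connection UNIV A \<Gamma>"
begin

abbreviation SF :: "('a \<Rightarrow> real) set" where "SF \<equiv> smooth_functions UNIV A"
abbreviation D :: "nat \<Rightarrow> ('a \<Rightarrow> real) \<Rightarrow> ('a, 'e) chart \<Rightarrow> 'a \<Rightarrow> 'e list \<Rightarrow> real" where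
  "D \<equiv> iterated_covariant_derivative UNIV \<Gamma>"
abbreviation \<tau> :: "nat \<Rightarrow> ('a \<Rightarrow> real) \<Rightarrow> 'a \<Rightarrow> real" where
  "\<tau> j h \<equiv> tensor_norm UNIV A g j (D j h)"

lemma
  assumes "c \<in> A"
  shows bilinear_\<Gamma>: "p \<in> fst c \<Longrightarrow> bilinear (\<Gamma> c p)"
    and smooth_\<Gamma>: "smooth (snd c ` fst c) (\<lambda>y. \<Gamma> c (chart_inv c y) v w)"
  using affine_connection assms unfolding affine_connection_def by auto

lemma transform_\<Gamma>:
  assumes "c \<in> A" "d \<in> A" "p \<in> fst c" "p \<in> fst d"
  shows "dir_deriv UNIV (transition c d) (snd c p) (\<Gamma> c p v w) =
    dir_deriv UNIV (\<lambda>y. dir_deriv UNIV (transition c d) y w) (snd c p) v +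
    \<Gamma> d p (dir_deriv UNIV (transition c d) (snd c p) v) (dir_deriv UNIV (transition c d) (snd c p) w)"
  using affine_connection assms unfolding affine_connection_def by (simp add: Let_def)

lemma
  assumes "c \<in> A"
  shows bilinear_g: "p \<in> fst c \<Longrightarrow> bilinear (g c p)"
    and g_pos: "p \<in> fst c \<Longrightarrow> v \<noteq> 0 \<Longrightarrow> g c p v v > 0"
    and smooth_g: "smooth (snd c ` fst c) (\<lambda>y. g c (chart_inv c y) v w)"
  using riemannian_metric assms unfolding riemannian_metric_def by auto

lemma transform_g:
  assumes "c \<in> A" "d \<in> A" "p \<in> fst c" "p \<in> fst d"
  shows "g d p (dir_deriv UNIV (transition c d) (snd c p) v) (dir_deriv UNIV (transition c d) (snd c p) w) = g c p v w"
  using riemannian_metric assms unfolding riemannian_metric_def by (simp add: Let_def)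

lemma D_Suc:
  "D (Suc j) h c p (v # ws) = dir_deriv UNIV (\<lambda>y. D j h c (chart_inv c y) ws) (snd c p) v
     - (\<Sum>k<length ws. D j h c p (ws[k := \<Gamma> c p v (ws ! k)]))"
  by (simp add: covariant_derivative_def)

lemma slot_expand:
  assumes "slotwise_linear j T" "length ws = j" "k < j"
  shows "T (ws[k := v]) = (\<Sum>b\<in>Basis. (v \<bullet> b) * T (ws[k := b]))"
  using assms unfolding slotwise_linear_def by (intro linear_sum_Basis) auto

text \<open>The two halves need each other: differentiability gives linearity of the derivative
  term, and linearity lets the varying vector \<open>\<Gamma> c p v (ws ! k)\<close> be expanded
  over \<open>Basis\<close>, so that the correction terms become products of smooth
  functions.\<close>

lemma D_linear_smooth:
  assumes h: "h \<in> SF" and c: "c \<in> A"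
  shows "(\<forall>p\<in>fst c. slotwise_linear j (D j h c p)) \<and>
    (\<forall>ws. length ws = j \<longrightarrow> smooth (snd c ` fst c) (\<lambda>y. D j h c (chart_inv c y) ws))"
proof (induction j)
  case 0 then show ?case using smooth_function_chart[OF h c] by (simp add: slotwise_linear_def)
next
  case (Suc j)
  let ?S = "snd c ` fst c"
  let ?T = "\<lambda>ws y. D j h c (chart_inv c y) ws"
  have sl: "slotwise_linear j (D j h c p)" if "p \<in> fst c" for p using Suc that by blast
  have lin: "linear (\<lambda>v. D j h c p (ws[k := v]))" if "p \<in> fst c" "length ws = j" "k < j" for p ws k
    using sl[OF that(1)] that(2,3) unfolding slotwise_linear_def by blast
  have sm: "smooth ?S (?T ws)" if "length ws = j" for ws using Suc that by blast
  have df: "?T ws differentiable (at (snd c p))" if "length ws = j" "p \<in> fst c" for ws p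
    using smooth_differentiable[OF sm[OF that(1)]] that(2) by blast
  have "slotwise_linear (Suc j) (D (Suc j) h c p)" if p: "p \<in> fst c" for p
    unfolding slotwise_linear_def
  proof (intro allI impI)
    fix us :: "'e list" and k assume us: "length us = Suc j" and k: "k < Suc j"
    then obtain v ws where ws: "us = v # ws" "length ws = j" by (cases us) auto
    show "linear (\<lambda>w. D (Suc j) h c p (us[k := w]))"
    \<comment> \<open>Slot 0 is the direction of differentiation; the later slots belong to the
      tensor being differentiated.\<close>
    proof (cases k)
      case 0
      have "linear (\<lambda>v. \<Sum>k<length ws. D j h c p (ws[k := \<Gamma> c p v (ws ! k)]))"
      proof (intro linear_compose_sum ballI)
        fix i assume "i \<in> {..<length ws}"
        then have "linear (\<lambda>v. D j h c p (ws[i := v]))" using lin[OF p ws(2)] ws(2) by simp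
        moreover have "linear (\<lambda>v. \<Gamma> c p v (ws ! i))" using bilinear_\<Gamma>[OF c p] by (simp add: bilinear_def)
        ultimately show "linear (\<lambda>v. D j h c p (ws[i := \<Gamma> c p v (ws ! i)]))"
          using linear_compose[of "\<lambda>v. \<Gamma> c p v (ws ! i)" "\<lambda>v. D j h c p (ws[i := v])"] by (simp add: comp_def)
      qed
      then show ?thesis unfolding ws(1) 0 list_update.simps nat.case D_Suc
        by (intro linear_compose_sub linear_dir_deriv[OF df[OF ws(2) p]])
    next
      case (Suc i)
      then have i: "i < j" using k by simp
      have "linear (\<lambda>w. dir_deriv UNIV (?T (ws[i := w])) (snd c p) v)"
      proof -
        have eq: "dir_deriv UNIV (?T (ws[i := w])) (snd c p) v
           = (\<Sum>b\<in>Basis. (w \<bullet> b) * dir_deriv UNIV (?T (ws[i := b])) (snd c p) v)" for w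
        proof -
          have "dir_deriv UNIV (?T (ws[i := w])) (snd c p) v
            = dir_deriv UNIV (\<lambda>y. \<Sum>b\<in>Basis. (w \<bullet> b) * ?T (ws[i := b]) y) (snd c p) v"
          proof (rule fun_cong[OF dir_deriv_cong_open[OF open_im[OF c]]])
            show "?T (ws[i := w]) y = (\<Sum>b\<in>Basis. (w \<bullet> b) * ?T (ws[i := b]) y)" if "y \<in> ?S" for y
              by (rule slot_expand[OF sl[OF chart_inv_dom[OF c that]] ws(2) i])
          qed (use p in blast)
          also have "\<dots> = (\<Sum>b\<in>Basis. (w \<bullet> b) * dir_deriv UNIV (?T (ws[i := b])) (snd c p) v)"
            using ws(2) p by (intro dir_deriv_eqI has_derivative_sum has_derivative_mult_right has_derivative_dir_deriv df) auto
          finally show ?thesis .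
        qed
        show ?thesis by (subst ext[OF eq]) (rule linear_Basis_sum)
      qed
      moreover have "linear (\<lambda>w. \<Sum>l<j. D j h c p (ws[i := w, l := \<Gamma> c p v (ws[i := w] ! l)]))"
      proof (intro linear_compose_sum ballI)
        fix l assume "l \<in> {..<j}"
        then have l: "l < j" by simp
        show "linear (\<lambda>w. D j h c p (ws[i := w, l := \<Gamma> c p v (ws[i := w] ! l)]))"
        \<comment> \<open>If the Christoffel update hits the slot of \<open>w\<close>, it overwrites
          \<open>w\<close> by a vector linear in \<open>w\<close>; otherwise the two updates
          commute.\<close>
        proof (cases "l = i")
          case True
          have "linear (\<Gamma> c p v)" using bilinear_\<Gamma>[OF c p] by (simp add: bilinear_def)
          from linear_compose[OF this lin[OF p ws(2) i]] show ?thesis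
            using True i ws(2) by (simp add: comp_def)
        next
          case False
          then have "ws[i := w, l := \<Gamma> c p v (ws[i := w] ! l)] = (ws[l := \<Gamma> c p v (ws ! l)])[i := w]" for w
            by (simp add: list_update_swap)
          then show ?thesis using lin[OF p, of "ws[l := \<Gamma> c p v (ws ! l)]" i] ws(2) i by simp
        qed
      qed
      ultimately show ?thesis unfolding ws(1) Suc list_update.simps nat.case D_Suc length_list_update ws(2)
        by (rule linear_compose_sub)
    qed
  qed
  moreover have "smooth ?S (\<lambda>y. D (Suc j) h c (chart_inv c y) us)" if us: "length us = Suc j" for us
  proof -
    obtain v ws where ws: "us = v # ws" "length ws = j" using us by (cases us) auto
    have "smooth ?S (\<lambda>y. dir_deriv UNIV (?T ws) y v
        - (\<Sum>k<j. \<Sum>b\<in>Basis. (\<Gamma> c (chart_inv c y) v (ws ! k) \<bullet> b) * ?T (ws[k := b]) y))"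
      using ws(2) by (intro smooth_diff smooth_sum smooth_mult smooth_inner_left open_im[OF c] smooth_dir_deriv sm
          smooth_\<Gamma>[OF c]) auto
    then show ?thesis
    proof (rule smooth_cong[OF open_im[OF c], THEN iffD1, rotated])
      fix y assume y: "y \<in> ?S"
      have "?T (ws[k := \<Gamma> c (chart_inv c y) v (ws ! k)]) y
        = (\<Sum>b\<in>Basis. (\<Gamma> c (chart_inv c y) v (ws ! k) \<bullet> b) * ?T (ws[k := b]) y)" if "k < j" for k
        by (rule slot_expand[OF sl[OF chart_inv_dom[OF c y]] ws(2) that])
      then show "dir_deriv UNIV (?T ws) y v
          - (\<Sum>k<j. \<Sum>b\<in>Basis. (\<Gamma> c (chart_inv c y) v (ws ! k) \<bullet> b) * ?T (ws[k := b]) y)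
        = D (Suc j) h c (chart_inv c y) us"
        unfolding ws(1) D_Suc by (simp add: ws(2) chart_inv[OF c y])
    qed
  qed
  ultimately show ?case by blast
qed

lemma D_slotwise_linear: "h \<in> SF \<Longrightarrow> c \<in> A \<Longrightarrow> p \<in> fst c \<Longrightarrow> slotwise_linear j (D j h c p)"
  using D_linear_smooth by blast

lemma smooth_D:
  "h \<in> SF \<Longrightarrow> c \<in> A \<Longrightarrow> length ws = j \<Longrightarrow> smooth (snd c ` fst c) (\<lambda>y. D j h c (chart_inv c y) ws)"
  using D_linear_smooth by blast

lemma D_Suc_chart:
  assumes h: "h \<in> SF" and c: "c \<in> A" and ws: "length ws = j" and y: "y \<in> snd c ` fst c"
  shows "D (Suc j) h c (chart_inv c y) (v # ws) = dir_deriv UNIV (\<lambda>y. D j h c (chart_inv c y) ws) y v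
    - (\<Sum>k<j. \<Sum>b\<in>Basis. (\<Gamma> c (chart_inv c y) v (ws ! k) \<bullet> b) * D j h c (chart_inv c y) (ws[k := b]))"
  unfolding D_Suc chart_inv[OF c y] ws
  using slot_expand[OF D_slotwise_linear[OF h c chart_inv_dom[OF c y]] ws] by simp

lemma D_combination:
  assumes h: "h \<in> SF" and k: "k \<in> SF" and c: "c \<in> A"
  shows "p \<in> fst c \<Longrightarrow> length ws = j \<Longrightarrow>
    D j (\<lambda>x. r * h x + s * k x) c p ws = r * D j h c p ws + s * D j k c p ws"
proof (induction j arbitrary: p ws)
  case 0 then show ?case by simp
next
  case (Suc j)
  obtain v vs where ws: "ws = v # vs" "length vs = j" using Suc.prems by (cases ws) auto
  have p: "snd c p \<in> snd c ` fst c" using Suc.prems by blast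
  have "dir_deriv UNIV (\<lambda>y. D j (\<lambda>x. r * h x + s * k x) c (chart_inv c y) vs) (snd c p) v
    = dir_deriv UNIV (\<lambda>y. r * D j h c (chart_inv c y) vs + s * D j k c (chart_inv c y) vs) (snd c p) v"
    using Suc.IH[OF chart_inv_dom[OF c] ws(2)] by (intro fun_cong[OF dir_deriv_cong_open[OF open_im[OF c] p]])
  also have "\<dots> = r * dir_deriv UNIV (\<lambda>y. D j h c (chart_inv c y) vs) (snd c p) v
      + s * dir_deriv UNIV (\<lambda>y. D j k c (chart_inv c y) vs) (snd c p) v"
    by (intro dir_deriv_eqI has_derivative_add has_derivative_mult_right has_derivative_dir_deriv
        smooth_differentiable[OF _ p] smooth_D h k c ws(2))
  finally show ?case
    unfolding ws(1) D_Suc using Suc.IH[OF Suc.prems(1)] ws(2)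
    by (simp add: sum.distrib sum_distrib_left algebra_simps)
qed

text \<open>Differentiating the induction hypothesis by the product rule brings in the second
  derivatives of the transition map, one term for each slot. They are cancelled by the inhomogeneous
  part of the transformation law of \<open>\<Gamma>\<close>.\<close>

lemma D_tensorial:
  assumes h: "h \<in> SF" and c: "c \<in> A" and d: "d \<in> A"
  shows "p \<in> fst c \<Longrightarrow> p \<in> fst d \<Longrightarrow> length ws = j \<Longrightarrow>
    D j h d p (map (dir_deriv UNIV (transition c d) (snd c p)) ws) = D j h c p ws"
proof (induction j arbitrary: p ws)
  case 0 then show ?case by simp
next
  case (Suc j)
  obtain v vs where ws: "ws = v # vs" "length vs = j" using Suc.prems by (cases ws) auto
  let ?t = "transition c d"
  let ?B = "\<lambda>y. dir_deriv UNIV ?t y" and ?x = "snd c p"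
  let ?S = "snd c ` (fst c \<inter> fst d)"
  have oS: "open ?S" using open_chart_image[OF c open_Int[OF open_dom[OF c] open_dom[OF d]]] by blast
  have xS: "?x \<in> ?S" using Suc.prems by blast
  have tS: "smooth ?S ?t" by (rule smooth_transition[OF c d])
  have tx: "?t ?x = snd d p" using Suc.prems by (simp add: transition_def inv_chart[OF c])
  have S: "chart_inv c y \<in> fst c" "chart_inv c y \<in> fst d" "snd c (chart_inv c y) = y"
    "chart_inv d (?t y) = chart_inv c y" if "y \<in> ?S" for y
    using that by (auto simp: inv_chart[OF c] inv_chart[OF d] transition_def)
  let ?us = "map (?B ?x) vs"
  let ?G = "\<lambda>y us. D j h d (chart_inv d (?t y)) us"
  let ?dG = "\<lambda>us v. dir_deriv UNIV (\<lambda>y. D j h d (chart_inv d y) us) (snd d p) (?B ?x v)"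
  let ?dB = "\<lambda>w v. dir_deriv UNIV (\<lambda>y. ?B y w) ?x v"
  have pr: "((\<lambda>y. ?G y (map (?B y) vs)) has_derivative
     (\<lambda>v. ?dG ?us v + (\<Sum>k<length vs. ?G ?x (?us[k := ?dB (vs ! k) v])))) (at ?x)"
  proof (rule has_derivative_slotwise_linear[OF oS xS _ _ _ ws(2)])
    show "slotwise_linear j (?G y)" if "y \<in> ?S" for y
      unfolding S(4)[OF that] by (rule D_slotwise_linear[OF h d S(2)[OF that]])
    show "((\<lambda>y. ?G y us) has_derivative ?dG us) (at ?x)" if "length us = j" for us
    proof -
      have "(\<lambda>y. D j h d (chart_inv d y) us) differentiable (at (?t ?x))"
        unfolding tx using smooth_differentiable[OF smooth_D[OF h d that]] Suc.prems by blast
      from has_derivative_compose[OF has_derivative_dir_deriv[OF smooth_differentiable[OF tS xS]]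
          has_derivative_dir_deriv[OF this]]
      show ?thesis by (simp add: tx)
    qed
    show "((\<lambda>y. ?B y w) has_derivative ?dB w) (at ?x)" for w
      by (rule has_derivative_dir_deriv[OF smooth_differentiable[OF smooth_dir_deriv[OF tS] xS]])
  qed
  have "dir_deriv UNIV (\<lambda>y. D j h c (chart_inv c y) vs) ?x v = dir_deriv UNIV (\<lambda>y. ?G y (map (?B y) vs)) ?x v"
  proof (rule fun_cong[OF dir_deriv_cong_open[OF oS xS]])
    fix y assume y: "y \<in> ?S"
    show "D j h c (chart_inv c y) vs = ?G y (map (?B y) vs)"
      unfolding S(4)[OF y] using Suc.IH[OF S(1,2)[OF y] ws(2)] S(3)[OF y] by simp
  qed
  also have "\<dots> = ?dG ?us v + (\<Sum>k<j. D j h d p (?us[k := ?dB (vs ! k) v]))"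
    unfolding dir_deriv_eqI[OF pr] using Suc.prems ws(2) by (simp add: tx inv_chart[OF d])
  finally have 1: "dir_deriv UNIV (\<lambda>y. D j h c (chart_inv c y) vs) ?x v
    = ?dG ?us v + (\<Sum>k<j. D j h d p (?us[k := ?dB (vs ! k) v]))" .
  \<comment> \<open>Linearity in slot \<open>k\<close> splits along the transformation law: the
    first summand is the second derivative term to be cancelled, the second is the correction term
    in the chart \<open>d\<close>.\<close>
  have "D j h c p (vs[k := \<Gamma> c p v (vs ! k)])
     = D j h d p (?us[k := ?dB (vs ! k) v]) + D j h d p (?us[k := \<Gamma> d p (?B ?x v) (?B ?x (vs ! k))])"
    if k: "k < j" for k
  proof -
    have "D j h c p (vs[k := \<Gamma> c p v (vs ! k)]) = D j h d p (?us[k := ?B ?x (\<Gamma> c p v (vs ! k))])"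
      using Suc.IH[OF Suc.prems(1,2), of "vs[k := \<Gamma> c p v (vs ! k)]"] ws(2) by (simp add: map_update)
    moreover have "linear (\<lambda>u. D j h d p (?us[k := u]))"
      using D_slotwise_linear[OF h d Suc.prems(2), of j] ws(2) k unfolding slotwise_linear_def by simp
    from linear_add[OF this]
    have "D j h d p (?us[k := u + w]) = D j h d p (?us[k := u]) + D j h d p (?us[k := w])" for u w .
    ultimately show ?thesis
      unfolding transform_\<Gamma>[OF c d Suc.prems(1,2)] by (rule trans)
  qed
  then have "D (Suc j) h c p (v # vs) = ?dG ?us v
      - (\<Sum>k<j. D j h d p (?us[k := \<Gamma> d p (?B ?x v) (?B ?x (vs ! k))]))"
    unfolding D_Suc 1 by (simp add: ws(2) sum.distrib)
  also have "\<dots> = D (Suc j) h d p (?B ?x v # ?us)"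
    unfolding D_Suc by (simp add: ws(2))
  finally show ?case by (simp add: ws(1))
qed

section \<open>Tensor norms and their comparison with coordinate derivatives\<close>

definition unit_lists :: "nat \<Rightarrow> ('a, 'e) chart \<Rightarrow> 'a \<Rightarrow> 'e list set" where
  "unit_lists j c p = {vs. length vs = j \<and> (\<forall>v\<in>set vs. g c p v v \<le> 1)}"

text \<open>The derivative of the transition map sends unit lists to unit lists and preserves the
  values of the tensor. Applied in both directions, this makes the two sets of values equal, hence
  also their suprema.\<close>

lemma tensor_norm_chart:
  assumes h: "h \<in> SF" and c: "c \<in> A" "p \<in> fst c"
  shows "\<tau> j h p = (SUP vs\<in>unit_lists j c p. \<bar>D j h c p vs\<bar>)"
proof -
  have sub: "(\<lambda>vs. \<bar>D j h c p vs\<bar>) ` unit_lists j c p \<subseteq> (\<lambda>vs. \<bar>D j h d p vs\<bar>) ` unit_lists j d p"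
    if c: "c \<in> A" "p \<in> fst c" and d: "d \<in> A" "p \<in> fst d" for c d
  proof
    fix r assume "r \<in> (\<lambda>vs. \<bar>D j h c p vs\<bar>) ` unit_lists j c p"
    then obtain vs where vs: "vs \<in> unit_lists j c p" "r = \<bar>D j h c p vs\<bar>" by blast
    let ?us = "map (dir_deriv UNIV (transition c d) (snd c p)) vs"
    have "?us \<in> unit_lists j d p"
      using vs(1) transform_g[OF c(1) d(1) c(2) d(2)] by (auto simp: unit_lists_def)
    moreover have "r = \<bar>D j h d p ?us\<bar>"
      using vs D_tensorial[OF h c(1) d(1) c(2) d(2), of vs j] by (simp add: unit_lists_def)
    ultimately show "r \<in> (\<lambda>vs. \<bar>D j h d p vs\<bar>) ` unit_lists j d p" by blast
  qed
  let ?d = "chart_at A p"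
  have d: "?d \<in> A" "p \<in> fst ?d" using chart_at_in_atlas[OF smooth_manifold] by auto
  have "(\<lambda>vs. \<bar>D j h ?d p vs\<bar>) ` unit_lists j ?d p = (\<lambda>vs. \<bar>D j h c p vs\<bar>) ` unit_lists j c p"
    using sub[OF c d] sub[OF d c] by (rule equalityI[rotated])
  then show ?thesis unfolding tensor_norm_def Let_def by (simp add: unit_lists_def)
qed

text \<open>By homogeneity of degree 2 it is enough to take the extreme values of the metric on the
  compact set of points of \<open>K\<close> paired with unit vectors; positivity makes the minimum
  positive.\<close>

lemma metric_bounds:
  assumes c: "c \<in> A" and K: "compact K" "K \<subseteq> snd c ` fst c"
  obtains m M where "0 < m" "0 < M" "\<And>x v. x \<in> K \<Longrightarrow> m * (norm v)\<^sup>2 \<le> g c (chart_inv c x) v v"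
    "\<And>x v. x \<in> K \<Longrightarrow> g c (chart_inv c x) v v \<le> M * (norm v)\<^sup>2"
proof (cases "K = {}")
  case True then show ?thesis using that[of 1 1] by simp
next
  case False
  let ?g = "\<lambda>x v. g c (chart_inv c x) v v"
  have dom: "chart_inv c x \<in> fst c" if "x \<in> K" for x using chart_inv_dom[OF c] K(2) that by blast
  \<comment> \<open>Smoothness of \<open>g\<close> is known for fixed arguments only; the expansion
    over \<open>Basis\<close> gives joint continuity in point and vector.\<close>
  have ex: "?g x v = (\<Sum>a\<in>Basis. \<Sum>b\<in>Basis. (v \<bullet> a) * (v \<bullet> b) * g c (chart_inv c x) a b)" if "x \<in> K" for x v
  proof -
    note bl = bilinear_g[OF c dom[OF that]]
    have "?g x v = (\<Sum>a\<in>Basis. (v \<bullet> a) * g c (chart_inv c x) a v)"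
      using bl by (intro linear_sum_Basis[of "\<lambda>w. g c (chart_inv c x) w v"]) (simp add: bilinear_def)
    moreover have "g c (chart_inv c x) a v = (\<Sum>b\<in>Basis. (v \<bullet> b) * g c (chart_inv c x) a b)" for a
      using bl by (intro linear_sum_Basis) (simp add: bilinear_def)
    ultimately show ?thesis by (simp add: sum_distrib_left mult.assoc)
  qed
  have "continuous_on (K \<times> sphere 0 1)
      (\<lambda>z. \<Sum>a\<in>Basis. \<Sum>b\<in>Basis. (snd z \<bullet> a) * (snd z \<bullet> b) * g c (chart_inv c (fst z)) a b)"
  proof (intro continuous_on_sum continuous_on_mult)
    fix a b :: 'e
    have "continuous_on K (\<lambda>x. g c (chart_inv c x) a b)"
      by (rule continuous_on_subset[OF smooth_continuous[OF smooth_g[OF c]] K(2)])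
    then show "continuous_on (K \<times> sphere 0 1) (\<lambda>z :: 'e \<times> 'e. g c (chart_inv c (fst z)) a b)"
      by (rule continuous_on_compose2) (auto intro!: continuous_intros)
  qed (intro continuous_intros)+
  then have cont: "continuous_on (K \<times> sphere 0 1) (\<lambda>z. ?g (fst z) (snd z))"
    by (rule continuous_on_eq) (rule ex[symmetric], auto)
  have ne: "K \<times> sphere (0::'e) 1 \<noteq> {}" and cpt: "compact (K \<times> sphere (0::'e) 1)"
    using False K(1) by (auto intro: compact_Times)
  obtain z where z: "z \<in> K \<times> sphere 0 1" "\<forall>w\<in>K \<times> sphere 0 1. ?g (fst z) (snd z) \<le> ?g (fst w) (snd w)"
    using continuous_attains_inf[OF cpt ne cont] by blast
  obtain y where y: "y \<in> K \<times> sphere 0 1" "\<forall>w\<in>K \<times> sphere 0 1. ?g (fst w) (snd w) \<le> ?g (fst y) (snd y)"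
    using continuous_attains_sup[OF cpt ne cont] by blast
  let ?m = "?g (fst z) (snd z)" and ?M = "?g (fst y) (snd y)"
  have pos: "?g x v > 0" if "x \<in> K" "v \<noteq> 0" for x v using g_pos[OF c dom[OF that(1)] that(2)] .
  have scale: "?g x v = (norm v)\<^sup>2 * ?g x (v /\<^sub>R norm v)" if "x \<in> K" "v \<noteq> 0" for x v
  proof -
    have "?g x (v /\<^sub>R norm v) = inverse (norm v) * (inverse (norm v) * ?g x v)"
      using bilinear_lmul[OF bilinear_g[OF c dom[OF that(1)]]] bilinear_rmul[OF bilinear_g[OF c dom[OF that(1)]]] by simp
    then show ?thesis using that(2) by (simp add: power2_eq_square field_simps)
  qed
  have mM: "?m * (norm v)\<^sup>2 \<le> ?g x v \<and> ?g x v \<le> ?M * (norm v)\<^sup>2" if "x \<in> K" for x v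
  proof (cases "v = 0")
    case True
    then show ?thesis using bilinear_lzero[OF bilinear_g[OF c dom[OF that]]] by simp
  next
    case False
    have "(x, v /\<^sub>R norm v) \<in> K \<times> sphere 0 1" using that False by simp
    then have "?m \<le> ?g x (v /\<^sub>R norm v)" "?g x (v /\<^sub>R norm v) \<le> ?M" using z(2) y(2) by fastforce+
    then show ?thesis unfolding scale[OF that False] by (simp add: mult.commute mult_left_mono)
  qed
  show ?thesis
  proof (rule that[of ?m ?M])
    show "?m > 0" "?M > 0" using z(1) y(1) by (auto intro!: pos)
  qed (use mM in auto)
qed

lemma zero_list_in_unit_lists:
  "c \<in> A \<Longrightarrow> p \<in> fst c \<Longrightarrow> replicate j 0 \<in> unit_lists j c p"
  using bilinear_lzero[OF bilinear_g] by (auto simp: unit_lists_def)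

lemma unit_lists_bound:
  assumes h: "h \<in> SF" and c: "c \<in> A" "p \<in> fst c" and m: "0 < m" "\<And>v. m * (norm v)\<^sup>2 \<le> g c p v v"
    and vs: "vs \<in> unit_lists j c p"
  shows "\<bar>D j h c p vs\<bar> \<le> (1 / sqrt m) ^ j * basis_sum j (D j h c p)"
proof (rule slotwise_linear_bound[OF D_slotwise_linear[OF h c]])
  show "length vs = j" using vs by (simp add: unit_lists_def)
  show "0 \<le> 1 / sqrt m" using m(1) by simp
  show "norm v \<le> 1 / sqrt m" if "v \<in> set vs" for v
  proof -
    have "m * (norm v)\<^sup>2 \<le> 1" using m(2)[of v] vs that by (force simp: unit_lists_def)
    then have "sqrt (m * (norm v)\<^sup>2) \<le> 1" by simp
    then show ?thesis using m(1) by (simp add: real_sqrt_mult field_simps)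
  qed
qed

text \<open>Suprema of reals are meaningful for bounded sets only. The metric at one point is the
  case of a one-point compact set in \<open>metric_bounds\<close>.\<close>

lemma bdd_above_D:
  assumes h: "h \<in> SF" and c: "c \<in> A" "p \<in> fst c"
  shows "bdd_above ((\<lambda>vs. \<bar>D j h c p vs\<bar>) ` unit_lists j c p)"
proof -
  have sub: "{snd c p} \<subseteq> snd c ` fst c" and cpt: "compact {snd c p}" using c(2) by auto
  obtain m M where m: "0 < m" "0 < M"
    "\<And>x v. x \<in> {snd c p} \<Longrightarrow> m * (norm v)\<^sup>2 \<le> g c (chart_inv c x) v v"
    "\<And>x v. x \<in> {snd c p} \<Longrightarrow> g c (chart_inv c x) v v \<le> M * (norm v)\<^sup>2"
    by (rule metric_bounds[OF c(1) cpt sub], rule that)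
  have "m * (norm v)\<^sup>2 \<le> g c p v v" for v using m(3)[of "snd c p" v] inv_chart[OF c] by simp
  then show ?thesis by (intro bdd_aboveI2[OF unit_lists_bound[OF h c m(1)]])
qed

lemma D_le_tensor_norm:
  assumes h: "h \<in> SF" and c: "c \<in> A" "p \<in> fst c" and "vs \<in> unit_lists j c p"
  shows "\<bar>D j h c p vs\<bar> \<le> \<tau> j h p"
  unfolding tensor_norm_chart[OF h c] by (rule cSUP_upper[OF assms(4) bdd_above_D[OF h c]])

lemma tensor_norm_least:
  assumes h: "h \<in> SF" and c: "c \<in> A" "p \<in> fst c" and "\<And>vs. vs \<in> unit_lists j c p \<Longrightarrow> \<bar>D j h c p vs\<bar> \<le> B"
  shows "\<tau> j h p \<le> B"
  unfolding tensor_norm_chart[OF h c] using assms(4) zero_list_in_unit_lists[OF c]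
  by (intro cSUP_least) auto

lemma tensor_norm_nonneg: "h \<in> SF \<Longrightarrow> 0 \<le> \<tau> j h p"
proof -
  assume h: "h \<in> SF"
  obtain c where c: "c \<in> A" "p \<in> fst c" using ex_chart by blast
  show ?thesis using D_le_tensor_norm[OF h c zero_list_in_unit_lists[OF c]] by (meson abs_ge_zero order_trans)
qed

lemma tensor_norm_combination:
  assumes h: "h \<in> SF" and k: "k \<in> SF"
  shows "\<tau> j (\<lambda>x. r * h x + s * k x) p \<le> \<bar>r\<bar> * \<tau> j h p + \<bar>s\<bar> * \<tau> j k p"
proof -
  obtain c where c: "c \<in> A" "p \<in> fst c" using ex_chart by blast
  show ?thesis
  proof (rule tensor_norm_least[OF smooth_functions_combination[OF h k] c])
    fix vs assume vs: "vs \<in> unit_lists j c p"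
    have "\<bar>D j (\<lambda>x. r * h x + s * k x) c p vs\<bar> \<le> \<bar>r\<bar> * \<bar>D j h c p vs\<bar> + \<bar>s\<bar> * \<bar>D j k c p vs\<bar>"
      using D_combination[OF h k c, of vs j r s] vs abs_triangle_ineq[of "r * D j h c p vs" "s * D j k c p vs"]
      by (simp add: unit_lists_def abs_mult)
    also have "\<dots> \<le> \<bar>r\<bar> * \<tau> j h p + \<bar>s\<bar> * \<tau> j k p"
      by (intro add_mono mult_left_mono D_le_tensor_norm h k c vs) auto
    finally show "\<bar>D j (\<lambda>x. r * h x + s * k x) c p vs\<bar> \<le> \<bar>r\<bar> * \<tau> j h p + \<bar>s\<bar> * \<tau> j k p" .
  qed
qed

text \<open>The recursion for \<open>D (Suc j)\<close> consists of one directional derivative and of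
  terms of order zero in \<open>D j\<close> with smooth coefficients. The derivative costs one more
  order of jets of \<open>D j\<close>, which is why \<open>m\<close> varies in the induction on
  \<open>j\<close> and only \<open>m + j\<close> counts.\<close>

lemma dominated_D_jet_norm:
  assumes c: "c \<in> A" and K: "compact K" "K \<subseteq> snd c ` fst c"
  shows "length ws = j \<Longrightarrow> dominated (SF \<times> K)
    (\<lambda>z. jet_norm m (\<lambda>y. D j (fst z) c (chart_inv c y) ws) (snd z))
    (\<lambda>z. jet_norm (m + j) (\<lambda>y. fst z (chart_inv c y)) (snd z))"
proof (induction j arbitrary: ws m)
  case 0 then show ?case by (simp add: dominated_le)
next
  case (Suc j)
  obtain v vs where ws: "ws = v # vs" "length vs = j" using Suc.prems by (cases ws) auto
  let ?S = "snd c ` fst c" and ?Z = "SF \<times> K"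
  let ?T = "\<lambda>z ws y. D j (fst z) c (chart_inv c y) ws"
  let ?g = "\<lambda>z. jet_norm (m + Suc j) (\<lambda>y. fst z (chart_inv c y)) (snd z)"
  let ?F = "\<lambda>z y. \<Sum>b\<in>Basis. (v \<bullet> b) * dir_deriv UNIV (?T z vs) y b"
  let ?G = "\<lambda>k z y. \<Sum>b\<in>Basis. (- (\<Gamma> c (chart_inv c y) v (vs ! k) \<bullet> b)) * ?T z (vs[k := b]) y"
  have o: "open ?S" by (rule open_im[OF c])
  have sF: "smooth ?S (?F z)" if "z \<in> ?Z" for z
    using that ws(2) c by (intro smooth_sum smooth_mult o smooth_const smooth_dir_deriv smooth_D) auto
  have s\<Gamma>: "smooth ?S (\<lambda>y. - (\<Gamma> c (chart_inv c y) v w \<bullet> b))" for w b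
  proof -
    have "smooth ?S (\<lambda>y. 0 - (\<Gamma> c (chart_inv c y) v w \<bullet> b))"
      by (intro smooth_diff o smooth_const smooth_inner_left smooth_\<Gamma>[OF c])
    then show ?thesis by simp
  qed
  have sG: "smooth ?S (?G k z)" if "z \<in> ?Z" for z k
    using that ws(2) c by (intro smooth_sum smooth_mult o s\<Gamma> smooth_D) auto
  have "dominated ?Z (\<lambda>z. jet_norm m (?F z) (snd z)) ?g"
  proof (rule dominated_jet_norm_combination[OF o K])
    fix b :: 'e assume b: "b \<in> Basis"
    have "dominated ?Z (\<lambda>z. jet_norm (Suc m) (?T z vs) (snd z)) ?g" using Suc.IH[OF ws(2), of "Suc m"] by simp
    then show "dominated ?Z (\<lambda>z. jet_norm m (\<lambda>y. dir_deriv UNIV (?T z vs) y b) (snd z)) ?g"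
      by (rule dominated_le_left[OF jet_norm_dir_deriv_le[OF b]])
    show "smooth ?S (\<lambda>y. dir_deriv UNIV (?T z vs) y b)" if "z \<in> ?Z" for z
      using that ws(2) c by (intro smooth_dir_deriv smooth_D) auto
  qed (auto intro: jet_norm_nonneg smooth_const simp del: jet_norm.simps)
  moreover have "dominated ?Z (\<lambda>z. jet_norm m (?G k z) (snd z)) ?g" for k
  proof (rule dominated_jet_norm_combination[OF o K s\<Gamma>])
    fix b :: 'e assume b: "b \<in> Basis"
    have "dominated ?Z (\<lambda>z. jet_norm m (?T z (vs[k := b])) (snd z)) (\<lambda>z. jet_norm (m + j) (\<lambda>y. fst z (chart_inv c y)) (snd z))"
      by (rule Suc.IH) (simp add: ws(2))
    then show "dominated ?Z (\<lambda>z. jet_norm m (?T z (vs[k := b])) (snd z)) ?g"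
      by (rule dominated_le_right) (use jet_norm_Suc_mono in simp)
    show "smooth ?S (?T z (vs[k := b]))" if "z \<in> ?Z" for z
      using that ws(2) c by (intro smooth_D) auto
  qed (auto intro: jet_norm_nonneg simp del: jet_norm.simps)
  ultimately have "dominated ?Z (\<lambda>z. jet_norm m (?F z) (snd z) + (\<Sum>k<j. jet_norm m (?G k z) (snd z))) ?g"
    by (intro dominated_add dominated_sum)
  then show ?case
  proof (rule dominated_le_left[rotated])
    fix z assume z: "z \<in> ?Z"
    have zS: "snd z \<in> ?S" using z K by auto
    have "jet_norm m (\<lambda>y. D (Suc j) (fst z) c (chart_inv c y) ws) (snd z) = jet_norm m (\<lambda>y. ?F z y + (\<Sum>k<j. ?G k z y)) (snd z)"
    proof (rule jet_norm_cong[OF o zS])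
      fix y assume y: "y \<in> ?S"
      have "?F z y = dir_deriv UNIV (?T z vs) y v"
        unfolding real_scaleR_def[symmetric] using z ws(2) c y
        by (intro dir_deriv_sum_Basis[symmetric] smooth_differentiable[of ?S] smooth_D) auto
      then show "D (Suc j) (fst z) c (chart_inv c y) ws = ?F z y + (\<Sum>k<j. ?G k z y)"
        unfolding ws(1) using D_Suc_chart[OF _ c ws(2) y, of "fst z" v] z by (auto simp: sum_negf)
    qed
    also have "\<dots> \<le> jet_norm m (?F z) (snd z) + jet_norm m (\<lambda>y. \<Sum>k<j. ?G k z y) (snd z)"
      by (rule jet_norm_add[OF o zS sF[OF z] smooth_sum[OF o sG[OF z]]])
    also have "jet_norm m (\<lambda>y. \<Sum>k<j. ?G k z y) (snd z) \<le> (\<Sum>k<j. jet_norm m (?G k z) (snd z))"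
      by (rule jet_norm_sum[OF o zS sG[OF z]])
    finally show "jet_norm m (\<lambda>y. D (Suc j) (fst z) c (chart_inv c y) ws) (snd z)
      \<le> jet_norm m (?F z) (snd z) + (\<Sum>k<j. jet_norm m (?G k z) (snd z))" by simp
  qed
qed

lemma dominated_tensor_norm_jet_norm:
  assumes c: "c \<in> A" and K: "compact K" "K \<subseteq> snd c ` fst c"
  shows "dominated (SF \<times> K) (\<lambda>z. \<tau> j (fst z) (chart_inv c (snd z)))
    (\<lambda>z. jet_norm j (\<lambda>y. fst z (chart_inv c y)) (snd z))"
proof -
  obtain m M where m: "0 < m" "\<And>x v. x \<in> K \<Longrightarrow> m * (norm v)\<^sup>2 \<le> g c (chart_inv c x) v v"
    and M: "0 < M" "\<And>x v. x \<in> K \<Longrightarrow> g c (chart_inv c x) v v \<le> M * (norm v)\<^sup>2"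
    by (rule metric_bounds[OF c K], rule that)
  have "dominated (SF \<times> K) (\<lambda>z. basis_sum j (D j (fst z) c (chart_inv c (snd z))))
      (\<lambda>z. jet_norm j (\<lambda>y. fst z (chart_inv c y)) (snd z))"
    using dominated_D_jet_norm[OF c K, of _ j 0] by (intro dominated_basis_sum) simp
  then have "dominated (SF \<times> K) (\<lambda>z. (1 / sqrt m) ^ j * basis_sum j (D j (fst z) c (chart_inv c (snd z))))
      (\<lambda>z. jet_norm j (\<lambda>y. fst z (chart_inv c y)) (snd z))"
    by (rule dominated_mult_bounded[where B = "(1 / sqrt m) ^ j", rotated]) (use m(1) jet_norm_nonneg in auto)
  then show ?thesis
  proof (rule dominated_le_left[rotated])
    fix z assume z: "z \<in> SF \<times> K"
    then have p: "chart_inv c (snd z) \<in> fst c" using chart_inv_dom[OF c] K(2) by auto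
    show "\<tau> j (fst z) (chart_inv c (snd z)) \<le> (1 / sqrt m) ^ j * basis_sum j (D j (fst z) c (chart_inv c (snd z)))"
      using z m by (intro tensor_norm_least[OF _ c p] unit_lists_bound[OF _ c p]) auto
  qed
qed

text \<open>Evaluation on fixed vectors is recovered from unit lists by scaling: the entries of
  \<open>ws\<close> times a small \<open>e\<close> have length at most 1 on all of \<open>K\<close>,
  and multilinearity turns this into the factor \<open>1 / e ^ j\<close>.\<close>

lemma dominated_D_tensor_norm:
  assumes c: "c \<in> A" and K: "compact K" "K \<subseteq> snd c ` fst c" and ws: "length ws = j"
  shows "dominated (SF \<times> K) (\<lambda>z. \<bar>D j (fst z) c (chart_inv c (snd z)) ws\<bar>) (\<lambda>z. \<tau> j (fst z) (chart_inv c (snd z)))"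
proof -
  obtain m M where m: "0 < m" "\<And>x v. x \<in> K \<Longrightarrow> m * (norm v)\<^sup>2 \<le> g c (chart_inv c x) v v"
    and M: "0 < M" "\<And>x v. x \<in> K \<Longrightarrow> g c (chart_inv c x) v v \<le> M * (norm v)\<^sup>2"
    by (rule metric_bounds[OF c K], rule that)
  \<comment> \<open>The summand 1 keeps \<open>R\<close> positive when the entries of
    \<open>ws\<close> vanish or \<open>ws\<close> is empty; \<open>e\<close> below is the positive
    solution of \<open>M * (e * R)^2 = 1\<close>.\<close>
  define R where "R = 1 + (\<Sum>v\<in>set ws. norm v)"
  have "0 \<le> (\<Sum>v\<in>set ws. norm v)" by (rule sum_nonneg) simp
  then have R0: "R > 0" unfolding R_def by linarith
  have R: "norm v \<le> R" if "v \<in> set ws" for v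
  proof -
    have "norm v \<le> (\<Sum>v\<in>set ws. norm v)" by (rule member_le_sum[OF that norm_ge_zero finite_set])
    then show ?thesis unfolding R_def by linarith
  qed
  define e where "e = 1 / (sqrt M * R)"
  have e: "e > 0" unfolding e_def using M(1) R0 by simp
  have "\<bar>D j (fst z) c (chart_inv c (snd z)) ws\<bar> \<le> (1 / e ^ j) * \<tau> j (fst z) (chart_inv c (snd z))"
    if z: "z \<in> SF \<times> K" for z
  proof -
    have p: "chart_inv c (snd z) \<in> fst c" using chart_inv_dom[OF c] K(2) z by auto
    have "g c (chart_inv c (snd z)) (e *\<^sub>R v) (e *\<^sub>R v) \<le> 1" if v: "v \<in> set ws" for v
    proof -
      have "g c (chart_inv c (snd z)) (e *\<^sub>R v) (e *\<^sub>R v) \<le> M * (e * norm v)\<^sup>2"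
        using M(2)[of "snd z" "e *\<^sub>R v"] z e by auto
      also have "\<dots> \<le> M * (e * R)\<^sup>2"
        using M(1) e R[OF v] by (intro mult_left_mono power_mono) auto
      also have "\<dots> = 1" using M(1) R0 by (simp add: e_def power_divide)
      finally show ?thesis .
    qed
    then have "map (\<lambda>v. e *\<^sub>R v) ws \<in> unit_lists j c (chart_inv c (snd z))"
      using ws by (auto simp: unit_lists_def)
    then have "\<bar>e ^ j * D j (fst z) c (chart_inv c (snd z)) ws\<bar> \<le> \<tau> j (fst z) (chart_inv c (snd z))"
      using D_le_tensor_norm[OF _ c p, of "fst z" "map (\<lambda>v. e *\<^sub>R v) ws" j] z
        slotwise_linear_scale[OF D_slotwise_linear[OF _ c p] ws] by auto
    then show ?thesis using e by (simp add: abs_mult field_simps)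
  qed
  then show ?thesis unfolding dominated_def using e by (intro exI[of _ "1 / e ^ j"]) auto
qed

text \<open>The recursion read backwards: a partial derivative of \<open>D j\<close> in direction
  \<open>b\<close> is \<open>D (Suc j)\<close> with first entry \<open>b\<close> plus Christoffel
  terms in \<open>D j\<close>. One order of differentiation is traded for one rank, so the induction
  is on \<open>m\<close> for all \<open>j\<close>, with \<open>j + m\<close> as the common
  bound.\<close>

lemma dominated_jet_norm_D_tensor_norm:
  assumes c: "c \<in> A" and K: "compact K" "K \<subseteq> snd c ` fst c"
  shows "length ws = j \<Longrightarrow> dominated (SF \<times> K)
    (\<lambda>z. jet_norm m (\<lambda>y. D j (fst z) c (chart_inv c y) ws) (snd z))
    (\<lambda>z. \<Sum>i\<le>j + m. \<tau> i (fst z) (chart_inv c (snd z)))"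
proof (induction m arbitrary: j ws)
  let ?Z = "SF \<times> K"
  let ?g = "\<lambda>n z. \<Sum>i\<le>n. \<tau> i (fst z) (chart_inv c (snd z))"
  have g: "?g n z \<le> ?g n' z" if "n \<le> n'" "z \<in> ?Z" for n n' z
    using that tensor_norm_nonneg by (intro sum_mono2) auto
  have base: "dominated ?Z (\<lambda>z. \<bar>D j (fst z) c (chart_inv c (snd z)) ws\<bar>) (?g n)"
    if "length ws = j" "j \<le> n" for j n ws
  proof (rule dominated_le_right[OF dominated_D_tensor_norm[OF c K that(1)]])
    fix z assume "z \<in> ?Z"
    then show "\<tau> j (fst z) (chart_inv c (snd z)) \<le> ?g n z"
      using tensor_norm_nonneg that(2) by (intro member_le_sum) auto
  qed
  { case 0 then show ?case using base[of ws j j] by simp }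
  { case (Suc m)
    let ?S = "snd c ` fst c"
    let ?T = "\<lambda>z ws y. D j (fst z) c (chart_inv c y) ws"
    have o: "open ?S" by (rule open_im[OF c])
    have "dominated ?Z (\<lambda>z. jet_norm m (\<lambda>y. dir_deriv UNIV (?T z ws) y b) (snd z)) (?g (j + Suc m))" if b: "b \<in> Basis" for b
    proof -
      let ?F = "\<lambda>z y. D (Suc j) (fst z) c (chart_inv c y) (b # ws)"
      let ?G = "\<lambda>k z y. \<Sum>b'\<in>Basis. (\<Gamma> c (chart_inv c y) b (ws ! k) \<bullet> b') * ?T z (ws[k := b']) y"
      have s\<Gamma>: "smooth ?S (\<lambda>y. \<Gamma> c (chart_inv c y) b w \<bullet> b')" for w b'
        by (intro smooth_inner_left o smooth_\<Gamma>[OF c])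
      have sF: "smooth ?S (?F z)" if "z \<in> ?Z" for z
        using that Suc.prems c by (intro smooth_D) auto
      have sG: "smooth ?S (?G k z)" if "z \<in> ?Z" for z k
        using that Suc.prems c by (intro smooth_sum smooth_mult o s\<Gamma> smooth_D) auto
      have "dominated ?Z (\<lambda>z. jet_norm m (?F z) (snd z)) (?g (Suc j + m))"
        by (rule Suc.IH) (simp add: Suc.prems)
      moreover have "dominated ?Z (\<lambda>z. jet_norm m (?G k z) (snd z)) (?g (Suc j + m))" for k
      proof (rule dominated_jet_norm_combination[OF o K s\<Gamma>])
        fix b' :: 'e
        have "dominated ?Z (\<lambda>z. jet_norm m (?T z (ws[k := b'])) (snd z)) (?g (j + m))"
          by (rule Suc.IH) (simp add: Suc.prems)
        then show "dominated ?Z (\<lambda>z. jet_norm m (?T z (ws[k := b'])) (snd z)) (?g (Suc j + m))"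
          by (rule dominated_le_right) (rule g, simp_all)
        show "smooth ?S (?T z (ws[k := b']))" if "z \<in> ?Z" for z
          using that Suc.prems c by (intro smooth_D) auto
        show "0 \<le> ?g (Suc j + m) z" if "z \<in> ?Z" for z
          by (intro sum_nonneg tensor_norm_nonneg) (use that in auto)
      qed auto
      ultimately have "dominated ?Z (\<lambda>z. jet_norm m (?F z) (snd z) + (\<Sum>k<j. jet_norm m (?G k z) (snd z))) (?g (Suc j + m))"
        by (intro dominated_add dominated_sum)
      then have "dominated ?Z (\<lambda>z. jet_norm m (?F z) (snd z) + (\<Sum>k<j. jet_norm m (?G k z) (snd z))) (?g (j + Suc m))"
        by simp
      then show ?thesis
      proof (rule dominated_le_left[rotated])
        fix z assume z: "z \<in> ?Z"
        have zS: "snd z \<in> ?S" using z K by auto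
        have "jet_norm m (\<lambda>y. dir_deriv UNIV (?T z ws) y b) (snd z) = jet_norm m (\<lambda>y. ?F z y + (\<Sum>k<j. ?G k z y)) (snd z)"
        proof (rule jet_norm_cong[OF o zS])
          show "dir_deriv UNIV (?T z ws) y b = ?F z y + (\<Sum>k<j. ?G k z y)" if "y \<in> ?S" for y
            using D_Suc_chart[OF _ c Suc.prems that, of "fst z" b] z by auto
        qed
        also have "\<dots> \<le> jet_norm m (?F z) (snd z) + jet_norm m (\<lambda>y. \<Sum>k<j. ?G k z y) (snd z)"
          by (rule jet_norm_add[OF o zS sF[OF z] smooth_sum[OF o sG[OF z]]])
        also have "jet_norm m (\<lambda>y. \<Sum>k<j. ?G k z y) (snd z) \<le> (\<Sum>k<j. jet_norm m (?G k z) (snd z))"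
          by (rule jet_norm_sum[OF o zS sG[OF z]])
        finally show "jet_norm m (\<lambda>y. dir_deriv UNIV (?T z ws) y b) (snd z)
          \<le> jet_norm m (?F z) (snd z) + (\<Sum>k<j. jet_norm m (?G k z) (snd z))" by simp
      qed
    qed
    then show ?case unfolding jet_norm.simps
      by (intro dominated_add dominated_sum base[OF Suc.prems]) auto }
qed

lemma dominated_jet_norm_tensor_norm:
  assumes c: "c \<in> A" and K: "compact K" "K \<subseteq> snd c ` fst c"
  shows "dominated (SF \<times> K) (\<lambda>z. jet_norm m (\<lambda>y. fst z (chart_inv c y)) (snd z))
    (\<lambda>z. \<Sum>i\<le>m. \<tau> i (fst z) (chart_inv c (snd z)))"
  using dominated_jet_norm_D_tensor_norm[OF c K, of "[]" 0 m] by simp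

end

section \<open>The Koopman operator\<close>

text \<open>A finite subcover is chosen; the sum of its local constants works everywhere because
  \<open>g\<close> is nonnegative.\<close>

lemma dominated_compact:
  fixes f g :: "'z \<times> 'a::topological_space \<Rightarrow> real"
  assumes "compact Q" and loc: "\<And>p. p \<in> Q \<Longrightarrow> \<exists>W. open W \<and> p \<in> W \<and> dominated (Z \<times> W) f g"
    and g: "\<And>z. z \<in> Z \<times> UNIV \<Longrightarrow> 0 \<le> g z"
  shows "dominated (Z \<times> Q) f g"
proof -
  have "\<forall>p\<in>Q. \<exists>W C. open W \<and> p \<in> W \<and> C \<ge> 0 \<and> (\<forall>z\<in>Z \<times> W. f z \<le> C * g z)"
    using loc unfolding dominated_def by blast
  from bchoice[OF this] obtain W where "\<forall>p\<in>Q. \<exists>C. open (W p) \<and> p \<in> W p \<and> C \<ge> 0 \<and> (\<forall>z\<in>Z \<times> W p. f z \<le> C * g z)"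
    by blast
  from bchoice[OF this] obtain C
    where WC: "\<forall>p\<in>Q. open (W p) \<and> p \<in> W p \<and> C p \<ge> 0 \<and> (\<forall>z\<in>Z \<times> W p. f z \<le> C p * g z)"
    by blast
  obtain P where P: "P \<subseteq> Q" "finite P" "Q \<subseteq> (\<Union>p\<in>P. W p)"
    by (rule compactE_image[OF assms(1), of Q W]) (use WC in auto)
  have "f z \<le> (\<Sum>p\<in>P. C p) * g z" if z: "z \<in> Z \<times> Q" for z
  proof -
    obtain p where p: "p \<in> P" "snd z \<in> W p" using P(3) z by auto
    have "z \<in> Z \<times> W p" using z p(2) by (auto simp: mem_Times_iff)
    then have "f z \<le> C p * g z" using WC P(1) p(1) by blast
    also have "\<dots> \<le> (\<Sum>p\<in>P. C p) * g z"
      using WC P p(1) z g[of z] by (intro mult_right_mono member_le_sum) (auto simp: mem_Times_iff)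
    finally show ?thesis .
  qed
  moreover have "0 \<le> (\<Sum>p\<in>P. C p)" using WC P(1) by (intro sum_nonneg) auto
  ultimately show ?thesis unfolding dominated_def by blast
qed

text \<open>Convergence may be tested on a subbasis, because finite intersections and unions
  preserve the property that containing the limit forces containing the values eventually. The
  \<open>C\<^sup>\<infinity>\<close>-topology is given by such a subbasis, the seminorm
  balls.\<close>

lemma limitin_generated:
  assumes l: "l \<in> \<Union>\<S>" and ev: "\<And>S. S \<in> \<S> \<Longrightarrow> l \<in> S \<Longrightarrow> eventually (\<lambda>x. f x \<in> S) F"
  shows "limitin (topology_generated_by \<S>) f l F"
  unfolding limitin_def
proof (intro conjI allI impI)
  show "l \<in> topspace (topology_generated_by \<S>)" using l by simp
  fix U assume "openin (topology_generated_by \<S>) U \<and> l \<in> U"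
  then have "generate_topology_on \<S> U" "l \<in> U" by (auto dest: openin_topology_generated_by)
  then show "eventually (\<lambda>x. f x \<in> U) F"
  proof (induction rule: generate_topology_on.induct)
    case (Int a b) then show ?case by (auto simp: eventually_conj_iff)
  next
    case (UN K)
    then obtain k where k: "k \<in> K" "l \<in> k" by blast
    show ?case by (rule eventually_mono[OF UN.IH[OF k]]) (use k(1) in blast)
  qed (auto intro: ev)
qed

locale koopman_system = complete_field A f + metric_connection A g \<Gamma>
  for A :: "('a::{t2_space,second_countable_topology}, 'e::euclidean_space) chart set"
    and f :: "('a, 'e) chart \<Rightarrow> 'a \<Rightarrow> 'e"
    and g :: "('a, 'e) chart \<Rightarrow> 'a \<Rightarrow> 'e \<Rightarrow> 'e \<Rightarrow> real"
    and \<Gamma> :: "('a, 'e) chart \<Rightarrow> 'a \<Rightarrow> 'e \<Rightarrow> 'e \<Rightarrow> 'e" +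
  fixes V :: "nat \<Rightarrow> 'a set"
  assumes exhaustion: "exhaustion V"
begin

abbreviation seminorm :: "nat \<Rightarrow> nat \<Rightarrow> ('a \<Rightarrow> real) \<Rightarrow> real" where
  "seminorm \<equiv> Cinf_seminorm UNIV A g \<Gamma> V"
abbreviation L :: "('a \<Rightarrow> real) \<Rightarrow> 'a \<Rightarrow> real" where "L \<equiv> lie_derivative UNIV A f"
abbreviation Xinf :: "('a \<Rightarrow> real) topology" where "Xinf \<equiv> Cinf_topology UNIV A g \<Gamma> V"

lemma compact_V: "compact (closure (V i))"
  using exhaustion by (simp add: exhaustion_def)

lemma compact_subset_V:
  assumes "compact Q" obtains i where "Q \<subseteq> V i"
proof -
  have "Q \<subseteq> (\<Union>i\<in>UNIV. V i)" using exhaustion by (auto simp: exhaustion_def)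
  then obtain I where I: "finite I" "Q \<subseteq> (\<Union>i\<in>I. V i)"
    by (rule compactE_image[OF assms, rotated]) (use exhaustion in \<open>auto simp: exhaustion_def\<close>)
  have "V i \<subseteq> V (Suc i)" for i using exhaustion closure_subset[of "V i"] unfolding exhaustion_def by blast
  then have "V i \<subseteq> V j" if "i \<le> j" for i j using that by (rule lift_Suc_mono_le)
  then have "V i \<subseteq> V (Max I)" if "i \<in> I" for i using I(1) that by simp
  then have "Q \<subseteq> V (Max I)" using I(2) by blast
  then show ?thesis using that by blast
qed

text \<open>Links the two sides of local estimates: compact coordinate balls, where constants exist,
  and neighbourhoods in the manifold, by which compact sets are covered.\<close>

lemma chart_cball:
  assumes c: "c \<in> A" and W: "open W" "p \<in> W" "W \<subseteq> fst c"
  obtains r N where "r > 0" "cball (snd c p) r \<subseteq> snd c ` W" "open N" "p \<in> N" "N \<subseteq> W"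
    "\<And>q. q \<in> N \<Longrightarrow> snd c q \<in> cball (snd c p) r \<and> chart_inv c (snd c q) = q"
proof -
  have "open (snd c ` W)" by (rule open_chart_image[OF c W(1,3)])
  then obtain r where r: "r > 0" "cball (snd c p) r \<subseteq> snd c ` W"
    using W(2) unfolding open_contains_cball by blast
  show ?thesis
  proof (rule that[OF r, of "W \<inter> (fst c \<inter> snd c -` ball (snd c p) r)"])
    show "open (W \<inter> (fst c \<inter> snd c -` ball (snd c p) r))"
      by (intro open_Int W open_chart_vimage[OF c open_ball])
  qed (use W r inv_chart[OF c] in auto)
qed

text \<open>Tensor norms are dominated by jet norms, which are continuous in a chart and so bounded
  on compact coordinate balls. Boundedness is phrased as domination by 1, so that
  \<open>dominated_compact\<close> can pass from local to global.\<close>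

lemma tensor_norm_bounded_on_compact:
  assumes h: "h \<in> SF" and Q: "compact Q"
  obtains B where "\<And>p. p \<in> Q \<Longrightarrow> \<tau> j h p \<le> B"
proof -
  have "dominated ({h} \<times> Q) (\<lambda>z. \<tau> j (fst z) (snd z)) (\<lambda>_. 1)"
  proof (rule dominated_compact[OF Q])
    fix p obtain c where c: "c \<in> A" "p \<in> fst c" using ex_chart by blast
    obtain r N where r: "r > 0" "cball (snd c p) r \<subseteq> snd c ` fst c" and N: "open N" "p \<in> N" "N \<subseteq> fst c"
      and q: "\<And>q. q \<in> N \<Longrightarrow> snd c q \<in> cball (snd c p) r \<and> chart_inv c (snd c q) = q"
      by (rule chart_cball[OF c(1) open_dom[OF c(1)] c(2) subset_refl], rule that)
    obtain B where B: "0 \<le> B" "\<And>x. x \<in> cball (snd c p) r \<Longrightarrow> jet_norm j (\<lambda>y. h (chart_inv c y)) x \<le> B"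
      by (rule jet_norm_bounded_on_compact[OF smooth_function_chart[OF h c(1)] compact_cball r(2)], rule that)
    have "dominated ({h} \<times> N) (\<lambda>z. \<tau> j (fst (fst z, snd c (snd z))) (chart_inv c (snd (fst z, snd c (snd z)))))
      (\<lambda>z. jet_norm j (\<lambda>y. fst (fst z, snd c (snd z)) (chart_inv c y)) (snd (fst z, snd c (snd z))))"
      by (rule dominated_reparam[OF dominated_tensor_norm_jet_norm[OF c(1) compact_cball r(2)],
            where m = "\<lambda>z. (fst z, snd c (snd z))"]) (use h q in auto)
    moreover have "dominated ({h} \<times> N) (\<lambda>z. jet_norm j (\<lambda>y. fst (fst z, snd c (snd z)) (chart_inv c y)) (snd (fst z, snd c (snd z)))) (\<lambda>_. 1)"
      unfolding dominated_def using B q by (intro exI[of _ B]) auto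
    ultimately have "dominated ({h} \<times> N) (\<lambda>z. \<tau> j (fst (fst z, snd c (snd z))) (chart_inv c (snd (fst z, snd c (snd z))))) (\<lambda>_. 1)"
      by (rule dominated_trans)
    then have "dominated ({h} \<times> N) (\<lambda>z. \<tau> j (fst z) (snd z)) (\<lambda>_. 1)"
      by (rule dominated_le_left[rotated]) (use q in auto)
    then show "\<exists>W. open W \<and> p \<in> W \<and> dominated ({h} \<times> W) (\<lambda>z. \<tau> j (fst z) (snd z)) (\<lambda>_. 1)"
      using N by blast
  qed simp
  then obtain C where "\<forall>z\<in>{h} \<times> Q. \<tau> j (fst z) (snd z) \<le> C * 1" unfolding dominated_def by blast
  then have "\<tau> j h p \<le> C" if "p \<in> Q" for p using that by auto
  then show ?thesis by (rule that)
qed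

lemma seminorm_least:
  assumes "\<And>p. p \<in> closure (V i) \<Longrightarrow> \<tau> j h p \<le> B" "0 \<le> B" shows "seminorm i j h \<le> B"
  unfolding Cinf_seminorm_def by (rule cSup_least) (use assms in auto)

lemma bdd_above_tensor_norm:
  assumes "h \<in> SF" shows "bdd_above (insert 0 (\<tau> j h ` closure (V i)))"
proof -
  obtain B where "\<And>p. p \<in> closure (V i) \<Longrightarrow> \<tau> j h p \<le> B"
    by (rule tensor_norm_bounded_on_compact[OF assms compact_V], rule that)
  then have "bdd_above (\<tau> j h ` closure (V i))" by (rule bdd_aboveI2)
  then show ?thesis by simp
qed

lemma tensor_norm_le_seminorm: "h \<in> SF \<Longrightarrow> p \<in> closure (V i) \<Longrightarrow> \<tau> j h p \<le> seminorm i j h"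
  unfolding Cinf_seminorm_def by (rule cSup_upper[OF _ bdd_above_tensor_norm]) auto

lemma seminorm_nonneg: "h \<in> SF \<Longrightarrow> 0 \<le> seminorm i j h"
  unfolding Cinf_seminorm_def by (rule cSup_upper[OF _ bdd_above_tensor_norm]) auto

lemma smooth_diff_functions: "h \<in> SF \<Longrightarrow> k \<in> SF \<Longrightarrow> (\<lambda>x. h x - k x) \<in> SF"
  using smooth_functions_combination[of h k 1 "-1"] by simp

lemma seminorm_add:
  assumes h: "h \<in> SF" and k: "k \<in> SF"
  shows "seminorm i j (\<lambda>x. h x + k x) \<le> seminorm i j h + seminorm i j k"
proof (rule seminorm_least)
  fix p assume p: "p \<in> closure (V i)"
  have "\<tau> j (\<lambda>x. h x + k x) p \<le> \<tau> j h p + \<tau> j k p"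
    using tensor_norm_combination[OF h k, of j 1 1 p] by simp
  then show "\<tau> j (\<lambda>x. h x + k x) p \<le> seminorm i j h + seminorm i j k"
    using tensor_norm_le_seminorm[OF h p, of j] tensor_norm_le_seminorm[OF k p, of j] by linarith
qed (simp add: seminorm_nonneg h k)

lemma topspace_X: "topspace Xinf = SF"
  by (rule topspace_Cinf_topology[OF smooth_manifold affine_connection riemannian_metric])

text \<open>In charts \<open>U t h\<close> is \<open>h\<close> composed with the coordinate form of
  \<open>\<Phi> t\<close>. Four comparisons are chained, all uniform in \<open>h\<close>: tensor
  norm by jets, the coordinate form of \<open>U t h\<close>, the chain rule, and jets by tensor
  norms at the image point.\<close>

lemma koopman_local_bound:
  "\<exists>N. open N \<and> p \<in> N \<and> dominated (SF \<times> N) (\<lambda>z. \<tau> j (U t (fst z)) (snd z))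
     (\<lambda>z. \<Sum>l\<le>j. \<tau> l (fst z) (\<Phi> t (snd z)))"
proof -
  obtain c d where c: "c \<in> A" "p \<in> fst c" and d: "d \<in> A" "\<Phi> t p \<in> fst d" using ex_chart by meson
  obtain W where W: "open W" "p \<in> W" "W \<subseteq> fst c" "\<Phi> t ` W \<subseteq> fst d"
    and G: "smooth (snd c ` W) (\<lambda>y. snd d (\<Phi> t (chart_inv c y)))"
    using smooth_map_at_charts[OF smooth_flow c d] by blast
  let ?G = "\<lambda>y. snd d (\<Phi> t (chart_inv c y))" and ?S = "snd c ` W" and ?T = "snd d ` fst d"
  obtain r N where r: "r > 0" "cball (snd c p) r \<subseteq> ?S" and N: "open N" "p \<in> N" "N \<subseteq> W"
    and q: "\<And>q. q \<in> N \<Longrightarrow> snd c q \<in> cball (snd c p) r \<and> chart_inv c (snd c q) = q"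
    by (rule chart_cball[OF c(1) W(1-3)], rule that)
  let ?K = "cball (snd c p) r"
  have oS: "open ?S" and oT: "open ?T"
    using open_chart_image[OF c(1) W(1,3)] open_im[OF d(1)] by auto
  have in_dom: "\<Phi> t (chart_inv c y) \<in> fst d" if "y \<in> ?S" for y
    using that W inv_chart[OF c(1)] by (auto simp: subset_iff image_subset_iff)
  then have GT: "?G ` ?S \<subseteq> ?T" by blast
  have KD: "?K \<subseteq> snd c ` fst c" using r(2) W(3) by blast
  have K': "compact (?G ` ?K)"
    by (rule compact_continuous_image[OF continuous_on_subset[OF smooth_continuous[OF G] r(2)] compact_cball])
  have K'T: "?G ` ?K \<subseteq> ?T" using GT image_mono[OF r(2)] by (rule order_trans[rotated])
  have "dominated (SF \<times> ?K) (\<lambda>z. \<tau> j (U t (fst z)) (chart_inv c (snd z)))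
      (\<lambda>z. jet_norm j (\<lambda>y. U t (fst z) (chart_inv c y)) (snd z))"
    using dominated_reparam[OF dominated_tensor_norm_jet_norm[OF c(1) compact_cball KD, of j],
        of "SF \<times> ?K" "\<lambda>z. (U t (fst z), snd z)"] smooth_koopman by auto
  moreover have "dominated (SF \<times> ?K) (\<lambda>z. jet_norm j (\<lambda>y. U t (fst z) (chart_inv c y)) (snd z))
      (\<lambda>z. jet_norm j (\<lambda>y. fst z (chart_inv d (?G y))) (snd z))"
  proof (rule dominated_le, rule eq_refl, rule jet_norm_cong[OF oS])
    fix z y assume "y \<in> ?S"
    then show "U t (fst z) (chart_inv c y) = fst z (chart_inv d (?G y))"
      using inv_chart[OF d(1) in_dom] by (simp add: koopman_def)
  qed (use r(2) in auto)
  moreover have "dominated (SF \<times> ?K) (\<lambda>z. jet_norm j (\<lambda>y. fst z (chart_inv d (?G y))) (snd z))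
      (\<lambda>z. jet_norm j (\<lambda>y. fst z (chart_inv d y)) (?G (snd z)))"
    using dominated_reparam[OF dominated_chain[OF oS oT G GT compact_cball r(2), of j],
        of "SF \<times> ?K" "\<lambda>z. (\<lambda>y. fst z (chart_inv d y), snd z)"] smooth_function_chart[OF _ d(1)] by auto
  moreover have "dominated (SF \<times> ?K) (\<lambda>z. jet_norm j (\<lambda>y. fst z (chart_inv d y)) (?G (snd z)))
      (\<lambda>z. \<Sum>l\<le>j. \<tau> l (fst z) (chart_inv d (?G (snd z))))"
    using dominated_reparam[OF dominated_jet_norm_tensor_norm[OF d(1) K' K'T, of j],
        of "SF \<times> ?K" "\<lambda>z. (fst z, ?G (snd z))"] by auto
  ultimately have "dominated (SF \<times> ?K) (\<lambda>z. \<tau> j (U t (fst z)) (chart_inv c (snd z)))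
      (\<lambda>z. \<Sum>l\<le>j. \<tau> l (fst z) (chart_inv d (?G (snd z))))"
    using dominated_trans by blast
  then have dN: "dominated (SF \<times> N) (\<lambda>z. \<tau> j (U t (fst z)) (chart_inv c (snd c (snd z))))
      (\<lambda>z. \<Sum>l\<le>j. \<tau> l (fst z) (chart_inv d (?G (snd c (snd z)))))"
    using dominated_reparam[of "SF \<times> ?K" _ _ "SF \<times> N" "\<lambda>z. (fst z, snd c (snd z))"] q by fastforce
  have "dominated (SF \<times> N) (\<lambda>z. \<tau> j (U t (fst z)) (snd z)) (\<lambda>z. \<Sum>l\<le>j. \<tau> l (fst z) (chart_inv d (?G (snd c (snd z)))))"
    by (rule dominated_le_left[OF _ dN]) (use q in auto)
  then have "dominated (SF \<times> N) (\<lambda>z. \<tau> j (U t (fst z)) (snd z)) (\<lambda>z. \<Sum>l\<le>j. \<tau> l (fst z) (\<Phi> t (snd z)))"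
  proof (rule dominated_le_right)
    fix z assume "z \<in> SF \<times> N"
    then have z: "snd z \<in> N" by auto
    have "\<Phi> t (snd z) \<in> fst d" using z N W by auto
    then show "(\<Sum>l\<le>j. \<tau> l (fst z) (chart_inv d (?G (snd c (snd z))))) \<le> (\<Sum>l\<le>j. \<tau> l (fst z) (\<Phi> t (snd z)))"
      using q[OF z] inv_chart[OF d(1)] by simp
  qed
  then show ?thesis using N by blast
qed

text \<open>The image of the compact set \<open>closure (V i)\<close> under \<open>\<Phi> t\<close>
  lies in some \<open>V i'\<close>, and compactness of \<open>closure (V i)\<close> makes the local
  bounds uniform.\<close>

lemma koopman_seminorm_bound:
  obtains i' C where "0 \<le> C" "\<And>h. h \<in> SF \<Longrightarrow> seminorm i j (U t h) \<le> C * (\<Sum>l\<le>j. seminorm i' l h)"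
proof -
  have "continuous_on UNIV (\<Phi> t)"
  proof (rule continuous_at_imp_continuous_on, rule ballI)
    fix p obtain c d where c: "c \<in> A" "p \<in> fst c" and d: "d \<in> A" "\<Phi> t p \<in> fst d" using ex_chart by meson
    obtain W where "open W" "p \<in> W" "continuous_on W (\<Phi> t)"
      using smooth_map_at_charts[OF smooth_flow c d] by blast
    then show "isCont (\<Phi> t) p" using continuous_on_eq_continuous_at by blast
  qed
  then have "compact (\<Phi> t ` closure (V i))"
    by (intro compact_continuous_image compact_V) (auto elim: continuous_on_subset)
  then obtain i' where i': "\<Phi> t ` closure (V i) \<subseteq> V i'" by (rule compact_subset_V)
  have "dominated (SF \<times> closure (V i)) (\<lambda>z. \<tau> j (U t (fst z)) (snd z)) (\<lambda>z. \<Sum>l\<le>j. \<tau> l (fst z) (\<Phi> t (snd z)))"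
    by (rule dominated_compact[OF compact_V koopman_local_bound]) (auto intro!: sum_nonneg tensor_norm_nonneg)
  then obtain C where C: "C \<ge> 0" "\<forall>z\<in>SF \<times> closure (V i). \<tau> j (U t (fst z)) (snd z) \<le> C * (\<Sum>l\<le>j. \<tau> l (fst z) (\<Phi> t (snd z)))"
    unfolding dominated_def by blast
  have "seminorm i j (U t h) \<le> C * (\<Sum>l\<le>j. seminorm i' l h)" if h: "h \<in> SF" for h
  proof (rule seminorm_least)
    fix p assume p: "p \<in> closure (V i)"
    then have "\<Phi> t p \<in> closure (V i')" using i' closure_subset by blast
    then have "C * (\<Sum>l\<le>j. \<tau> l h (\<Phi> t p)) \<le> C * (\<Sum>l\<le>j. seminorm i' l h)"
      using C(1) h by (intro mult_left_mono sum_mono tensor_norm_le_seminorm)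
    moreover have "\<tau> j (U t h) p \<le> C * (\<Sum>l\<le>j. \<tau> l h (\<Phi> t p))" using C(2) h p by fastforce
    ultimately show "\<tau> j (U t h) p \<le> C * (\<Sum>l\<le>j. seminorm i' l h)" by linarith
  next
    show "0 \<le> C * (\<Sum>l\<le>j. seminorm i' l h)" using C(1) h by (intro mult_nonneg_nonneg sum_nonneg seminorm_nonneg)
  qed
  then show ?thesis using that C(1) by blast
qed

lemma openin_seminorm_ball:
  assumes "h \<in> SF" "\<epsilon> > 0"
  shows "openin Xinf {k \<in> SF. seminorm i j (\<lambda>x. k x - h x) < \<epsilon>}"
  unfolding Cinf_topology_def using assms by (intro topology_generated_by_Basis) blast

lemma koopman_continuous: "continuous_map Xinf Xinf (U t)"
proof -
  have "continuous_map Xinf (topology_generated_by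
     {{k \<in> SF. seminorm i j (\<lambda>x. k x - h x) < \<epsilon>} | i j h \<epsilon>. h \<in> SF \<and> \<epsilon> > 0}) (U t)"
  proof (rule continuous_on_generated_topo)
    fix B assume "B \<in> {{k \<in> SF. seminorm i j (\<lambda>x. k x - h x) < \<epsilon>} | i j h \<epsilon>. h \<in> SF \<and> \<epsilon> > 0}"
    then obtain i j h \<epsilon> where B: "B = {k \<in> SF. seminorm i j (\<lambda>x. k x - h x) < \<epsilon>}" and h: "h \<in> SF" and "\<epsilon> > 0"
      by blast
    obtain i' C where C: "0 \<le> C" "\<And>h. h \<in> SF \<Longrightarrow> seminorm i j (U t h) \<le> C * (\<Sum>l\<le>j. seminorm i' l h)"
      by (rule koopman_seminorm_bound, rule that)
    show "openin Xinf (U t -` B \<inter> topspace Xinf)"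
      unfolding topspace_X
    proof (subst openin_subopen, intro ballI)
      fix k assume "k \<in> U t -` B \<inter> SF"
      then have k: "k \<in> SF" and kB: "seminorm i j (\<lambda>x. U t k x - h x) < \<epsilon>" by (auto simp: B)
      \<comment> \<open>\<open>U t k\<close> is in general off the centre \<open>h\<close> of the
        ball, so only the gap up to \<open>\<epsilon>\<close> is available. It is shared among the
        \<open>j + 1\<close> seminorms of the bound; \<open>C + 1\<close> avoids division by
        0.\<close>
      define \<delta> where "\<delta> = (\<epsilon> - seminorm i j (\<lambda>x. U t k x - h x)) / ((C + 1) * (real j + 1))"
      have \<delta>: "\<delta> > 0" using kB C(1) by (simp add: \<delta>_def)
      have C\<delta>: "C * ((real j + 1) * \<delta>) \<le> \<epsilon> - seminorm i j (\<lambda>x. U t k x - h x)"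
      proof -
        have "C * ((real j + 1) * \<delta>) \<le> (C + 1) * ((real j + 1) * \<delta>)" using \<delta> by (intro mult_right_mono) auto
        also have "\<dots> = \<epsilon> - seminorm i j (\<lambda>x. U t k x - h x)" using C(1) by (simp add: \<delta>_def)
        finally show ?thesis .
      qed
      let ?T = "\<Inter>l\<in>{..j}. {k' \<in> SF. seminorm i' l (\<lambda>x. k' x - k x) < \<delta>}"
      have "openin Xinf ?T" using openin_seminorm_ball[OF k \<delta>] by (intro openin_INT2) auto
      moreover have "k \<in> ?T"
        using k \<delta> Cinf_seminorm_zero_function[OF smooth_manifold affine_connection riemannian_metric] by simp
      moreover have "?T \<subseteq> U t -` B \<inter> SF"
      proof
        fix k' assume T: "k' \<in> ?T"
        then have k': "k' \<in> SF" and l: "\<And>l. l \<le> j \<Longrightarrow> seminorm i' l (\<lambda>x. k' x - k x) < \<delta>" by auto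
        have d: "(\<lambda>x. k' x - k x) \<in> SF" by (rule smooth_diff_functions[OF k' k])
        have "(\<lambda>x. U t k' x - h x) = (\<lambda>x. U t (\<lambda>x. k' x - k x) x + (U t k x - h x))"
          by (simp add: koopman_def)
        then have "seminorm i j (\<lambda>x. U t k' x - h x)
          \<le> seminorm i j (U t (\<lambda>x. k' x - k x)) + seminorm i j (\<lambda>x. U t k x - h x)"
          using seminorm_add[OF smooth_koopman[OF d, of t] smooth_diff_functions[OF smooth_koopman[OF k, of t] h], of i j] by simp
        moreover have "seminorm i j (U t (\<lambda>x. k' x - k x)) < \<epsilon> - seminorm i j (\<lambda>x. U t k x - h x)"
        proof (cases "C = 0")
          case True
          then show ?thesis using C(2)[OF d] kB by simp
        next
          case False
          have "(\<Sum>l\<le>j. seminorm i' l (\<lambda>x. k' x - k x)) < (\<Sum>l\<le>j. \<delta>)" using l by (intro sum_strict_mono) auto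
          then have "C * (\<Sum>l\<le>j. seminorm i' l (\<lambda>x. k' x - k x)) < C * ((real j + 1) * \<delta>)"
            using False C(1) by (intro mult_strict_left_mono) (auto simp: algebra_simps)
          then show ?thesis using C(2)[OF d] C\<delta> by linarith
        qed
        ultimately have "seminorm i j (\<lambda>x. U t k' x - h x) < \<epsilon>" by linarith
        then show "k' \<in> U t -` B \<inter> SF" using k' smooth_koopman by (simp add: B)
      qed
      ultimately show "\<exists>T. openin Xinf T \<and> k \<in> T \<and> T \<subseteq> U t -` B \<inter> SF" by blast
    qed
  next
    have "\<Union> {{k \<in> SF. seminorm i j (\<lambda>x. k x - h x) < \<epsilon>} | i j h \<epsilon>. h \<in> SF \<and> \<epsilon> > 0} = SF"
      using topspace_X unfolding Cinf_topology_def by simp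
    then show "U t ` topspace Xinf \<subseteq> \<Union> {{k \<in> SF. seminorm i j (\<lambda>x. k x - h x) < \<epsilon>} | i j h \<epsilon>. h \<in> SF \<and> \<epsilon> > 0}"
      unfolding topspace_X using smooth_koopman by auto
  qed
  then show ?thesis by (simp only: Cinf_topology_def)
qed

lemma koopman_Aut: "U t \<in> Aut Xinf"
proof -
  have "bounded_operator Xinf (U t)" for t
    unfolding bounded_operator_def using koopman_continuous by (simp add: koopman_def comp_def)
  moreover have "U (- t) (U t h) = h" "U t (U (- t) h) = h" for h
    using koopman_add[of t "- t" h] koopman_add[of "- t" t h] by (simp_all add: koopman_0)
  ultimately show ?thesis unfolding Aut_def by blast
qed

section \<open>Differentiability of the Koopman group\<close>

abbreviation quotient :: "('a \<Rightarrow> real) \<Rightarrow> real \<Rightarrow> 'a \<Rightarrow> real" where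
  "quotient k s x \<equiv> (U s k x - k x) / s - L k x"

lemma smooth_quotient:
  assumes k: "k \<in> SF" shows "quotient k s \<in> SF"
proof -
  have "(\<lambda>x. (1 / s) * U s k x + (- 1 / s) * k x) \<in> SF"
    by (rule smooth_functions_combination[OF smooth_koopman[OF k] k])
  from smooth_diff_functions[OF this smooth_lie_derivative[OF k]] show ?thesis
    by (simp add: diff_divide_distrib)
qed

text \<open>For \<open>s \<noteq> 0\<close> the quotient agrees in coordinates with
  \<open>v s\<close>, a family of class \<open>j\<close> that extends to \<open>s = 0\<close> and
  vanishes there. Its jets are therefore uniformly small on a compact ball for small
  \<open>s\<close>, and they dominate the tensor norm.\<close>

lemma quotient_locally_small:
  assumes k: "k \<in> SF" and e: "e > 0"
  shows "\<exists>N. open N \<and> p \<in> N \<and> (\<forall>\<^sub>F s in at 0. \<forall>q\<in>N. \<tau> j (quotient k s) q \<le> e)"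
proof -
  obtain c where c: "c \<in> A" "p \<in> fst c" using ex_chart by blast
  let ?k = "\<lambda>y. k (chart_inv c y)" and ?Lk = "\<lambda>y. L k (chart_inv c y)"
  obtain a r where a: "a > 0" and r: "r > 0" "ball (snd c p) r \<subseteq> snd c ` fst c"
    and dom: "\<And>s x. s \<in> {-a..a} \<Longrightarrow> x \<in> ball (snd c p) r \<Longrightarrow> \<Phi> s (chart_inv c x) \<in> fst c"
    and sm: "\<And>k. param_Ck k {-a..a} (ball (snd c p) r) (\<lambda>s x. snd c (\<Phi> s (chart_inv c x)))"
    by (rule local_flow[OF c], rule that)
  let ?J = "{-a..a}" and ?B = "ball (snd c p) r" and ?K = "cball (snd c p) (r / 2)"
  have KB: "?K \<subseteq> ?B" using r(1) by auto
  have KD: "?K \<subseteq> snd c ` fst c" using KB r(2) by blast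
  have sL: "smooth (snd c ` fst c) ?Lk" by (rule smooth_function_chart[OF smooth_lie_derivative[OF k] c(1)])
  define w where "w s x = L k (\<Phi> s (chart_inv c x))" for s x
  have "param_Ck j ?J ?B (\<lambda>s x. ?Lk (snd c (\<Phi> s (chart_inv c x))))"
    by (rule param_Ck_chain[OF open_ball open_im[OF c(1)] smooth_imp_param_Ck[OF sL] sm]) (use dom in blast)
  then have w: "param_Ck j ?J ?B w"
    by (rule param_Ck_cong[OF open_ball, THEN iffD1, rotated]) (simp add: w_def inv_chart[OF c(1) dom])
  define m where "m s x = integral {0..1} (\<lambda>\<theta>. w (\<theta> * s) x)" for s x
  have J: "\<theta> * s \<in> ?J" if "\<theta> \<in> {0..1}" "s \<in> ?J" for \<theta> s
  proof -
    have "\<bar>\<theta> * s\<bar> \<le> 1 * a" unfolding abs_mult using that by (intro mult_mono) auto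
    then show ?thesis by (auto simp: abs_le_iff)
  qed
  have "param_Ck j ({0..1} \<times> ?J) ?B (\<lambda>z. w (fst z * snd z))"
    by (rule param_Ck_reparam[OF _ _ w]) (use J in \<open>auto intro!: continuous_intros\<close>)
  then have m: "param_Ck j ?J ?B m"
    unfolding m_def using param_Ck_integral[OF open_ball convex_ball, of j ?J "snd c p" r "\<lambda>z. w (fst z * snd z)"] by simp
  define v where "v s x = m s x - ?Lk x" for s x
  have v: "param_Ck j ?J ?B v"
    unfolding v_def by (intro param_Ck_diff[OF open_ball m] smooth_imp_param_Ck smooth_subset[OF sL r(2)])
  have v0: "v 0 x = 0" for x by (simp add: v_def m_def w_def flow_0)
  have vq: "quotient k s (chart_inv c x) = v s x" if s: "s \<in> ?J" "s \<noteq> 0" and x: "x \<in> ?B" for s x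
  proof -
    have "((\<lambda>\<theta>. k (\<Phi> (\<theta> * s) (chart_inv c x))) has_vector_derivative s * w (\<theta> * s) x) (at \<theta> within {0..1})" for \<theta>
    proof -
      have "((\<lambda>t. k (\<Phi> t (chart_inv c x))) has_vector_derivative w (\<theta> * s) x) (at (\<theta> * s))"
        unfolding w_def by (rule derivative_along_curve[OF k flow_curve])
      moreover have "((\<lambda>\<theta>. \<theta> * s) has_vector_derivative s) (at \<theta>)"
        by (auto intro!: derivative_eq_intros)
      ultimately have "((\<lambda>t. k (\<Phi> t (chart_inv c x))) \<circ> (\<lambda>\<theta>. \<theta> * s) has_vector_derivative s *\<^sub>R w (\<theta> * s) x) (at \<theta>)"
        by (rule vector_diff_chain_at[rotated])
      then show ?thesis by (simp add: comp_def has_vector_derivative_at_within)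
    qed
    then have "((\<lambda>\<theta>. s * w (\<theta> * s) x) has_integral (k (\<Phi> (1 * s) (chart_inv c x)) - k (\<Phi> (0 * s) (chart_inv c x)))) {0..1}"
      by (intro fundamental_theorem_of_calculus) auto
    from integral_unique[OF this] have "s * m s x = U s k (chart_inv c x) - k (chart_inv c x)"
      by (simp add: m_def flow_0 koopman_def)
    then show ?thesis using s(2) by (simp add: v_def field_simps)
  qed
  have dv: "jet_norm j (\<lambda>y. quotient k s (chart_inv c y)) x = jet_norm j (v s) x" if "s \<in> ?J" "s \<noteq> 0" "x \<in> ?K" for s x
    by (rule jet_norm_cong[OF open_ball]) (use that vq KB in auto)
  obtain C where C: "C \<ge> 0" "\<forall>z\<in>SF \<times> ?K. \<tau> j (fst z) (chart_inv c (snd z)) \<le> C * jet_norm j (\<lambda>y. fst z (chart_inv c y)) (snd z)"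
    using dominated_tensor_norm_jet_norm[OF c(1) compact_cball KD, of j] unfolding dominated_def by blast
  define e' where "e' = e / (C + 1)"
  have e': "e' > 0" "C * e' \<le> e" using e C(1) by (auto simp: e'_def field_simps)
  have zJ: "0 \<in> ?J" using a by simp
  have vc: "continuous_on (?J \<times> ?K) (\<lambda>z. jet_norm j (v (fst z)) (snd z))"
    using continuous_on_subset[OF continuous_jet_norm[OF v], of "?J \<times> ?K"] KB by (auto simp: split_beta)
  \<comment> \<open>Compactness of the ball gives one neighbourhood of \<open>s = 0\<close> that
    serves all its points; the jet norm of \<open>v 0\<close> is 0.\<close>
  obtain X0 where X0: "0 \<in> X0" "open X0"
    "\<forall>s\<in>X0 \<inter> ?J. \<forall>x\<in>?K. dist (jet_norm j (v s) x) (jet_norm j (v 0) x) \<le> e'"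
    by (rule continuous_on_prod_compactE[OF vc compact_cball zJ e'(1)]) (rule that, simp_all)
  obtain r' N where N: "open N" "p \<in> N" "N \<subseteq> fst c \<inter> snd c -` ball (snd c p) (r / 2)"
    and q: "\<And>q. q \<in> N \<Longrightarrow> snd c q \<in> cball (snd c p) r' \<and> chart_inv c (snd c q) = q"
    by (rule chart_cball[OF c(1) open_chart_vimage[OF c(1) open_ball, of "snd c p" "r / 2"], of p])
      (use c r(1) in auto)
  have "\<tau> j (quotient k s) q' \<le> e" if s: "s \<in> X0 \<inter> ?J" "s \<noteq> 0" and q': "q' \<in> N" for s q'
  proof -
    have x: "snd c q' \<in> ?K" using q' N(3) by auto
    have "v 0 = (\<lambda>y. 0)" by (rule ext) (rule v0)
    then have v0': "jet_norm j (v 0) y = 0" for y by (simp only: jet_norm_0)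
    have "dist (jet_norm j (v s) (snd c q')) (jet_norm j (v 0) (snd c q')) \<le> e'" using X0(3) s(1) x by blast
    then have "jet_norm j (v s) (snd c q') \<le> e'" unfolding v0' dist_real_def by simp
    then have d: "jet_norm j (\<lambda>y. quotient k s (chart_inv c y)) (snd c q') \<le> e'" using dv s x by simp
    have "\<tau> j (quotient k s) (chart_inv c (snd c q')) \<le> C * jet_norm j (\<lambda>y. quotient k s (chart_inv c y)) (snd c q')"
      using C(2)[rule_format, of "(quotient k s, snd c q')"] smooth_quotient[OF k, of s] x by simp
    also have "\<dots> \<le> C * e'" using d C(1) by (rule mult_left_mono)
    finally show ?thesis using e'(2) q[OF q'] by simp
  qed
  moreover have "\<forall>\<^sub>F s in at 0. s \<in> X0 \<inter> {-a<..<a} \<and> s \<noteq> 0"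
    unfolding eventually_at_topological using X0 a by (intro exI[of _ "X0 \<inter> {-a<..<a}"]) auto
  ultimately have "\<forall>\<^sub>F s in at 0. \<forall>q\<in>N. \<tau> j (quotient k s) q \<le> e"
    by (elim eventually_mono) auto
  then show ?thesis using N by blast
qed

text \<open>The admissible times depend on the neighbourhood, but finitely many neighbourhoods cover
  the compact set, and finitely many eventual statements hold together.\<close>

lemma quotient_small:
  assumes k: "k \<in> SF" and e: "e > 0"
  shows "\<forall>\<^sub>F s in at 0. seminorm i j (quotient k s) \<le> e"
proof -
  have "\<forall>p. \<exists>N. open N \<and> p \<in> N \<and> (\<forall>\<^sub>F s in at 0. \<forall>q\<in>N. \<tau> j (quotient k s) q \<le> e)"
    using quotient_locally_small[OF k e] by blast
  from choice[OF this] obtain N where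
    N: "\<And>p. open (N p)" "\<And>p. p \<in> N p" "\<And>p. \<forall>\<^sub>F s in at 0. \<forall>q\<in>N p. \<tau> j (quotient k s) q \<le> e"
    by blast
  obtain P where P: "finite P" "closure (V i) \<subseteq> (\<Union>p\<in>P. N p)"
    by (rule compactE_image[OF compact_V, of UNIV N i]) (auto intro: N(1,2))
  have "\<forall>\<^sub>F s in at 0. \<forall>p\<in>P. \<forall>q\<in>N p. \<tau> j (quotient k s) q \<le> e"
    using P(1) N(3) by (intro eventually_ball_finite) auto
  then show ?thesis
  proof (elim eventually_mono)
    fix s assume *: "\<forall>p\<in>P. \<forall>q\<in>N p. \<tau> j (quotient k s) q \<le> e"
    show "seminorm i j (quotient k s) \<le> e"
      by (rule seminorm_least) (use * P(2) e in auto)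
  qed
qed

lemma koopman_derivative: "has_strong_derivative Xinf U (U t \<circ> L) t"
  unfolding has_strong_derivative_def topspace_X
proof
  fix h assume h: "h \<in> SF"
  let ?k = "U t h" and ?\<S> = "{{k \<in> SF. seminorm i j (\<lambda>x. k x - h x) < \<epsilon>} | i j h \<epsilon>. h \<in> SF \<and> \<epsilon> > 0}"
  have k: "?k \<in> SF" by (rule smooth_koopman[OF h])
  have Lk: "L ?k \<in> SF" by (rule smooth_lie_derivative[OF k])
  let ?q = "\<lambda>s x. (U s h x - U t h x) / (s - t)"
  have q: "?q s \<in> SF" for s
  proof -
    have "(\<lambda>x. (1 / (s - t)) * U s h x + (- 1 / (s - t)) * ?k x) \<in> SF"
      by (rule smooth_functions_combination[OF smooth_koopman[OF h] k])
    then show ?thesis by (simp add: diff_divide_distrib)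
  qed
  have "limitin (topology_generated_by ?\<S>) ?q (L ?k) (at t)"
  proof (rule limitin_generated)
    show "L ?k \<in> \<Union>?\<S>" using topspace_X Lk unfolding Cinf_topology_def by simp
    fix B assume "B \<in> ?\<S>" "L ?k \<in> B"
    then obtain i j h0 \<epsilon> where B: "B = {k \<in> SF. seminorm i j (\<lambda>x. k x - h0 x) < \<epsilon>}" and h0: "h0 \<in> SF"
      and lt: "seminorm i j (\<lambda>x. L ?k x - h0 x) < \<epsilon>" by blast
    \<comment> \<open>Half of the gap, since the quotient is bounded by a weak inequality and the
      result must be strict.\<close>
    define e where "e = (\<epsilon> - seminorm i j (\<lambda>x. L ?k x - h0 x)) / 2"
    have e: "e > 0" using lt by (simp add: e_def)
    have "\<forall>\<^sub>F s in at t. seminorm i j (quotient ?k (s - t)) \<le> e"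
      using quotient_small[OF k e] unfolding eventually_at_to_0[of _ t] by simp
    then show "\<forall>\<^sub>F s in at t. ?q s \<in> B"
    proof (elim eventually_mono)
      fix s assume s: "seminorm i j (quotient ?k (s - t)) \<le> e"
      \<comment> \<open>The group law moves the base time from \<open>t\<close> to 0, with
        \<open>U t h\<close> in place of \<open>h\<close>.\<close>
      have "U s h = U (s - t) ?k" using koopman_add[of t "s - t" h] by simp
      then have "(\<lambda>x. ?q s x - h0 x) = (\<lambda>x. quotient ?k (s - t) x + (L ?k x - h0 x))" by auto
      then have "seminorm i j (\<lambda>x. ?q s x - h0 x) \<le> e + seminorm i j (\<lambda>x. L ?k x - h0 x)"
        using seminorm_add[OF smooth_quotient[OF k, of "s - t"] smooth_diff_functions[OF Lk h0], of i j] s by simp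
      also have "\<dots> < \<epsilon>" using lt by (simp add: e_def field_simps)
      finally show "?q s \<in> B" using q by (simp add: B)
    qed
  qed
  then show "limitin Xinf ?q ((U t \<circ> L) h) (at t)"
    by (simp add: Cinf_topology_def koopman_lie_derivative[OF h])
qed

end

text \<open>Charts take values in {0} and are injective, so chart domains are single points and the
  manifold is discrete. A continuous curve on the connected real line is then constant, the flow is
  the identity, and the Lie derivative, taken along the zero field, vanishes: both sides of the
  equation are 0.\<close>

lemma koopman_dimension_zero:
  fixes A :: "('a::{t2_space,second_countable_topology}, 'e::euclidean_space) chart set"
  assumes M: "smooth_manifold {0} A" and "smooth_vector_field {0} A f" "complete_vector_field A f"
    and "riemannian_metric {0} A g" "affine_connection {0} A \<Gamma>"
  shows "koopman A f t \<in> Aut (Cinf_topology {0} A g \<Gamma> V) \<and>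
    has_strong_derivative (Cinf_topology {0} A g \<Gamma> V) (koopman A f) (koopman A f t \<circ> lie_derivative {0} A f) t \<and>
    (\<forall>h \<in> smooth_functions {0} A. koopman A f t (lie_derivative {0} A f h) = lie_derivative {0} A f (koopman A f t h))"
proof -
  let ?X = "Cinf_topology {0} A g \<Gamma> V"
  have top: "topspace ?X = smooth_functions {0} A" by (rule topspace_Cinf_topology[OF M assms(5,4)])
  have chart: "chart_at A p \<in> A" "p \<in> fst (chart_at A p)" for p using chart_at_in_atlas[OF M] by auto
  have discrete: "open {p}" for p :: 'a
  proof -
    let ?c = "chart_at A p"
    have c: "open (fst ?c)" "openin (top_of_set {0}) (snd ?c ` fst ?c)"
      "homeomorphism (fst ?c) (snd ?c ` fst ?c) (snd ?c) (chart_inv ?c)"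
      using M chart[of p] unfolding smooth_manifold_def is_chart_def by auto
    have "q = p" if "q \<in> fst ?c" for q
    proof -
      have "snd ?c q = 0" "snd ?c p = 0" using openin_imp_subset[OF c(2)] that chart by auto
      then show ?thesis using c(3) that chart[of p] unfolding homeomorphism_def by metis
    qed
    then have "fst ?c = {p}" using chart[of p] by blast
    then show ?thesis using c(1) by simp
  qed
  have const: "\<gamma> = (\<lambda>_. x)" if "integral_curve A f \<gamma>" "\<gamma> 0 = x" for \<gamma> x
  proof -
    have \<gamma>: "continuous_on UNIV \<gamma>" using that unfolding integral_curve_def by blast
    have "open (\<gamma> -` {x})" by (rule open_vimage[OF discrete \<gamma>])
    moreover have "open (- {x})" by (rule open_Compl[OF closed_singleton])
    from open_vimage[OF this \<gamma>] have "closed (\<gamma> -` {x})" unfolding closed_def by (simp add: vimage_Compl)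
    ultimately have "\<gamma> -` {x} = UNIV" using clopen[of "\<gamma> -` {x}"] that(2) by blast
    then show ?thesis by auto
  qed
  have "flow A f t x = x" for t x
  proof -
    obtain \<gamma> where \<gamma>: "integral_curve A f \<gamma>" "\<gamma> 0 = x" using assms(3) unfolding complete_vector_field_def by blast
    have "(THE \<gamma>. integral_curve A f \<gamma> \<and> \<gamma> 0 = x) = (\<lambda>_. x)"
    proof (rule the_equality)
      show "integral_curve A f (\<lambda>_. x) \<and> x = x" using \<gamma>(1) unfolding const[OF \<gamma>] by simp
      show "\<delta> = (\<lambda>_. x)" if "integral_curve A f \<delta> \<and> \<delta> 0 = x" for \<delta>
        using that by (intro const) auto
    qed
    then show ?thesis by (simp add: flow_def)
  qed
  then have U: "koopman A f t = (\<lambda>h. h)" for t by (auto simp: koopman_def comp_def)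
  have L: "lie_derivative {0} A f h = (\<lambda>_. 0)" for h
  proof
    fix p
    have "f (chart_at A p) p = 0" using assms(2) chart unfolding smooth_vector_field_def by blast
    then show "lie_derivative {0} A f h p = 0" by (simp add: lie_derivative_def Let_def dir_deriv_zero_space)
  qed
  have "Ck_on k {0} S (\<lambda>_. 0 :: real)" for k and S :: "'e set"
    by (induction k) (simp_all add: dir_deriv_zero_space)
  then have "(\<lambda>_. 0) \<in> smooth_functions {0} A" by (simp add: smooth_functions_def smooth_on_def comp_def)
  then have "has_strong_derivative ?X (koopman A f) (koopman A f t \<circ> lie_derivative {0} A f) t"
    unfolding has_strong_derivative_def by (simp add: U L top)
  moreover have "bounded_operator ?X (\<lambda>h. h)" unfolding bounded_operator_def using continuous_map_id[of ?X] by (simp add: id_def)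
  then have "(\<lambda>h. h) \<in> Aut ?X" unfolding Aut_def by blast
  ultimately show ?thesis by (simp add: U L)
qed

theorem theorem2:
  fixes E :: "'e::euclidean_space set"
    and A :: "('a::{t2_space,second_countable_topology}, 'e) chart set"
    and f :: "('a, 'e) chart \<Rightarrow> 'a \<Rightarrow> 'e"
    and g :: "('a, 'e) chart \<Rightarrow> 'a \<Rightarrow> 'e \<Rightarrow> 'e \<Rightarrow> real"
    and \<Gamma> :: "('a, 'e) chart \<Rightarrow> 'a \<Rightarrow> 'e \<Rightarrow> 'e \<Rightarrow> 'e"
    and V :: "nat \<Rightarrow> 'a set"
  assumes "smooth_manifold E A"
    and "smooth_vector_field E A f" and "complete_vector_field A f"
    and "riemannian_metric E A g" and "affine_connection E A \<Gamma>" and "exhaustion V"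
  shows "\<forall>t. koopman A f t \<in> Aut (Cinf_topology E A g \<Gamma> V) \<and>
             has_strong_derivative (Cinf_topology E A g \<Gamma> V) (koopman A f)
               (koopman A f t \<circ> lie_derivative E A f) t \<and>
             (\<forall>h \<in> smooth_functions E A.
                koopman A f t (lie_derivative E A f h) = lie_derivative E A f (koopman A f t h))"
proof -
  consider "E = UNIV" | "E = {0}" using assms(1) by (auto simp: smooth_manifold_def model_space_def)
  then show ?thesis
  proof cases
    case 1
    interpret koopman_system A f g \<Gamma> V
      using assms unfolding 1 by unfold_locales
    show ?thesis unfolding 1 using koopman_Aut koopman_derivative koopman_lie_derivative by blast
  next
    case 2
    show ?thesis using koopman_dimension_zero assms(1-5) unfolding 2 by blast
  qed
qed

end
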